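(* Let $\mathbf{i}\in R(w_0)$. Then the set consisting of all PBW $\mathbf{i}$-linearity domains together with all their faces forms a fan in $\mathbb{R}^N$.
   Context: $W=S_{n+1}$ is the Weyl group of type $A_n$ with simple reflections $s_1,\dots,s_n$, $w_0$ its longest element, $N$ the length of $w_0$, and $R(w_0)$ the set of reduced decompositions $\mathbf{i}=(i_1,\dots,i_N)$ of $w_0$. Reparametrization functions. For $\mathbf{i},\mathbf{i}'\in R(w_0)$, Lusztig's piecewise-linear function $R_{\mathbf{i}}^{\mathbf{i}'}:\mathbb{R}^N\to\mathbb{R}^N$ is the composite, along any sequence of braid moves from $\mathbf{i}$ to $\mathbf{i}'$ (the result is independent of the sequence), of the maps swapping $a_k,a_{k+1}$ when adjacent entries $i_k,i_{k+1}$ with $|i_k-i_{k+1}|>1$ are interchanged, and replacing $(a_k,a_{k+1},a_{k+2})$ by $(a_{k+1}+a_{k+2}-\mu,\ \mu,\ a_k+a_{k+1}-\mu)$, $\mu=\min(a_k,a_{k+2})$, when $(i_k,i_{k+1},i_{k+2})=(i,j,i)$ with $|i-j|=1$ is replaced by $(j,i,j)$. Linearity domains. A PBW $\mathbf{i}$-wall is a hyperplane $a_k=a_{k+2}$ in $\mathbb{R}^N$ for an index $k$ with $i_k=i_{k+2}=i_{k+1}\pm1$. A point $\mathbf{m}\in\mathbb{R}_{>0}^N$ is PBW $\mathbf{i}$-regular if for every $\mathbf{i}'\in R(w_0)$ the point $R_{\mathbf{i}}^{\mathbf{i}'}(\mathbf{m})$ lies on no PBW $\mathbf{i}'$-wall.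 The PBW $\mathbf{i}$-linearity domains are the closures of the connected components of the set of PBW $\mathbf{i}$-regular points (each is a convex polyhedral cone in $\mathbb{R}_{\ge0}^N$). Fans. A strongly convex polyhedral cone is a convex polyhedral cone $C$ such that $0\neq v\in C$ implies $-v\notin C$. A set of strongly convex polyhedral cones forms a fan if every face of every cone in the set lies in the set, and the intersection of any two cones in the set lies again in the set. *)

theory Defs
  imports "HOL-Analysis.Analysis" "HOL-Combinatorics.Permutations"
begin

text \<open>
  The Weyl group of type \<open>A\<^sub>n\<close> is the group of permutations of \<open>{1..n+1}\<close>, realised as functions
  on \<^typ>\<open>nat\<close> fixing all other points.  Words in the simple reflections \<open>s\<^sub>1, \<dots>, s\<^sub>n\<close> are lists
  over \<open>{1..n}\<close>.  List positions start at 0, so the entries called \<open>i\<^sub>1, \<dots>, i\<^sub>N\<close> in the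
  literature are \<open>w ! 0, \<dots>, w ! (N - 1)\<close>.
\<close>

definition simple_refl :: "nat \<Rightarrow> nat \<Rightarrow> nat" where
  "simple_refl i = Transposition.transpose i (i + 1)"

definition word_perm :: "nat list \<Rightarrow> nat \<Rightarrow> nat" where
  "word_perm w = foldr (\<lambda>i p. simple_refl i \<circ> p) w id"

definition weyl_length :: "nat \<Rightarrow> (nat \<Rightarrow> nat) \<Rightarrow> nat" where
  "weyl_length n p =
     (LEAST l. \<exists>w. set w \<subseteq> {1..n} \<and> word_perm w = p \<and> length w = l)"

definition longest_elt :: "nat \<Rightarrow> nat \<Rightarrow> nat" where
  "longest_elt n = (ARG_MAX (weyl_length n) p. p permutes {1..n + 1})"

definition reduced_words :: "nat \<Rightarrow> (nat \<Rightarrow> nat) \<Rightarrow> nat list set" where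
  "reduced_words n p =
     {w. set w \<subseteq> {1..n} \<and> word_perm w = p \<and> length w = weyl_length n p}"

text \<open>
  The space \<open>\<real>\<^sup>N\<close> is \<open>real ^ 'k\<close> for a finite linearly ordered index type \<open>'k\<close> with \<open>N\<close> elements;
  \<open>pos p\<close> is the \<open>p\<close>-th smallest index, counting from 0.  It is only meaningful for \<open>p < N\<close>.
\<close>

definition pos :: "nat \<Rightarrow> 'k::{finite,linorder}" where
  "pos p = sorted_list_of_set UNIV ! p"

definition commute_map :: "nat \<Rightarrow> real ^ 'k::{finite,linorder} \<Rightarrow> real ^ 'k::{finite,linorder}" where
  "commute_map p a =
     (\<chi> j. if j = pos p then a $ pos (p + 1)
          else if j = pos (p + 1) then a $ pos p
          else a $ j)"

definition braid_map :: "nat \<Rightarrow> real ^ 'k::{finite,linorder} \<Rightarrow> real ^ 'k::{finite,linorder}" where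
  "braid_map p a =
     (let \<mu> = min (a $ pos p) (a $ pos (p + 2)) in
      \<chi> j. if j = pos p then a $ pos (p + 1) + a $ pos (p + 2) - \<mu>
          else if j = pos (p + 1) then \<mu>
          else if j = pos (p + 2) then a $ pos p + a $ pos (p + 1) - \<mu>
          else a $ j)"

definition adjacent :: "nat \<Rightarrow> nat \<Rightarrow> bool" where
  "adjacent i j \<longleftrightarrow> i = j + 1 \<or> j = i + 1"

text \<open>
  \<open>braid_moves v w f\<close>: some sequence of braid moves leads from \<open>v\<close> to \<open>w\<close>, and \<open>f\<close> is the
  composite of the piecewise-linear maps attached to its steps.
\<close>

inductive braid_moves ::
  "nat list \<Rightarrow> nat list \<Rightarrow> (real ^ 'k::{finite,linorder} \<Rightarrow> real ^ 'k::{finite,linorder}) \<Rightarrow> bool" where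
  refl: "braid_moves v v id"
| commute: "braid_moves v (xs @ [i, j] @ ys) f \<Longrightarrow> i \<noteq> j \<Longrightarrow> \<not> adjacent i j \<Longrightarrow>
    braid_moves v (xs @ [j, i] @ ys) (commute_map (length xs) \<circ> f)"
| braid: "braid_moves v (xs @ [i, j, i] @ ys) f \<Longrightarrow> adjacent i j \<Longrightarrow>
    braid_moves v (xs @ [j, i, j] @ ys) (braid_map (length xs) \<circ> f)"

text \<open>
  For reduced words of the same element a sequence of braid moves exists by Tits' theorem, and by
  Lusztig's theorem the composite does not depend on it, so the choice made here is immaterial.
\<close>

definition reparam :: "nat list \<Rightarrow> nat list \<Rightarrow> real ^ 'k::{finite,linorder} \<Rightarrow> real ^ 'k::{finite,linorder}" where
  "reparam v w = (SOME f. braid_moves v w f)"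

definition pbw_walls :: "nat list \<Rightarrow> (real ^ 'k::{finite,linorder}) set set" where
  "pbw_walls w =
     {{a. a $ pos p = a $ pos (p + 2)} | p.
        p + 2 < length w \<and> w ! p = w ! (p + 2) \<and> adjacent (w ! p) (w ! (p + 1))}"

definition pbw_regular :: "nat \<Rightarrow> nat list \<Rightarrow> (real ^ 'k::{finite,linorder}) set" where
  "pbw_regular n v =
     {m. (\<forall>j. 0 < m $ j) \<and>
         (\<forall>w \<in> reduced_words n (longest_elt n). \<forall>H \<in> pbw_walls w. reparam v w m \<notin> H)}"

definition pbw_linearity_domains ::
  "nat \<Rightarrow> nat list \<Rightarrow> (real ^ 'k::{finite,linorder}) set set" where
  "pbw_linearity_domains n v = closure ` components (pbw_regular n v)"

text \<open>
  The library's \<^const>\<open>face_of\<close> and \<^const>\<open>cone\<close> admit the empty set, which is neither a cone nor a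
  face of a cone in the sense of fans (all of these contain the origin); hence the nonemptiness
  conditions below.
\<close>

definition cone_face :: "'a::euclidean_space set \<Rightarrow> 'a set \<Rightarrow> bool" where
  "cone_face F C \<longleftrightarrow> F face_of C \<and> F \<noteq> {}"

definition strongly_convex_polyhedral_cone :: "'a::euclidean_space set \<Rightarrow> bool" where
  "strongly_convex_polyhedral_cone C \<longleftrightarrow>
     polyhedron C \<and> cone C \<and> C \<noteq> {} \<and> (\<forall>v \<in> C. v \<noteq> 0 \<longrightarrow> - v \<notin> C)"

definition is_fan :: "'a::euclidean_space set set \<Rightarrow> bool" where
  "is_fan \<F> \<longleftrightarrow>
     (\<forall>C \<in> \<F>. strongly_convex_polyhedral_cone C) \<and>
     (\<forall>C \<in> \<F>. \<forall>F. cone_face F C \<longrightarrow> F \<in> \<F>) \<and>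
     (\<forall>C \<in> \<F>. \<forall>D \<in> \<F>. C \<inter> D \<in> \<F>)"

end

theory Submission imports Defs "Jordan_Normal_Form.Determinant" begin

text \<open>
  Every coordinate of every reparametrization function, seen from the chart of the given word \<open>v\<close>, is a
  combination with signs of four functions of the form \<open>a \<mapsto> min {e \<bullet> a | e \<in> S}\<close> with \<open>S\<close> finite
  (\<open>chamber_minor_concave\<close>, \<open>crossing_coordinate\<close>).  Let \<open>F\<close> be the sum of all these concave functions,
  over all reduced words.  A point \<open>m\<close> with positive coordinates is regular exactly if \<open>F\<close> is linear near
  \<open>m\<close>.  Indeed, off the walls all braid maps are locally linear, hence so are all the concave functions.
  Conversely, if a sum of concave functions is linear near \<open>m\<close>, then so is each of them, and so all
  reparametrizations are linear near \<open>m\<close>; on a wall, however, the minimum in the corresponding braid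
  map has a kink.  Hence the regular set is the part of the open orthant where the minimum defining \<open>F\<close> is
  attained only once.  Its components are the cells on which a given linear function is the minimum,
  and the closures of such cells meet in common faces (\<open>is_fan_linearity_regions\<close>).

  Concavity comes from matrices.  For an upper unitriangular matrix \<open>z\<close> and a reduced word consider the
  flag minors on the sets \<open>u ` {1..r}\<close>, where \<open>u\<close> is the permutation of a prefix of the word: these are
  the chamber labels of the wiring diagram.  The chamber ansatz combines them to one number for each letter,
  the crossing numbers.  By the three-term Pluecker relation, a braid move changes the crossing numbers by
  a subtraction-free formula, whose tropicalization is the braid map (\<open>braid_chambers\<close>).  So if the
  crossing numbers of a family \<open>Z x\<close> decay like \<open>exp (- a\<^sub>p x)\<close> for \<open>v\<close>, then those for another word \<open>w\<close> decay
  with the rates given by the reparametrization of \<open>a\<close> (\<open>realizes_braid_moves\<close>).  On the other hand, every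
  flag minor is a Laurent polynomial in the crossing numbers of \<open>v\<close> (\<open>flag_minor_laurent\<close>), since the
  matrix can be recovered from them by Cramer's rule with monomial denominators.  For generic \<open>a\<close> one
  term of a Laurent polynomial dominates, so that its decay rate is the minimum of the linear functions given
  by its exponents, and by continuity this holds for all \<open>a\<close> (\<open>laurent_trop_eq_min_linear\<close>).  The rates
  of the chamber minors of \<open>w\<close> are thus concave, and the chamber ansatz expresses each coordinate by four
  of them.

  Two more facts are used.  Any two reduced words are connected by braid moves
  (\<open>ascending_words_connected\<close>).  And every point \<open>a\<close> is realized by some family of matrices: for the word
  \<open>(1) (2 1) (3 2 1) \<dots>\<close> the chambers are intervals, and a matrix with given interval minors can be
  filled in entry by entry (\<open>standard_realization\<close>).
\<close>

(* The vector notation of the matrix library would make $ and \<bullet> ambiguous. *)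
no_notation vec_index (infixl "$" 100)
no_notation scalar_prod (infix "\<bullet>" 70)

section \<open>Reduced words and Tits' theorem\<close>

lemma word_perm_Nil [simp]: "word_perm [] = id"
  and word_perm_Cons: "word_perm (i # w) = simple_refl i \<circ> word_perm w"
  by (simp_all add: word_perm_def)

lemma word_perm_append: "word_perm (v @ w) = word_perm v \<circ> word_perm w"
  by (induction v) (auto simp: word_perm_Cons fun_eq_iff)

lemma word_perm_snoc: "word_perm (w @ [i]) = word_perm w \<circ> simple_refl i"
  by (simp add: word_perm_append word_perm_Cons)

lemma simple_refl_simps [simp]: "simple_refl i i = i + 1" "simple_refl i (Suc i) = i"
  by (simp_all add: simple_refl_def)

lemma simple_refl_if: "simple_refl i a = (if a = i then Suc i else if a = Suc i then i else a)"
  by (simp add: simple_refl_def Transposition.transpose_def)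

lemma simple_refl_other: "a \<noteq> i \<Longrightarrow> a \<noteq> i + 1 \<Longrightarrow> simple_refl i a = a"
  by (simp add: simple_refl_def)

lemma simple_refl_invol [simp]: "simple_refl i (simple_refl i a) = a"
  by (simp add: simple_refl_def)

lemma simple_refl_permutes: "i \<in> {1..n} \<Longrightarrow> simple_refl i permutes {1..n + 1}"
  unfolding simple_refl_def by (rule permutes_swap_id) auto

lemma word_perm_permutes: "set w \<subseteq> {1..n} \<Longrightarrow> word_perm w permutes {1..n + 1}"
proof (induction w)
  case (Cons i w)
  then show ?case
    unfolding word_perm_Cons by (intro permutes_compose simple_refl_permutes) auto
qed (simp add: permutes_id)

lemma simple_refl_commute:
  "i \<noteq> j \<Longrightarrow> \<not> adjacent i j \<Longrightarrow> simple_refl i \<circ> simple_refl j = simple_refl j \<circ> simple_refl i"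
  by (auto simp: fun_eq_iff simple_refl_if adjacent_def)

lemma simple_refl_braid:
  "adjacent i j \<Longrightarrow> simple_refl i \<circ> (simple_refl j \<circ> simple_refl i) =
     simple_refl j \<circ> (simple_refl i \<circ> simple_refl j)"
  by (auto simp: fun_eq_iff simple_refl_if adjacent_def)

definition inversions :: "nat \<Rightarrow> (nat \<Rightarrow> nat) \<Rightarrow> (nat \<times> nat) set" where
  "inversions n p = {(a, b). 1 \<le> a \<and> a < b \<and> b \<le> n + 1 \<and> p b < p a}"

lemma finite_inversions [simp]: "finite (inversions n p)"
  by (rule finite_subset[of _ "{1..n+1} \<times> {1..n+1}"]) (auto simp: inversions_def)

text \<open>
  The pair \<open>(i, i + 1)\<close> becomes an inversion; applying \<open>s\<^sub>i\<close> to both entries of a pair matches the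
  remaining inversions before and after.
\<close>

lemma card_inversions_ascent:
  assumes i: "i \<in> {1..n}" and lt: "p i < p (i + 1)"
  shows "card (inversions n (p \<circ> simple_refl i)) = Suc (card (inversions n p))"
proof -
  let ?s = "simple_refl i"
  let ?f = "map_prod ?s ?s"
  have "inversions n (p \<circ> ?s) = insert (i, i + 1) (?f ` inversions n p)"
  proof (intro equalityI subsetI)
    fix x assume "x \<in> inversions n (p \<circ> ?s)"
    then obtain a b where x: "x = (a, b)" "1 \<le> a" "a < b" "b \<le> n + 1" "p (?s b) < p (?s a)"
      by (auto simp: inversions_def)
    show "x \<in> insert (i, i + 1) (?f ` inversions n p)"
    proof (cases "a = i \<and> b = i + 1")
      case False
      have "?s a < ?s b"
        using x(3) False by (auto simp: simple_refl_if)
      moreover have "1 \<le> ?s a" "?s b \<le> n + 1"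
        using x i by (auto simp: simple_refl_if)
      ultimately have "(?s a, ?s b) \<in> inversions n p" using x by (auto simp: inversions_def)
      then have "?f (?s a, ?s b) \<in> ?f ` inversions n p" by blast
      then show ?thesis using x by simp
    qed (use x in auto)
  next
    fix x assume "x \<in> insert (i, i + 1) (?f ` inversions n p)"
    then consider "x = (i, i + 1)" | a b where "x = (?s a, ?s b)" "(a, b) \<in> inversions n p"
      by auto
    then show "x \<in> inversions n (p \<circ> ?s)"
    proof cases
      case 1 then show ?thesis using i lt by (auto simp: inversions_def)
    next
      case 2
      then have ab: "1 \<le> a" "a < b" "b \<le> n + 1" "p b < p a" by (auto simp: inversions_def)
      have "\<not> (a = i \<and> b = i + 1)" using ab lt by auto
      then have "?s a < ?s b" using ab by (auto simp: simple_refl_if)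
      moreover have "1 \<le> ?s a" "?s b \<le> n + 1"
        using ab i by (auto simp: simple_refl_if)
      ultimately show ?thesis using 2 ab by (auto simp: inversions_def)
    qed
  qed
  moreover have "(i, i + 1) \<notin> ?f ` inversions n p"
  proof
    assume "(i, i + 1) \<in> ?f ` inversions n p"
    then obtain a b where ab: "(a, b) \<in> inversions n p" "?s a = i" "?s b = i + 1" by auto
    then have "a = i + 1" "b = i" by (metis simple_refl_invol simple_refl_simps(1,2) Suc_eq_plus1)+
    then show False using ab by (auto simp: inversions_def)
  qed
  moreover have "inj_on ?f (inversions n p)"
    by (rule inj_onI) (metis (no_types, lifting) simple_refl_invol map_prod_simp prod.collapse prod.inject)
  ultimately show ?thesis by (simp add: card_image)
qed

lemma card_inversions_descent:
  assumes i: "i \<in> {1..n}" and gt: "p (i + 1) < p i"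
  shows "card (inversions n p) = Suc (card (inversions n (p \<circ> simple_refl i)))"
proof -
  have "p \<circ> simple_refl i \<circ> simple_refl i = p" by (simp add: fun_eq_iff)
  then show ?thesis
    using card_inversions_ascent[OF i, of "p \<circ> simple_refl i"] gt by simp
qed

text \<open>
  A word is reduced exactly when each of its letters, at the moment it acts, exchanges two values
  that are still in increasing order.  This local form of reducedness is the one that the minors
  below respond to, since it decides the order of the two lines that cross.
\<close>

definition ascending_word :: "nat list \<Rightarrow> bool" where
  "ascending_word w \<longleftrightarrow>
     (\<forall>k < length w. word_perm (take k w) (w ! k) < word_perm (take k w) (w ! k + 1))"

lemma ascending_word_Nil [simp]: "ascending_word []"
  by (simp add: ascending_word_def)

lemma ascending_word_snoc:
  "ascending_word (w @ [i]) \<longleftrightarrow> ascending_word w \<and> word_perm w i < word_perm w (i + 1)"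
  by (auto simp: ascending_word_def nth_append less_Suc_eq)

text \<open>
  Every letter changes the number of inversions by one, so the number of inversions reaches the
  length of the word exactly if no letter ever removes one.
\<close>

lemma card_inversions_word:
  assumes "set w \<subseteq> {1..n}"
  shows "card (inversions n (word_perm w)) \<le> length w \<and>
    (card (inversions n (word_perm w)) = length w \<longleftrightarrow> ascending_word w)"
  using assms
proof (induction w rule: rev_induct)
  case Nil
  have "inversions n (\<lambda>a. a) = {}" by (auto simp: inversions_def)
  then show ?case by (simp add: id_def)
next
  case (snoc i w)
  then have i: "i \<in> {1..n}" and w: "set w \<subseteq> {1..n}" by auto
  note IH = snoc.IH[OF w]
  have ne: "word_perm w i \<noteq> word_perm w (i + 1)"
    using permutes_inj[OF word_perm_permutes[OF w]] by (simp add: inj_eq)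
  define q where "q = word_perm w \<circ> simple_refl i"
  have q: "word_perm (w @ [i]) = q" by (simp only: q_def word_perm_snoc)
  show ?case
  proof (cases "word_perm w i < word_perm w (i + 1)")
    case True
    have "card (inversions n q) = Suc (card (inversions n (word_perm w)))"
      unfolding q_def by (rule card_inversions_ascent[OF i True])
    then show ?thesis
      unfolding q ascending_word_snoc using IH True by auto
  next
    case False
    then have "word_perm w (i + 1) < word_perm w i" using ne by simp
    from card_inversions_descent[OF i this]
    have "card (inversions n (word_perm w)) = Suc (card (inversions n q))" unfolding q_def .
    then show ?thesis
      unfolding q ascending_word_snoc using IH False by auto
  qed
qed

lemma permutes_no_descent_id:
  fixes p :: "nat \<Rightarrow> nat"
  assumes p: "p permutes {1..n + 1}" and asc: "\<And>i. i \<in> {1..n} \<Longrightarrow> p i < p (i + 1)"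
  shows "p = id"
proof -
  have ge: "k \<in> {1..n + 1} \<Longrightarrow> k \<le> p k" for k
  proof (induction k)
    case (Suc k)
    show ?case
    proof (cases "k = 0")
      case True
      then show ?thesis using permutes_in_image[OF p, of 1] Suc.prems by auto
    next
      case False
      then have "k \<le> p k" "p k < p (k + 1)" using Suc asc[of k] by auto
      then show ?thesis by simp
    qed
  qed simp
  then show ?thesis using permutes_natset_ge[OF p] by blast
qed

lemma ascending_word_exists_aux:
  assumes "card (inversions n p) = c" "p permutes {1..n + 1}"
  shows "\<exists>w. set w \<subseteq> {1..n} \<and> word_perm w = p \<and> ascending_word w"
  using assms
proof (induction c arbitrary: p)
  case 0
  have "p i < p (i + 1)" if "i \<in> {1..n}" for i
  proof -
    have "inversions n p = {}" using 0 by simp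
    then have "\<not> p (i + 1) < p i" using that by (auto simp: inversions_def)
    moreover have "p i \<noteq> p (i + 1)" using permutes_inj[OF 0(2)] by (simp add: inj_eq)
    ultimately show ?thesis by simp
  qed
  then have "p = id" using permutes_no_descent_id[OF 0(2)] by blast
  then have "word_perm [] = p" by simp
  then show ?case by (metis ascending_word_Nil empty_subsetI set_empty)
next
  case (Suc c)
  have "\<exists>i \<in> {1..n}. p (i + 1) < p i"
  proof (rule ccontr)
    assume no: "\<not> ?thesis"
    have "p i < p (i + 1)" if "i \<in> {1..n}" for i
    proof -
      have "\<not> p (i + 1) < p i" using no that by blast
      moreover have "p i \<noteq> p (i + 1)" using permutes_inj[OF Suc.prems(2)] by (simp add: inj_eq)
      ultimately show ?thesis by simp
    qed
    then have "p = id" using permutes_no_descent_id[OF Suc.prems(2)] by blast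
    then have "inversions n p = {}" by (auto simp: inversions_def)
    then show False using Suc.prems(1) by simp
  qed
  then obtain i where i: "i \<in> {1..n}" "p (i + 1) < p i" by blast
  define q where "q = p \<circ> simple_refl i"
  have pq: "p = q \<circ> simple_refl i" by (simp add: q_def fun_eq_iff)
  have "q permutes {1..n + 1}"
    unfolding q_def by (rule permutes_compose[OF simple_refl_permutes[OF i(1)] Suc.prems(2)])
  moreover have "card (inversions n q) = c"
    using card_inversions_descent[OF i] Suc.prems(1) unfolding q_def by simp
  ultimately obtain w where w: "set w \<subseteq> {1..n}" "word_perm w = q" "ascending_word w"
    using Suc.IH by blast
  have "q i < q (i + 1)" using i by (simp add: q_def)
  then have "ascending_word (w @ [i])" unfolding ascending_word_snoc using w by simp
  moreover have "word_perm (w @ [i]) = p" unfolding word_perm_snoc w(2) pq ..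
  moreover have "set (w @ [i]) \<subseteq> {1..n}" using w i by simp
  ultimately show ?case by blast
qed

lemma ascending_word_exists:
  assumes "p permutes {1..n + 1}"
  obtains w where "set w \<subseteq> {1..n}" "word_perm w = p" "ascending_word w"
  using ascending_word_exists_aux[OF HOL.refl assms] that by blast

lemma weyl_length_eq:
  assumes p: "p permutes {1..n + 1}"
  shows "weyl_length n p = card (inversions n p)"
  unfolding weyl_length_def
proof (rule Least_equality)
  obtain w where w: "set w \<subseteq> {1..n}" "word_perm w = p" "ascending_word w"
    using ascending_word_exists[OF p] .
  then show "\<exists>w. set w \<subseteq> {1..n} \<and> word_perm w = p \<and> length w = card (inversions n p)"
    using card_inversions_word[OF w(1)] by auto
next
  fix l assume "\<exists>w. set w \<subseteq> {1..n} \<and> word_perm w = p \<and> length w = l"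
  then show "card (inversions n p) \<le> l" using card_inversions_word by blast
qed

lemma reduced_words_eq:
  assumes p: "p permutes {1..n + 1}"
  shows "reduced_words n p = {w. set w \<subseteq> {1..n} \<and> word_perm w = p \<and> ascending_word w}"
proof -
  have "length w = card (inversions n p) \<longleftrightarrow> ascending_word w"
    if "set w \<subseteq> {1..n}" "word_perm w = p" for w
    using card_inversions_word[OF that(1)] that(2) by auto
  then show ?thesis unfolding reduced_words_def weyl_length_eq[OF p] by blast
qed

text \<open>
  The length counts inversions and the reversal inverts all pairs, so an element of maximal length
  inverts all pairs as well.  Composing it with the reversal leaves no descent.
\<close>

lemma longest_elt:
  shows longest_elt_permutes: "longest_elt n permutes {1..n + 1}"
    and longest_elt_apply: "a \<in> {1..n + 1} \<Longrightarrow> longest_elt n a = n + 2 - a"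
proof -
  define r where "r a = (if a \<in> {1..n + 1} then n + 2 - a else a)" for a :: nat
  define A where "A = {(a, b). 1 \<le> a \<and> a < b \<and> b \<le> n + 1}"
  have finA: "finite A"
    by (rule finite_subset[of _ "{1..n+1} \<times> {1..n+1}"]) (auto simp: A_def)
  have r: "r permutes {1..n + 1}"
  proof (rule bij_imp_permutes)
    show "bij_betw r {1..n + 1} {1..n + 1}"
      by (rule bij_betwI[where g = r]) (auto simp: r_def)
  qed (auto simp: r_def)
  have invr: "inversions n r = A" by (auto simp: inversions_def r_def A_def)
  have sub: "inversions n p \<subseteq> A" for p by (auto simp: inversions_def A_def)
  have bound: "\<forall>p. p permutes {1..n + 1} \<longrightarrow> weyl_length n p < Suc (card A)"
    using card_mono[OF finA sub] by (simp add: weyl_length_eq less_Suc_eq_le)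
  have max: "longest_elt n permutes {1..n + 1} \<and>
      (\<forall>p. p permutes {1..n + 1} \<longrightarrow> weyl_length n p \<le> weyl_length n (longest_elt n))"
    unfolding longest_elt_def by (rule arg_max_nat_lemma[OF r bound])
  then show perm: "longest_elt n permutes {1..n + 1}" by blast
  have "card A \<le> card (inversions n (longest_elt n))"
    using max r perm by (metis weyl_length_eq invr)
  then have invw: "inversions n (longest_elt n) = A"
    using card_seteq[OF finA sub] by blast
  have "longest_elt n \<circ> r = id"
  proof (rule permutes_no_descent_id)
    show "longest_elt n \<circ> r permutes {1..n + 1}" by (intro permutes_compose r perm)
    fix i assume i: "i \<in> {1..n}"
    then have "(r (i + 1), r i) \<in> inversions n (longest_elt n)"
      unfolding invw by (auto simp: A_def r_def)
    then show "(longest_elt n \<circ> r) i < (longest_elt n \<circ> r) (i + 1)" by (simp add: inversions_def)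
  qed
  then have rr: "longest_elt n (r a) = a" for a by (metis comp_apply id_apply)
  show "longest_elt n a = n + 2 - a" if "a \<in> {1..n + 1}"
  proof -
    have "r (n + 2 - a) = a" using that by (auto simp: r_def)
    then show ?thesis using rr[of "n + 2 - a"] by simp
  qed
qed

lemma longest_elt_image:
  assumes "r \<le> n + 1"
  shows "longest_elt n ` {1..r} = {n + 2 - r..n + 1}"
proof -
  have "longest_elt n ` {1..r} = (\<lambda>a. n + 2 - a) ` {1..r}"
    using assms by (intro image_cong) (auto simp: longest_elt_apply)
  also have "\<dots> = {n + 2 - r..n + 1}"
  proof (intro equalityI subsetI)
    fix x assume "x \<in> {n + 2 - r..n + 1}"
    then show "x \<in> (\<lambda>a. n + 2 - a) ` {1..r}"
      using assms by (intro image_eqI[of _ _ "n + 2 - x"]) auto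
  qed (use assms in auto)
  finally show ?thesis .
qed

inductive braid_step :: "nat list \<Rightarrow> nat list \<Rightarrow> bool" where
  commute: "i \<noteq> j \<Longrightarrow> \<not> adjacent i j \<Longrightarrow> braid_step (xs @ [i, j] @ ys) (xs @ [j, i] @ ys)"
| braid: "adjacent i j \<Longrightarrow> braid_step (xs @ [i, j, i] @ ys) (xs @ [j, i, j] @ ys)"

lemma adjacent_sym: "adjacent i j \<longleftrightarrow> adjacent j i"
  by (auto simp: adjacent_def)

lemma braid_step_append: "braid_step v w \<Longrightarrow> braid_step (v @ zs) (w @ zs)"
  by (induction rule: braid_step.induct)
    (metis append.assoc braid_step.intros(1), metis append.assoc braid_step.intros(2))

lemma braid_steps_append: "braid_step\<^sup>*\<^sup>* v w \<Longrightarrow> braid_step\<^sup>*\<^sup>* (v @ zs) (w @ zs)"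
  by (induction rule: rtranclp_induct) (auto intro: rtranclp.intros braid_step_append)

lemma braid_step_invariants:
  assumes "braid_step v w"
  shows "set w = set v" "length w = length v" "word_perm w = word_perm v"
proof -
  show "set w = set v" "length w = length v"
    using assms by (induction rule: braid_step.induct) auto
  show "word_perm w = word_perm v"
    using assms
  proof (induction rule: braid_step.induct)
    case (commute i j xs ys)
    have "word_perm [i, j] = word_perm [j, i]"
      using simple_refl_commute[OF commute] by (simp add: word_perm_Cons)
    then show ?case unfolding word_perm_append by simp
  next
    case (braid i j xs ys)
    have "word_perm [i, j, i] = word_perm [j, i, j]"
      using simple_refl_braid[OF braid] by (simp add: word_perm_Cons)
    then show ?case unfolding word_perm_append by simp
  qed
qed

lemma braid_step_ascending:
  assumes "braid_step v w" "set v \<subseteq> {1..n}" "ascending_word v"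
  shows "ascending_word w"
  using braid_step_invariants[OF assms(1)] assms card_inversions_word by metis

lemma braid_steps_imp_braid_moves:
  assumes "braid_step\<^sup>*\<^sup>* v w"
  shows "\<exists>f :: real ^ 'k::{finite,linorder} \<Rightarrow> _. braid_moves v w f"
  using assms
proof (induction rule: rtranclp_induct)
  case base
  show ?case using braid_moves.refl by blast
next
  case (step w w')
  from step.hyps(2) step.IH show ?case
    by (cases rule: braid_step.cases) (blast intro: braid_moves.intros)+
qed

lemma braid_moves_imp_braid_steps:
  "braid_moves v w f \<Longrightarrow> braid_step\<^sup>*\<^sup>* v w"
  by (induction rule: braid_moves.induct)
    (auto intro: rtranclp.rtrancl_into_rtrancl braid_step.intros simp del: append.simps)

text \<open>
  Tits' theorem for the symmetric group.  Compare the last letters \<open>i\<close> and \<open>j\<close> of the two words.  If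
  they differ, both are descents of the permutation, which therefore also has reduced words that end
  in the one and in the other side of the relation between \<open>s\<^sub>i\<close> and \<open>s\<^sub>j\<close>.  The induction
  hypothesis connects the given words to these, and one braid move connects these to each other.
\<close>

theorem ascending_words_connected:
  assumes "set v \<subseteq> {1..n}" "set w \<subseteq> {1..n}" "ascending_word v" "ascending_word w"
    and "word_perm v = word_perm w"
  shows "braid_step\<^sup>*\<^sup>* v w"
  using assms
proof (induction "length v" arbitrary: v w rule: less_induct)
  case less
  note lenc = card_inversions_word[of _ n]
  have len: "length v = length w"
    using lenc[of v] lenc[of w] less.prems by metis
  show ?case
  proof (cases v rule: rev_cases)
    case Nil
    then show ?thesis using len by simp
  next
    case (snoc v' i)
    then obtain w' j where w: "w = w' @ [j]" using len by (cases w rule: rev_cases) auto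
    note v = snoc
    have i: "i \<in> {1..n}" and j: "j \<in> {1..n}" and v': "set v' \<subseteq> {1..n}" and w': "set w' \<subseteq> {1..n}"
      using less.prems v w by auto
    have av: "ascending_word v'" "word_perm v' i < word_perm v' (i + 1)"
      and aw: "ascending_word w'" "word_perm w' j < word_perm w' (j + 1)"
      using less.prems by (auto simp: v w ascending_word_snoc)
    define p where "p = word_perm v"
    have pv: "p = word_perm v' \<circ> simple_refl i" and pw: "p = word_perm w' \<circ> simple_refl j"
      using less.prems by (simp_all add: p_def v w word_perm_snoc)
    have v'p: "word_perm v' = p \<circ> simple_refl i" and w'p: "word_perm w' = p \<circ> simple_refl j"
      by (simp add: pv fun_eq_iff, simp add: pw fun_eq_iff)
    have pi: "p (i + 1) < p i" and pj: "p (j + 1) < p j"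
      using av(2) aw(2) by (simp_all add: v'p w'p)
    have perm: "p permutes {1..n + 1}"
      unfolding p_def by (rule word_perm_permutes[OF less.prems(1)])
    have IH: "braid_step\<^sup>*\<^sup>* x y"
      if "length x < length v" "set x \<subseteq> {1..n}" "set y \<subseteq> {1..n}" "ascending_word x"
        "ascending_word y" "word_perm x = word_perm y" for x y
      by (rule less.hyps) (use that in auto)
    have lensw: "length x = length w'" if "set x \<subseteq> {1..n}" "ascending_word x" "word_perm x = word_perm w'" for x
      using lenc[of x] lenc[of w'] that w' aw by metis
    consider "i = j" | "i \<noteq> j" "\<not> adjacent i j" | "adjacent i j" by blast
    then show ?thesis
    proof cases
      case 1
      then have "braid_step\<^sup>*\<^sup>* v' w'"
        using IH[of v' w'] v v' w' av aw v'p w'p by simp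
      then show ?thesis using 1 braid_steps_append by (simp add: v w)
    next
      case 2
      define q where "q = p \<circ> simple_refl i \<circ> simple_refl j"
      have q': "q = p \<circ> simple_refl j \<circ> simple_refl i"
        using simple_refl_commute[OF 2] by (simp add: q_def comp_assoc)
      have "q permutes {1..n + 1}"
        unfolding q_def by (intro permutes_compose perm simple_refl_permutes i j)
      then obtain t where t: "set t \<subseteq> {1..n}" "word_perm t = q" "ascending_word t"
        using ascending_word_exists by blast
      have qj: "q j < q (j + 1)"
        using 2 pj by (simp add: q_def simple_refl_other adjacent_def)
      have qi: "q i < q (i + 1)"
        using 2 pi by (simp add: q' simple_refl_other adjacent_def)
      have tj: "word_perm (t @ [j]) = word_perm v'" "ascending_word (t @ [j])"
        by (simp add: word_perm_snoc t q_def v'p comp_def) (use t qj in \<open>simp add: ascending_word_snoc\<close>)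
      have ti: "word_perm (t @ [i]) = word_perm w'" "ascending_word (t @ [i])"
        by (simp add: word_perm_snoc t q' w'p comp_def) (use t qi in \<open>simp add: ascending_word_snoc\<close>)
      have a: "braid_step\<^sup>*\<^sup>* v' (t @ [j])"
        by (rule IH) (use v v' av t j tj in auto)
      have b: "braid_step\<^sup>*\<^sup>* (t @ [i]) w'"
        by (rule IH) (use lensw[of "t @ [i]"] len v w w' aw t i ti in auto)
      have "braid_step\<^sup>*\<^sup>* v (t @ [j, i])" using braid_steps_append[OF a, of "[i]"] by (simp add: v)
      moreover have "braid_step (t @ [j, i]) (t @ [i, j])"
        using braid_step.commute[of j i t "[]"] 2 adjacent_sym by auto
      moreover have "braid_step\<^sup>*\<^sup>* (t @ [i, j]) w" using braid_steps_append[OF b, of "[j]"] by (simp add: w)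
      ultimately show ?thesis by (meson rtranclp.rtrancl_into_rtrancl rtranclp_trans)
    next
      case 3
      define q where "q = p \<circ> (simple_refl i \<circ> (simple_refl j \<circ> simple_refl i))"
      have q': "q = p \<circ> (simple_refl j \<circ> (simple_refl i \<circ> simple_refl j))"
        using simple_refl_braid[OF 3] by (simp add: q_def)
      have "q permutes {1..n + 1}"
        unfolding q_def by (intro permutes_compose perm simple_refl_permutes i j)
      then obtain t where t: "set t \<subseteq> {1..n}" "word_perm t = q" "ascending_word t"
        using ascending_word_exists by blast
      have ij: "j = i + 1 \<or> i = j + 1" using 3 by (auto simp: adjacent_def)
      have tj: "word_perm (t @ [i, j]) = word_perm v'"
        by (simp add: word_perm_append word_perm_Cons t q_def v'p fun_eq_iff)
      have ti: "word_perm (t @ [j, i]) = word_perm w'"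
        by (simp add: word_perm_append word_perm_Cons t q' w'p fun_eq_iff)
      have atj: "ascending_word ((t @ [i]) @ [j])"
        unfolding ascending_word_snoc word_perm_snoc t(2)
        using ij pi pj t(3) by (auto simp: q_def simple_refl_if)
      have ati: "ascending_word ((t @ [j]) @ [i])"
        unfolding ascending_word_snoc word_perm_snoc t(2)
        using ij pi pj t(3) by (auto simp: q' simple_refl_if)
      have a: "braid_step\<^sup>*\<^sup>* v' (t @ [i, j])"
        by (rule IH) (use v v' av t i j tj atj in auto)
      have b: "braid_step\<^sup>*\<^sup>* (t @ [j, i]) w'"
        by (rule IH) (use lensw[of "t @ [j, i]"] len v w w' aw t i j ti ati in auto)
      have "braid_step\<^sup>*\<^sup>* v (t @ [i, j, i])" using braid_steps_append[OF a, of "[i]"] by (simp add: v)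
      moreover have "braid_step (t @ [i, j, i]) (t @ [j, i, j])"
        using braid_step.braid[of i j t "[]"] 3 by auto
      moreover have "braid_step\<^sup>*\<^sup>* (t @ [j, i, j]) w" using braid_steps_append[OF b, of "[j]"] by (simp add: w)
      ultimately show ?thesis by (meson rtranclp.rtrancl_into_rtrancl rtranclp_trans)
    qed
  qed
qed

section \<open>Fans from concave piecewise linear functions\<close>

text \<open>
  A nonzero point \<open>x\<close> of the face lies in the open segment between \<open>c x\<close> and a multiple of \<open>x\<close> on the
  other side of \<open>x\<close>.
\<close>

lemma cone_face_of_cone:
  fixes C :: "'a::euclidean_space set"
  assumes C: "cone C" and F: "F face_of C"
  shows "cone F"
  unfolding cone_def
proof (intro ballI allI impI)
  fix x and c :: real assume x: "x \<in> F" and c: "0 \<le> c"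
  show "c *\<^sub>R x \<in> F"
  proof (cases "x = 0 \<or> c = 1")
    case False
    \<comment> \<open>\<open>d\<close> and \<open>c\<close> lie on different sides of \<open>1\<close>.\<close>
    define d :: real where "d = (if c < 1 then 2 else 0)"
    define t where "t = (1 - c) / (d - c)"
    have xC: "x \<in> C" using x F by (auto dest: face_of_imp_subset)
    have t: "0 < t" "t < 1" and dc: "d \<noteq> c"
      using False c by (auto simp: t_def d_def field_simps)
    have "t * (d - c) = 1 - c" using dc by (simp add: t_def)
    then have "(1 - t) * c + t * d = 1" by (simp add: algebra_simps)
    then have "x = (1 - t) *\<^sub>R (c *\<^sub>R x) + t *\<^sub>R (d *\<^sub>R x)"
      by (metis scaleR_left_distrib scaleR_one scaleR_scaleR)
    then have "x \<in> open_segment (c *\<^sub>R x) (d *\<^sub>R x)"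
      unfolding in_segment using t dc False by auto
    moreover have "c *\<^sub>R x \<in> C" "d *\<^sub>R x \<in> C"
      using C xC c by (auto simp: cone_def d_def)
    ultimately show ?thesis using face_ofD[OF F] x by blast
  qed (use x in auto)
qed

lemma strongly_convex_polyhedral_cone_face:
  assumes "strongly_convex_polyhedral_cone C" "cone_face F C"
  shows "strongly_convex_polyhedral_cone F"
  using assms face_of_imp_subset[of F C]
  by (auto simp: strongly_convex_polyhedral_cone_def cone_face_def
      intro: face_of_polyhedron_polyhedron cone_face_of_cone)

lemma is_fan_faces:
  assumes cones: "\<And>C. C \<in> \<D> \<Longrightarrow> strongly_convex_polyhedral_cone C"
    and inter: "\<And>C D. C \<in> \<D> \<Longrightarrow> D \<in> \<D> \<Longrightarrow> C \<inter> D face_of C"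
  shows "is_fan (\<D> \<union> {F. \<exists>C \<in> \<D>. cone_face F C})"
proof -
  have refl: "cone_face C C" if "C \<in> \<D>" for C
    using cones[OF that] polyhedron_imp_convex
    by (auto simp: cone_face_def strongly_convex_polyhedral_cone_def intro: face_of_refl)
  have eq: "\<D> \<union> {F. \<exists>C \<in> \<D>. cone_face F C} = {F. \<exists>C \<in> \<D>. cone_face F C}"
    using refl by blast
  have zero: "0 \<in> F" if "C \<in> \<D>" "cone_face F C" for F C
  proof -
    have "cone F" "F \<noteq> {}"
      using strongly_convex_polyhedral_cone_face[OF cones[OF that(1)] that(2)]
      by (auto simp: strongly_convex_polyhedral_cone_def)
    then show ?thesis using cone_contains_0 by blast
  qed
  show ?thesis
    unfolding is_fan_def eq
  proof (intro conjI ballI allI impI)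
    fix F assume "F \<in> {F. \<exists>C \<in> \<D>. cone_face F C}"
    then show "strongly_convex_polyhedral_cone F"
      using cones strongly_convex_polyhedral_cone_face by blast
  next
    fix F G assume "F \<in> {F. \<exists>C \<in> \<D>. cone_face F C}" "cone_face G F"
    then show "G \<in> {F. \<exists>C \<in> \<D>. cone_face F C}"
      by (auto simp: cone_face_def intro: face_of_trans)
  next
    fix F G assume "F \<in> {F. \<exists>C \<in> \<D>. cone_face F C}" "G \<in> {F. \<exists>C \<in> \<D>. cone_face F C}"
    then obtain C D where C: "C \<in> \<D>" "cone_face F C" and D: "D \<in> \<D>" "cone_face G D" by blast
    define E where "E = C \<inter> D"
    have E: "E face_of C" "E face_of D"
      using inter[OF C(1) D(1)] inter[OF D(1) C(1)] by (simp_all add: E_def Int_commute)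
    have FC: "F face_of C" and GD: "G face_of D" using C D by (auto simp: cone_face_def)
    \<comment> \<open>Both faces can be cut down to the common face \<open>E\<close> of the two cones without changing
      their intersection.\<close>
    have "F \<inter> G = (F \<inter> E) \<inter> (G \<inter> E)"
      using face_of_imp_subset[OF FC] face_of_imp_subset[OF GD] by (auto simp: E_def)
    moreover have "F \<inter> E face_of E"
      by (rule face_of_subset[OF face_of_Int[OF FC E(1)]]) (use face_of_imp_subset[OF E(1)] in auto)
    moreover have "G \<inter> E face_of E"
      by (rule face_of_subset[OF face_of_Int[OF GD E(2)]]) (use face_of_imp_subset[OF E(2)] in auto)
    ultimately have "F \<inter> G face_of C"
      using face_of_Int face_of_trans E(1) by metis
    then have "cone_face (F \<inter> G) C"
      using zero[OF C] zero[OF D] by (auto simp: cone_face_def)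
    then show "F \<inter> G \<in> {F. \<exists>C \<in> \<D>. cone_face F C}" using C by blast
  qed
qed

definition min_linear :: "'a::euclidean_space set \<Rightarrow> 'a \<Rightarrow> real" where
  "min_linear S x = Min ((\<lambda>e. inner e x) ` S)"

definition locally_linear_at :: "('a::euclidean_space \<Rightarrow> real) \<Rightarrow> 'a \<Rightarrow> bool" where
  "locally_linear_at f m \<longleftrightarrow> (\<exists>e. \<forall>\<^sub>F x in nhds m. f x = inner e x)"

lemma min_linear_le: "finite S \<Longrightarrow> e \<in> S \<Longrightarrow> min_linear S x \<le> inner e x"
  unfolding min_linear_def by (rule Min_le) auto

lemma min_linear_attained:
  assumes "finite S" "S \<noteq> {}"
  obtains e where "e \<in> S" "min_linear S x = inner e x"
proof -
  have "min_linear S x \<in> (\<lambda>e. inner e x) ` S"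
    unfolding min_linear_def using assms by (intro Min_in) auto
  then show ?thesis using that by blast
qed

lemma min_linear_plus:
  assumes "finite S" "S \<noteq> {}" "finite T" "T \<noteq> {}"
  shows "min_linear S x + min_linear T x = min_linear ((\<lambda>(d, e). d + e) ` (S \<times> T)) x"
proof (rule antisym)
  let ?U = "(\<lambda>(d, e). d + e) ` (S \<times> T)"
  have U: "finite ?U" "?U \<noteq> {}" using assms by auto
  obtain c where c: "c \<in> ?U" "min_linear ?U x = inner c x" using min_linear_attained[OF U] .
  then obtain d e where "d \<in> S" "e \<in> T" "min_linear ?U x = inner (d + e) x" by auto
  then show "min_linear S x + min_linear T x \<le> min_linear ?U x"
    using min_linear_le[of S d x] min_linear_le[of T e x] assms by (simp add: inner_add_left)
  obtain d where d: "d \<in> S" "min_linear S x = inner d x" using min_linear_attained[OF assms(1,2)] .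
  obtain e where e: "e \<in> T" "min_linear T x = inner e x" using min_linear_attained[OF assms(3,4)] .
  have "d + e \<in> ?U" using d e by auto
  then show "min_linear ?U x \<le> min_linear S x + min_linear T x"
    using min_linear_le[OF U(1), of "d + e" x] d e by (simp add: inner_add_left)
qed

lemma sum_min_linear:
  assumes "finite I" "\<And>i. i \<in> I \<Longrightarrow> finite (S i) \<and> S i \<noteq> {}"
  shows "\<exists>T. finite T \<and> T \<noteq> {} \<and> (\<forall>x. (\<Sum>i\<in>I. min_linear (S i) x) = min_linear T x)"
  using assms
proof (induction I rule: finite_induct)
  case empty
  show ?case by (intro exI[of _ "{0}"]) (simp add: min_linear_def)
next
  case (insert i I)
  then obtain T where T: "finite T" "T \<noteq> {}" "\<And>x. (\<Sum>i\<in>I. min_linear (S i) x) = min_linear T x"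
    by auto
  have Si: "finite (S i)" "S i \<noteq> {}" using insert.prems by auto
  define U where "U = (\<lambda>(d, e). d + e) ` (S i \<times> T)"
  have "(\<Sum>i\<in>insert i I. min_linear (S i) x) = min_linear U x" for x
    unfolding U_def min_linear_plus[OF Si T(1,2), symmetric] T(3)[symmetric]
    using insert.hyps by simp
  moreover have "finite U" "U \<noteq> {}" using Si T by (auto simp: U_def)
  ultimately show ?case by blast
qed

text \<open>
  Moving away from \<open>m\<close> in the direction \<open>d - e\<close> violates the inequality unless \<open>d = e\<close>.
\<close>

lemma linear_touching_eq:
  fixes d e :: "'a::euclidean_space"
  assumes le: "\<forall>\<^sub>F x in nhds m. inner d x \<le> inner e x" and eq: "inner d m = inner e m"
  shows "d = e"
proof -
  have "((\<lambda>s. m + s *\<^sub>R (d - e)) \<longlongrightarrow> m + 0 *\<^sub>R (d - e)) (at_right 0)"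
    by (intro tendsto_intros)
  then have "filterlim (\<lambda>s. m + s *\<^sub>R (d - e)) (nhds m) (at_right 0)" by simp
  then have "\<forall>\<^sub>F s in at_right 0. inner d (m + s *\<^sub>R (d - e)) \<le> inner e (m + s *\<^sub>R (d - e))"
    by (rule eventually_compose_filterlim[OF le])
  moreover have "\<forall>\<^sub>F s :: real in at_right 0. 0 < s" by (simp add: eventually_at_right_less)
  ultimately have "\<forall>\<^sub>F s :: real in at_right 0. inner (d - e) (d - e) \<le> 0"
  proof eventually_elim
    case (elim s)
    then have "s * inner (d - e) (d - e) \<le> 0"
      using eq by (simp add: inner_diff_left inner_add_right algebra_simps)
    then show ?case using elim by (simp add: mult_le_0_iff)
  qed
  then have "inner (d - e) (d - e) \<le> 0" by simp
  then show ?thesis using inner_ge_zero[of "d - e"] by simp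
qed

text \<open>
  If the minimum is linear near \<open>m\<close>, then every linear function that attains it at \<open>m\<close> touches it from
  above there, and so is equal to it.  Hence only one of them attains the minimum.
\<close>

lemma locally_linear_min_linear_iff:
  assumes S: "finite S" "S \<noteq> {}"
  shows "locally_linear_at (min_linear S) m \<longleftrightarrow> (\<exists>e \<in> S. \<forall>e' \<in> S - {e}. inner e m < inner e' m)"
proof
  assume "locally_linear_at (min_linear S) m"
  then obtain d where d: "\<forall>\<^sub>F x in nhds m. min_linear S x = inner d x"
    by (auto simp: locally_linear_at_def)
  have at: "min_linear S m = inner d m" using eventually_nhds_x_imp_x[OF d] .
  have uniq: "d = e" if "e \<in> S" "min_linear S m = inner e m" for e
  proof (rule linear_touching_eq)
    show "\<forall>\<^sub>F x in nhds m. inner d x \<le> inner e x"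
      using d by eventually_elim (metis min_linear_le S(1) that(1))
  qed (use at that in simp)
  obtain e where e: "e \<in> S" "min_linear S m = inner e m" using min_linear_attained[OF S] .
  have "inner e m < inner e' m" if "e' \<in> S - {e}" for e'
  proof -
    have "inner e m \<le> inner e' m" using min_linear_le[OF S(1), of e' m] that e by simp
    moreover have "inner e m \<noteq> inner e' m" using uniq[of e'] uniq[OF e] e that by auto
    ultimately show ?thesis by simp
  qed
  then show "\<exists>e \<in> S. \<forall>e' \<in> S - {e}. inner e m < inner e' m" using e by blast
next
  assume "\<exists>e \<in> S. \<forall>e' \<in> S - {e}. inner e m < inner e' m"
  then obtain e where e: "e \<in> S" "\<forall>e' \<in> S - {e}. inner e m < inner e' m" by blast
  have "\<forall>\<^sub>F x in nhds m. inner e x < inner e' x" if "e' \<in> S - {e}" for e'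
  proof (rule eventually_nhds_in_open[of "{x. inner e x < inner e' x}", simplified])
    show "open {x. inner e x < inner e' x}" by (intro open_Collect_less continuous_intros)
  qed (use e that in auto)
  then have "\<forall>\<^sub>F x in nhds m. \<forall>e' \<in> S - {e}. inner e x < inner e' x"
    using S by (intro eventually_ball_finite) auto
  then have "\<forall>\<^sub>F x in nhds m. min_linear S x = inner e x"
  proof eventually_elim
    case (elim x)
    have "inner e x \<le> inner e' x" if "e' \<in> S" for e'
      using elim that by (cases "e' = e") (auto intro: less_imp_le)
    then show ?case
      unfolding min_linear_def using S e by (intro Min_eqI) auto
  qed
  then show "locally_linear_at (min_linear S) m" by (auto simp: locally_linear_at_def)
qed

text \<open>
  Choose for each summand a linear function that attains it at \<open>m\<close>.  The sum of these touches the
  given linear function from above, hence equals it, and this leaves no room for a summand to drop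
  below its own linear function anywhere near \<open>m\<close>.
\<close>

lemma locally_linear_sum_min_linear_imp:
  assumes I: "finite I" and S: "\<And>i. i \<in> I \<Longrightarrow> finite (S i) \<and> S i \<noteq> {}"
    and lin: "locally_linear_at (\<lambda>x. \<Sum>i\<in>I. min_linear (S i) x) m" and i: "i \<in> I"
  shows "locally_linear_at (min_linear (S i)) m"
proof -
  obtain d where d: "\<forall>\<^sub>F x in nhds m. (\<Sum>i\<in>I. min_linear (S i) x) = inner d x"
    using lin by (auto simp: locally_linear_at_def)
  have "\<forall>i\<in>I. \<exists>e. e \<in> S i \<and> min_linear (S i) m = inner e m"
    using S by (blast elim: min_linear_attained)
  then obtain e where e: "\<And>i. i \<in> I \<Longrightarrow> e i \<in> S i" "\<And>i. i \<in> I \<Longrightarrow> min_linear (S i) m = inner (e i) m"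
    by metis
  have le: "min_linear (S i) x \<le> inner (e i) x" if "i \<in> I" for i x
    using min_linear_le S e that by blast
  have de: "d = (\<Sum>i\<in>I. e i)"
  proof (rule linear_touching_eq)
    show "\<forall>\<^sub>F x in nhds m. inner d x \<le> inner (\<Sum>i\<in>I. e i) x"
      using d by eventually_elim (metis (mono_tags, lifting) inner_sum_left le sum_mono)
    show "inner d m = inner (\<Sum>i\<in>I. e i) m"
      using eventually_nhds_x_imp_x[OF d] e by (simp add: inner_sum_left)
  qed
  from d have "\<forall>\<^sub>F x in nhds m. min_linear (S i) x = inner (e i) x"
  proof eventually_elim
    case (elim x)
    then have "(\<Sum>i\<in>I. inner (e i) x - min_linear (S i) x) = 0"
      by (simp add: de inner_sum_left sum_subtractf)
    then show ?case using le i I by (subst (asm) sum_nonneg_eq_0_iff) auto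
  qed
  then show ?thesis by (auto simp: locally_linear_at_def)
qed

definition positive_orthant :: "(real ^ 'k) set" where
  "positive_orthant = {x. \<forall>j. 0 < x $ j}"

definition open_cell :: "(real ^ 'k) set \<Rightarrow> real ^ 'k \<Rightarrow> (real ^ 'k) set" where
  "open_cell S e = {x \<in> positive_orthant. \<forall>e' \<in> S - {e}. inner e x < inner e' x}"

definition closed_cell :: "(real ^ 'k) set \<Rightarrow> real ^ 'k \<Rightarrow> (real ^ 'k) set" where
  "closed_cell S e = {x. (\<forall>j. 0 \<le> x $ j) \<and> (\<forall>e' \<in> S. inner e x \<le> inner e' x)}"

lemma open_positive_orthant: "open (positive_orthant :: (real ^ 'k::finite) set)"
proof -
  have "positive_orthant = (\<Inter>j. {x :: real ^ 'k. 0 < x $ j})" by (auto simp: positive_orthant_def)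
  also have "open \<dots>" by (intro open_INT open_Collect_less ballI continuous_intros) auto
  finally show ?thesis .
qed

lemma open_open_cell:
  assumes "finite S"
  shows "open (open_cell S e)"
proof -
  have "open_cell S e = positive_orthant \<inter> (\<Inter>e' \<in> S - {e}. {x. inner e x < inner e' x})"
    by (auto simp: open_cell_def)
  also have "open \<dots>"
    using assms by (intro open_Int open_positive_orthant open_INT open_Collect_less ballI
        continuous_intros) auto
  finally show ?thesis .
qed

lemma convex_cell_segment:
  assumes x: "x \<in> closed_cell S e" and u: "u \<in> open_cell S e" and t: "0 < t" "t \<le> 1"
  shows "(1 - t) *\<^sub>R x + t *\<^sub>R u \<in> open_cell S e"
proof -
  have "(1 - t) * inner e x + t * inner e u < (1 - t) * inner e' x + t * inner e' u"
    if "e' \<in> S - {e}" for e'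
    using x u t that by (intro add_le_less_mono mult_left_mono mult_strict_left_mono)
      (auto simp: closed_cell_def open_cell_def)
  moreover have "0 < (1 - t) * x $ j + t * u $ j" for j
    using x u t by (intro add_nonneg_pos mult_nonneg_nonneg mult_pos_pos)
      (auto simp: closed_cell_def open_cell_def positive_orthant_def)
  ultimately show ?thesis
    by (auto simp: open_cell_def positive_orthant_def inner_add_right)
qed

lemma open_cell_subset: "open_cell S e \<subseteq> closed_cell S e"
proof
  fix x assume x: "x \<in> open_cell S e"
  have "inner e x \<le> inner e' x" if "e' \<in> S" for e'
    using x that by (cases "e' = e") (auto simp: open_cell_def intro: less_imp_le)
  then show "x \<in> closed_cell S e"
    using x by (auto simp: open_cell_def closed_cell_def positive_orthant_def intro: less_imp_le)
qed

lemma convex_open_cell: "convex (open_cell S e)"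
  unfolding convex_alt
proof (intro ballI allI impI)
  fix x y and u :: real assume *: "x \<in> open_cell S e" "y \<in> open_cell S e" "0 \<le> u \<and> u \<le> 1"
  show "(1 - u) *\<^sub>R x + u *\<^sub>R y \<in> open_cell S e"
    using * convex_cell_segment[of x S e y u] open_cell_subset by (cases "u = 0") auto
qed

lemma closed_cell_halfspaces:
  "closed_cell S e = (\<Inter>j. {x. inner (- axis j 1) x \<le> 0}) \<inter> (\<Inter>e' \<in> S. {x. inner (e - e') x \<le> 0})"
  by (auto simp: closed_cell_def inner_diff_left inner_axis')

lemma polyhedron_closed_cell:
  fixes S :: "(real ^ 'k::finite) set"
  assumes "finite S"
  shows "polyhedron (closed_cell S e)"
  unfolding closed_cell_halfspaces
  using assms by (intro polyhedron_Int polyhedron_Inter) (auto simp: polyhedron_halfspace_le polyhedron_halfspace_ge)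

lemma closed_cell_cone:
  fixes S :: "(real ^ 'k::finite) set"
  assumes "finite S"
  shows "strongly_convex_polyhedral_cone (closed_cell S e)"
  unfolding strongly_convex_polyhedral_cone_def
proof (intro conjI ballI impI polyhedron_closed_cell assms)
  show "cone (closed_cell S e)" by (auto simp: cone_def closed_cell_def mult_left_mono)
  show "closed_cell S e \<noteq> {}" by (auto simp: closed_cell_def intro!: exI[of _ 0])
  fix x assume "x \<in> closed_cell S e" "x \<noteq> 0"
  then obtain j where "0 < x $ j" by (auto simp: closed_cell_def Finite_Cartesian_Product.vec_eq_iff order_less_le)
  then show "- x \<notin> closed_cell S e" by (auto simp: closed_cell_def not_le)
qed

lemma closed_cell_Int_face:
  fixes S :: "(real ^ 'k::finite) set"
  assumes "finite S" "e \<in> S" "e' \<in> S"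
  shows "closed_cell S e \<inter> closed_cell S e' face_of closed_cell S e"
proof -
  have "closed_cell S e \<inter> closed_cell S e' = closed_cell S e \<inter> {x. inner (e - e') x = 0}"
    using assms by (auto simp: closed_cell_def inner_diff_left intro: antisym)
  also have "\<dots> face_of closed_cell S e"
    using assms polyhedron_closed_cell[THEN polyhedron_imp_convex]
    by (intro face_of_Int_supporting_hyperplane_le) (auto simp: closed_cell_def inner_diff_left)
  finally show ?thesis .
qed

lemma closure_open_cell:
  fixes S :: "(real ^ 'k::finite) set"
  assumes "finite S" "open_cell S e \<noteq> {}"
  shows "closure (open_cell S e) = closed_cell S e"
proof
  show "closure (open_cell S e) \<subseteq> closed_cell S e"
    using polyhedron_closed_cell[OF assms(1)] open_cell_subset
    by (intro closure_minimal polyhedron_imp_closed)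
  obtain u where u: "u \<in> open_cell S e" using assms by blast
  show "closed_cell S e \<subseteq> closure (open_cell S e)"
  proof
    fix x assume x: "x \<in> closed_cell S e"
    show "x \<in> closure (open_cell S e)"
    proof (cases "x = u")
      case False
      have "open_segment x u \<subseteq> open_cell S e"
        using convex_cell_segment[OF x u] by (auto simp: in_segment)
      then have "closure (open_segment x u) \<subseteq> closure (open_cell S e)" by (rule closure_mono)
      then show ?thesis using False by (auto simp: closure_open_segment)
    qed (use u closure_subset in auto)
  qed
qed

lemma open_cell_disjoint:
  "e \<in> S \<Longrightarrow> e' \<in> S \<Longrightarrow> x \<in> open_cell S e \<Longrightarrow> x \<in> open_cell S e' \<Longrightarrow> e = e'"
  unfolding open_cell_def by (metis (no_types, lifting) Diff_iff mem_Collect_eq order_less_asym singletonD)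

lemma components_open_cells:
  fixes S :: "(real ^ 'k::finite) set"
  assumes S: "finite S" and K: "K \<in> components (\<Union>e \<in> S. open_cell S e)"
  obtains e where "e \<in> S" "K = open_cell S e" "open_cell S e \<noteq> {}"
proof -
  let ?R = "\<Union>e \<in> S. open_cell S e"
  obtain x where x: "x \<in> K" using in_components_nonempty[OF K] by blast
  then obtain e where e: "e \<in> S" "x \<in> open_cell S e" using in_components_subset[OF K] by blast
  have "K \<subseteq> open_cell S e"
  proof (rule ccontr)
    assume "\<not> K \<subseteq> open_cell S e"
    let ?B = "\<Union>e' \<in> S - {e}. open_cell S e'"
    have B: "open ?B" using S by (intro open_UN ballI open_open_cell)
    have "K \<subseteq> open_cell S e \<union> ?B" using in_components_subset[OF K] by blast
    moreover have "open_cell S e \<inter> ?B \<inter> K = {}" using open_cell_disjoint[OF e(1)] by blast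
    ultimately have "open_cell S e \<inter> K = {} \<or> ?B \<inter> K = {}"
      using connectedD[OF in_components_connected[OF K] open_open_cell[OF S] B] by blast
    then show False
      using e x \<open>\<not> K \<subseteq> open_cell S e\<close> in_components_subset[OF K] by blast
  qed
  moreover have "open_cell S e \<subseteq> K"
  proof (rule components_maximal[OF K])
    show "connected (open_cell S e)" by (rule convex_connected[OF convex_open_cell])
  qed (use e x in auto)
  ultimately show ?thesis using that[of e] e by blast
qed

text \<open>
  The sum is again a minimum of finitely many linear functions.  On each component of \<open>R\<close> one of them
  is the strict minimum, so the closures are closed cells, and two closed cells meet along the
  hyperplane on which their linear functions agree, which supports both of them.
\<close>

theorem is_fan_linearity_regions:
  fixes S :: "'i \<Rightarrow> (real ^ 'k::finite) set"
  assumes I: "finite I" and S: "\<And>i. i \<in> I \<Longrightarrow> finite (S i) \<and> S i \<noteq> {}"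
    and R: "R = {m \<in> positive_orthant. locally_linear_at (\<lambda>x. \<Sum>i\<in>I. min_linear (S i) x) m}"
  defines "\<D> \<equiv> closure ` components R"
  shows "is_fan (\<D> \<union> {F. \<exists>C \<in> \<D>. cone_face F C})"
proof -
  obtain T where T: "finite T" "T \<noteq> {}"
    and T3: "\<forall>x. (\<Sum>i\<in>I. min_linear (S i) x) = min_linear T x"
    using sum_min_linear[of I S] I S by blast
  have "R = (\<Union>e \<in> T. open_cell T e)"
    unfolding R T3[rule_format] locally_linear_min_linear_iff[OF T(1,2)] by (auto simp: open_cell_def)
  note cells = this
  have D: "\<exists>e \<in> T. C = closed_cell T e" if C: "C \<in> \<D>" for C
  proof -
    obtain K where K: "K \<in> components R" "C = closure K" using C by (auto simp: \<D>_def)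
    obtain e where e: "e \<in> T" "K = open_cell T e" "open_cell T e \<noteq> {}"
      using components_open_cells[OF T(1) K(1)[unfolded cells]] .
    then show ?thesis using closure_open_cell[OF T(1) e(3)] K(2) by blast
  qed
  show ?thesis
  proof (rule is_fan_faces)
    show "strongly_convex_polyhedral_cone C" if "C \<in> \<D>" for C
      using D[OF that] closed_cell_cone[OF T(1)] by blast
    show "C \<inter> E face_of C" if "C \<in> \<D>" "E \<in> \<D>" for C E
      using D[OF that(1)] D[OF that(2)] closed_cell_Int_face[OF T(1)] by blast
  qed
qed

section \<open>Minors of unitriangular matrices\<close>

text \<open>
  Rows and columns are lists, so that they can be appended and reordered at the cost of a sign;
  \<open>set_minor\<close> sorts its columns, which fixes the signs for which the minors below are positive.
\<close>

definition minor :: "(nat \<Rightarrow> nat \<Rightarrow> real) \<Rightarrow> nat list \<Rightarrow> nat list \<Rightarrow> real" where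
  "minor z rs cs = Determinant.det (Matrix.mat (length rs) (length rs) (\<lambda>(i, j). z (rs ! i) (cs ! j)))"

definition set_minor :: "(nat \<Rightarrow> nat \<Rightarrow> real) \<Rightarrow> nat list \<Rightarrow> nat set \<Rightarrow> real" where
  "set_minor z rs J = minor z rs (sorted_list_of_set J)"

definition flag_minor :: "(nat \<Rightarrow> nat \<Rightarrow> real) \<Rightarrow> nat set \<Rightarrow> real" where
  "flag_minor z J = set_minor z [1..<Suc (card J)] J"

lemma minor_cong:
  assumes "\<And>i j. i < length rs \<Longrightarrow> j < length rs \<Longrightarrow> z (rs ! i) (cs ! j) = z' (rs ! i) (cs' ! j)"
  shows "minor z rs cs = minor z' rs cs'"
  unfolding minor_def by (intro arg_cong[of _ _ Determinant.det] eq_matI) (auto simp: assms)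

lemma minor_swap_adjacent:
  assumes len: "length rs = length (xs @ [x, y] @ ys)"
  shows "minor z rs (xs @ [x, y] @ ys) = - minor z rs (xs @ [y, x] @ ys)"
proof -
  let ?n = "length rs" and ?k = "length xs"
  let ?M = "\<lambda>cs. Matrix.mat ?n ?n (\<lambda>(i, j). z (rs ! i) (cs ! j))"
  have "?M (xs @ [x, y] @ ys) = swapcols ?k (Suc ?k) (?M (xs @ [y, x] @ ys))"
    by (rule eq_matI) (use len in \<open>auto simp: nth_append nth_Cons'\<close>)
  then show ?thesis
    unfolding minor_def using len by (simp add: det_swapcols[of _ ?n])
qed

lemma minor_move_right:
  assumes "length rs = length (xs @ [x] @ ys @ zs)"
  shows "minor z rs (xs @ [x] @ ys @ zs) = (- 1) ^ length ys * minor z rs (xs @ ys @ [x] @ zs)"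
  using assms
proof (induction ys arbitrary: xs)
  case (Cons y ys)
  have "minor z rs (xs @ [x, y] @ ys @ zs) = - minor z rs (xs @ [y, x] @ ys @ zs)"
    by (rule minor_swap_adjacent) (use Cons.prems in simp)
  also have "minor z rs (xs @ [y, x] @ ys @ zs) =
      (- 1) ^ length ys * minor z rs (xs @ (y # ys) @ [x] @ zs)"
    using Cons.IH[of "xs @ [y]"] Cons.prems by simp
  finally show ?case by simp
qed simp

lemma sorted_list_of_set_split:
  assumes "finite S" "x \<notin> S"
  shows "sorted_list_of_set (insert x S) =
      sorted_list_of_set {s \<in> S. s < x} @ [x] @ sorted_list_of_set {s \<in> S. x < s}"
    and "sorted_list_of_set S =
      sorted_list_of_set {s \<in> S. s < x} @ sorted_list_of_set {s \<in> S. x < s}"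
proof -
  let ?A = "{s \<in> S. s < x}" and ?B = "{s \<in> S. x < s}"
  have fin: "finite ?A" "finite ?B" using assms by auto
  show "sorted_list_of_set (insert x S) =
      sorted_list_of_set ?A @ [x] @ sorted_list_of_set ?B"
  proof (rule sorted_distinct_set_unique[OF sorted_sorted_list_of_set distinct_sorted_list_of_set])
    show "sorted (sorted_list_of_set ?A @ [x] @ sorted_list_of_set ?B)"
      using fin by (auto simp: sorted_append)
    show "set (sorted_list_of_set (insert x S)) = set (sorted_list_of_set ?A @ [x] @ sorted_list_of_set ?B)"
      by (subst set_sorted_list_of_set) (use assms fin in \<open>auto simp: neq_iff\<close>)
  qed (use fin assms in auto)
  show "sorted_list_of_set S = sorted_list_of_set ?A @ sorted_list_of_set ?B"
  proof (rule sorted_distinct_set_unique)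
    show "sorted (sorted_list_of_set ?A @ sorted_list_of_set ?B)"
      using fin by (auto simp: sorted_append)
    show "set (sorted_list_of_set S) = set (sorted_list_of_set ?A @ sorted_list_of_set ?B)"
      using assms fin by (auto simp: neq_iff) (metis linorder_cases)
  qed (use fin assms in auto)
qed

text \<open>
  On its way from its sorted position to the end of the list, \<open>x\<close> passes the larger elements.
\<close>

lemma minor_sorted_insert:
  assumes S: "finite S" "x \<notin> S" and len: "length rs = Suc (card S + length zs)"
  shows "minor z rs (sorted_list_of_set (insert x S) @ zs) =
     (- 1) ^ card {s \<in> S. x < s} * minor z rs (sorted_list_of_set S @ [x] @ zs)"
proof -
  have "card S = length (sorted_list_of_set {s \<in> S. s < x} @ sorted_list_of_set {s \<in> S. x < s})"
    using sorted_list_of_set_split(2)[OF S] by (metis length_sorted_list_of_set)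
  then show ?thesis
    unfolding sorted_list_of_set_split[OF S]
    using minor_move_right[of rs "sorted_list_of_set {s \<in> S. s < x}" x
        "sorted_list_of_set {s \<in> S. x < s}" zs z] len by simp
qed

lemma minor_sort:
  assumes "distinct cs"
  obtains s :: real where "s = 1 \<or> s = - 1"
    "\<And>z rs. length rs = length cs \<Longrightarrow> minor z rs cs = s * set_minor z rs (set cs)"
proof -
  have "\<exists>s :: real. (s = 1 \<or> s = - 1) \<and> (\<forall>z rs zs. length rs = length cs + length zs \<longrightarrow>
      minor z rs (cs @ zs) = s * minor z rs (sorted_list_of_set (set cs) @ zs))"
    using assms
  proof (induction cs)
    case Nil
    show ?case by (intro exI[of _ 1]) simp
  next
    case (Cons x cs)
    then obtain s :: real where s: "s = 1 \<or> s = - 1"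
      "\<And>z rs zs. length rs = length cs + length zs \<Longrightarrow>
        minor z rs (cs @ zs) = s * minor z rs (sorted_list_of_set (set cs) @ zs)" by auto
    let ?e = "(- 1) ^ length cs * s * (- 1) ^ card {s \<in> set cs. x < s} :: real"
    have "minor z rs ((x # cs) @ zs) = ?e * minor z rs (sorted_list_of_set (set (x # cs)) @ zs)"
      if len: "length rs = length (x # cs) + length zs" for z rs zs
    proof -
      let ?k = "card {s \<in> set cs. x < s}"
      have "minor z rs ((x # cs) @ zs) = (- 1) ^ length cs * minor z rs (cs @ [x] @ zs)"
        using minor_move_right[of rs "[]" x cs zs z] len by simp
      also have "minor z rs (cs @ [x] @ zs) = s * minor z rs (sorted_list_of_set (set cs) @ [x] @ zs)"
        using s(2)[of rs "[x] @ zs" z] len by simp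
      also have "minor z rs (sorted_list_of_set (set cs) @ [x] @ zs) =
          (- 1) ^ ?k * ((- 1) ^ ?k * minor z rs (sorted_list_of_set (set cs) @ [x] @ zs))"
        by (simp add: mult.assoc[symmetric] power_add[symmetric])
      also have "(- 1) ^ ?k * minor z rs (sorted_list_of_set (set cs) @ [x] @ zs) =
          minor z rs (sorted_list_of_set (set (x # cs)) @ zs)"
        using minor_sorted_insert[of "set cs" x rs zs z] Cons.prems len
        by (simp add: distinct_card)
      finally show ?thesis by (simp add: mult_ac)
    qed
    moreover have "?e = 1 \<or> ?e = - 1"
      using s(1) by (cases "even (length cs)"; cases "even (card {s \<in> set cs. x < s})") auto
    ultimately show ?case by blast
  qed
  then obtain s :: real where s: "s = 1 \<or> s = - 1" and
    e: "\<forall>z rs zs. length rs = length cs + length zs \<longrightarrow>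
      minor z rs (cs @ zs) = s * minor z rs (sorted_list_of_set (set cs) @ zs)" by blast
  show ?thesis
  proof (rule that[OF s])
    show "minor z rs cs = s * set_minor z rs (set cs)" if "length rs = length cs" for z rs
      using e[rule_format, of rs "[]" z] that by (simp add: set_minor_def)
  qed
qed

text \<open>
  The coefficients \<open>\<kappa>\<close> express the columns in \<open>X\<close>, restricted to the rows \<open>R\<close>, through the columns \<open>L\<close>.
  Subtracting these combinations makes the matrix block triangular and leaves the Schur complement.
\<close>

lemma minor_schur:
  assumes len: "length R = a" "length L = a" "length P = b" "length X = b"
    and \<kappa>: "\<And>x i. x \<in> set X \<Longrightarrow> i < a \<Longrightarrow> (\<Sum>k<a. z (R ! i) (L ! k) * \<kappa> x k) = z (R ! i) x"
  shows "minor z (R @ P) (L @ X) = minor z R L *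
    Determinant.det (Matrix.mat b b (\<lambda>(i, j). z (P ! i) (X ! j) - (\<Sum>k<a. z (P ! i) (L ! k) * \<kappa> (X ! j) k)))"
proof -
  let ?A = "Matrix.mat a a (\<lambda>(i, j). z (R ! i) (L ! j))"
  let ?C = "Matrix.mat b a (\<lambda>(i, j). z (P ! i) (L ! j))"
  let ?K = "Matrix.mat a b (\<lambda>(k, j). \<kappa> (X ! j) k)"
  let ?E = "Matrix.mat b b (\<lambda>(i, j). z (P ! i) (X ! j) - (\<Sum>k<a. z (P ! i) (L ! k) * \<kappa> (X ! j) k))"
  let ?M1 = "four_block_mat ?A (0\<^sub>m a b) ?C ?E"
  let ?M2 = "four_block_mat (1\<^sub>m a) ?K (0\<^sub>m b a) (1\<^sub>m b)"
  let ?M = "Matrix.mat (a + b) (a + b) (\<lambda>(i, j). z ((R @ P) ! i) ((L @ X) ! j))"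
  have prod: "?M1 * ?M2 = four_block_mat (?A * 1\<^sub>m a + 0\<^sub>m a b * 0\<^sub>m b a) (?A * ?K + 0\<^sub>m a b * 1\<^sub>m b)
      (?C * 1\<^sub>m a + ?E * 0\<^sub>m b a) (?C * ?K + ?E * 1\<^sub>m b)"
    by (rule mult_four_block_mat) auto
  also have "\<dots> = four_block_mat ?A (?A * ?K) ?C (?C * ?K + ?E)"
    using right_add_zero_mat[OF mult_carrier_mat[of ?A a a ?K b]]
    by (simp add: right_mult_zero_mat[of _ _ b] left_mult_zero_mat[of _ b])
  also have "\<dots> = ?M"
  proof (rule eq_matI)
    fix i j assume "i < dim_row ?M" "j < dim_col ?M"
    then have ij: "i < a + b" "j < a + b" by auto
    show "four_block_mat ?A (?A * ?K) ?C (?C * ?K + ?E) $$ (i, j) = ?M $$ (i, j)"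
    proof (cases "j < a")
      case True
      then show ?thesis using ij len by (auto simp: nth_append)
    next
      case False
      then have Xj: "X ! (j - a) \<in> set X" using ij len by simp
      show ?thesis
      proof (cases "i < a")
        case True
        have "(?A * ?K) $$ (i, j - a) = (\<Sum>k<a. z (R ! i) (L ! k) * \<kappa> (X ! (j - a)) k)"
          using True False ij by (simp add: scalar_prod_def atLeast0LessThan)
        then show ?thesis using True False ij len \<kappa>[OF Xj] by (simp add: nth_append)
      next
        case i: False
        have "(?C * ?K) $$ (i - a, j - a) = (\<Sum>k<a. z (P ! (i - a)) (L ! k) * \<kappa> (X ! (j - a)) k)"
          using i False ij by (simp add: scalar_prod_def atLeast0LessThan)
        then show ?thesis using i False ij len by (simp add: nth_append)
      qed
    qed
  qed auto
  finally have M: "?M = ?M1 * ?M2" ..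
  have "Determinant.det ?M = Determinant.det ?M1 * Determinant.det ?M2"
    unfolding M by (rule det_mult[of _ "a + b"]) auto
  also have "Determinant.det ?M1 = Determinant.det ?A * Determinant.det ?E"
    by (rule det_four_block_mat_upper_right_zero) auto
  also have "Determinant.det ?M2 = Determinant.det (1\<^sub>m a :: real mat) * Determinant.det (1\<^sub>m b :: real mat)"
    by (rule det_four_block_mat_lower_left_zero) auto
  finally show ?thesis using len by (simp add: minor_def)
qed

lemma minor_schur1:
  assumes "length R = a" "length L = a"
    and "\<And>i. i < a \<Longrightarrow> (\<Sum>k<a. z (R ! i) (L ! k) * \<kappa> k) = z (R ! i) x"
  shows "minor z (R @ [\<rho>]) (L @ [x]) = minor z R L * (z \<rho> x - (\<Sum>k<a. z \<rho> (L ! k) * \<kappa> k))"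
  using minor_schur[of R a L "[\<rho>]" 1 "[x]" z "\<lambda>_. \<kappa>"] assms by (simp add: det_single)

lemma cramer_exists:
  assumes len: "length R = a" "length L = a" and d: "minor z R L \<noteq> 0"
  obtains \<kappa> where "\<And>x i. i < a \<Longrightarrow> (\<Sum>k<a. z (R ! i) (L ! k) * \<kappa> x k) = z (R ! i) x"
proof -
  let ?A = "Matrix.mat a a (\<lambda>(i, j). z (R ! i) (L ! j))"
  let ?d = "Determinant.det ?A"
  have dA: "?d \<noteq> 0" using d len by (simp add: minor_def)
  have adj: "adj_mat ?A \<in> carrier_mat a a" "?A * adj_mat ?A = ?d \<cdot>\<^sub>m 1\<^sub>m a"
    using adj_mat[of ?A a] by auto
  define \<kappa> where "\<kappa> x k = (\<Sum>l<a. adj_mat ?A $$ (k, l) * z (R ! l) x) / ?d" for x k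
  have "(\<Sum>k<a. z (R ! i) (L ! k) * \<kappa> x k) = z (R ! i) x" if i: "i < a" for x i
  proof -
    have e: "(\<Sum>k<a. z (R ! i) (L ! k) * adj_mat ?A $$ (k, l)) = (if i = l then ?d else 0)" if "l < a" for l
    proof -
      have "(?A * adj_mat ?A) $$ (i, l) = (\<Sum>k<a. z (R ! i) (L ! k) * adj_mat ?A $$ (k, l))"
        using i that adj(1) by (simp add: scalar_prod_def atLeast0LessThan)
      then show ?thesis using i that unfolding adj(2) by (cases "i = l") simp_all
    qed
    have "?d * \<kappa> x k = (\<Sum>l<a. adj_mat ?A $$ (k, l) * z (R ! l) x)" for k
      using dA by (simp add: \<kappa>_def)
    note d\<kappa> = this
    have "?d * (\<Sum>k<a. z (R ! i) (L ! k) * \<kappa> x k) = (\<Sum>k<a. z (R ! i) (L ! k) * (?d * \<kappa> x k))"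
      by (simp add: sum_distrib_left mult.left_commute)
    also have "\<dots> = (\<Sum>k<a. z (R ! i) (L ! k) * (\<Sum>l<a. adj_mat ?A $$ (k, l) * z (R ! l) x))"
      by (simp only: d\<kappa>)
    also have "\<dots> = (\<Sum>k<a. \<Sum>l<a. z (R ! i) (L ! k) * adj_mat ?A $$ (k, l) * z (R ! l) x)"
      by (simp add: sum_distrib_left mult.assoc)
    also have "\<dots> = (\<Sum>l<a. (\<Sum>k<a. z (R ! i) (L ! k) * adj_mat ?A $$ (k, l)) * z (R ! l) x)"
      by (subst sum.swap) (simp add: sum_distrib_right)
    also have "\<dots> = (\<Sum>l<a. if i = l then ?d * z (R ! l) x else 0)"
      by (rule sum.cong) (auto simp: e)
    also have "\<dots> = ?d * z (R ! i) x" using i by simp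
    finally show ?thesis using dA by simp
  qed
  then show ?thesis by (rule that)
qed

text \<open>
  After division by the minor on \<open>R\<close> and \<open>L\<close>, the bordered minors are the entries and the determinant of
  one \<open>2 \<times> 2\<close> Schur complement.
\<close>

lemma minor_jacobi:
  assumes len: "length R = a" "length L = a" and d: "minor z R L \<noteq> 0"
  shows "minor z (R @ [\<rho>]) (L @ [x]) * minor z (R @ [\<sigma>]) (L @ [y]) -
      minor z (R @ [\<sigma>]) (L @ [x]) * minor z (R @ [\<rho>]) (L @ [y]) =
      minor z (R @ [\<rho>, \<sigma>]) (L @ [x, y]) * minor z R L"
proof -
  obtain \<kappa> where \<kappa>: "\<And>x i. i < a \<Longrightarrow> (\<Sum>k<a. z (R ! i) (L ! k) * \<kappa> x k) = z (R ! i) x"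
    using cramer_exists[OF assms] by blast
  define q where "q \<rho> x = z \<rho> x - (\<Sum>k<a. z \<rho> (L ! k) * \<kappa> x k)" for \<rho> x
  have 1: "minor z (R @ [\<rho>]) (L @ [x]) = minor z R L * q \<rho> x" for \<rho> x
    unfolding q_def by (rule minor_schur1[OF len]) (rule \<kappa>)
  have "minor z (R @ [\<rho>, \<sigma>]) (L @ [x, y]) =
      minor z R L * Determinant.det (Matrix.mat 2 2 (\<lambda>(i, j). q ([\<rho>, \<sigma>] ! i) ([x, y] ! j)))"
    unfolding q_def by (rule minor_schur[OF len]) (auto simp: \<kappa>)
  also have "Determinant.det (Matrix.mat 2 2 (\<lambda>(i, j). q ([\<rho>, \<sigma>] ! i) ([x, y] ! j))) =
      q \<rho> x * q \<sigma> y - q \<rho> y * q \<sigma> x"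
    by (subst laplace_expansion_column[of _ 2 0])
      (auto simp: numeral_2_eq_2 lessThan_Suc cofactor_def det_single mat_delete_def)
  finally have 2: "minor z (R @ [\<rho>, \<sigma>]) (L @ [x, y]) = minor z R L * (q \<rho> x * q \<sigma> y - q \<rho> y * q \<sigma> x)" .
  show ?thesis unfolding 1 2 by (simp add: algebra_simps)
qed

text \<open>
  Because \<open>x < y\<close>, sorting contributes the same two signs to each of the three products.
\<close>

lemma set_minor_jacobi:
  assumes L: "finite L" "card L = length R" and xy: "x \<notin> L" "y \<notin> L" "x < y"
    and d: "set_minor z R L \<noteq> 0"
  shows "set_minor z (R @ [\<rho>]) (insert x L) * set_minor z (R @ [\<sigma>]) (insert y L) -
      set_minor z (R @ [\<sigma>]) (insert x L) * set_minor z (R @ [\<rho>]) (insert y L) =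
      set_minor z (R @ [\<rho>, \<sigma>]) (insert x (insert y L)) * set_minor z R L"
proof -
  let ?L = "sorted_list_of_set L"
  define a b where "a = card {s \<in> L. x < s}" and "b = card {s \<in> L. y < s}"
  have sx: "set_minor z (R @ [\<tau>]) (insert x L) = (- 1) ^ a * minor z (R @ [\<tau>]) (?L @ [x])" for \<tau>
    using minor_sorted_insert[of L x "R @ [\<tau>]" "[]" z] L xy by (simp add: set_minor_def a_def)
  have sy: "set_minor z (R @ [\<tau>]) (insert y L) = (- 1) ^ b * minor z (R @ [\<tau>]) (?L @ [y])" for \<tau>
    using minor_sorted_insert[of L y "R @ [\<tau>]" "[]" z] L xy by (simp add: set_minor_def b_def)
  have "{s \<in> insert x L. y < s} = {s \<in> L. y < s}" using xy by auto
  then have "set_minor z (R @ [\<rho>, \<sigma>]) (insert y (insert x L)) =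
      (- 1) ^ b * minor z (R @ [\<rho>, \<sigma>]) (sorted_list_of_set (insert x L) @ [y])"
    using minor_sorted_insert[of "insert x L" y "R @ [\<rho>, \<sigma>]" "[]" z] L xy
    by (simp add: set_minor_def b_def)
  also have "minor z (R @ [\<rho>, \<sigma>]) (sorted_list_of_set (insert x L) @ [y]) =
      (- 1) ^ a * minor z (R @ [\<rho>, \<sigma>]) (?L @ [x, y])"
    using minor_sorted_insert[of L x "R @ [\<rho>, \<sigma>]" "[y]" z] L xy by (simp add: a_def)
  finally have sxy: "set_minor z (R @ [\<rho>, \<sigma>]) (insert x (insert y L)) =
      (- 1) ^ b * ((- 1) ^ a * minor z (R @ [\<rho>, \<sigma>]) (?L @ [x, y]))"
    by (simp add: insert_commute)
  have "minor z (R @ [\<rho>]) (?L @ [x]) * minor z (R @ [\<sigma>]) (?L @ [y]) -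
      minor z (R @ [\<sigma>]) (?L @ [x]) * minor z (R @ [\<rho>]) (?L @ [y]) =
      minor z (R @ [\<rho>, \<sigma>]) (?L @ [x, y]) * minor z R ?L"
    using d L by (intro minor_jacobi[of _ "length R"]) (auto simp: set_minor_def)
  then have "(- 1) ^ b * ((- 1) ^ a * (minor z (R @ [\<rho>]) (?L @ [x]) * minor z (R @ [\<sigma>]) (?L @ [y]) -
      minor z (R @ [\<sigma>]) (?L @ [x]) * minor z (R @ [\<rho>]) (?L @ [y]))) =
      (- 1) ^ b * ((- 1) ^ a * (minor z (R @ [\<rho>, \<sigma>]) (?L @ [x, y]) * minor z R ?L))"
    by simp
  moreover have "set_minor z R L = minor z R ?L" by (simp add: set_minor_def)
  ultimately show ?thesis unfolding sx sy sxy by (simp add: algebra_simps)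
qed

text \<open>
  With \<open>P\<close> and \<open>Q\<close> the minors on \<open>L\<close> and one more column, bordered by the next row and by the one after
  it, this is the identity
  \<open>P\<^sub>y (P\<^sub>x Q\<^sub>t - Q\<^sub>x P\<^sub>t) = (P\<^sub>x Q\<^sub>y - Q\<^sub>x P\<^sub>y) P\<^sub>t + (P\<^sub>y Q\<^sub>t - Q\<^sub>y P\<^sub>t) P\<^sub>x\<close>.
\<close>

lemma flag_minor_pluecker:
  assumes L: "finite L" "x \<notin> L" "y \<notin> L" "t \<notin> L" "x < y" "y < t" and d: "flag_minor z L \<noteq> 0"
  shows "flag_minor z (insert y L) * flag_minor z (insert x (insert t L)) =
    flag_minor z (insert x (insert y L)) * flag_minor z (insert t L) +
    flag_minor z (insert y (insert t L)) * flag_minor z (insert x L)"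
proof -
  define R where "R = [1..<Suc (card L)]"
  let ?\<rho> = "Suc (card L)" and ?\<sigma> = "Suc (Suc (card L))"
  have R1: "[1..<Suc (Suc (card L))] = R @ [?\<rho>]"
    and R2: "[1..<Suc (Suc (Suc (card L)))] = R @ [?\<rho>, ?\<sigma>]" and lenR: "length R = card L"
    by (simp_all add: R_def)
  define P Q where "P u = set_minor z (R @ [?\<rho>]) (insert u L)"
    and "Q u = set_minor z (R @ [?\<sigma>]) (insert u L)" for u
  have f0: "flag_minor z L = set_minor z R L" by (simp only: flag_minor_def R_def)
  have f1: "flag_minor z (insert u L) = P u" if "u \<notin> L" for u
    unfolding flag_minor_def P_def R1[symmetric] using that L by simp
  have f2: "P u * Q v - Q u * P v = flag_minor z (insert u (insert v L)) * flag_minor z L"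
    if "u \<notin> L" "v \<notin> L" "u < v" for u v
  proof -
    have "card (insert u (insert v L)) = Suc (Suc (card L))" using that L by simp
    then have "flag_minor z (insert u (insert v L)) = set_minor z (R @ [?\<rho>, ?\<sigma>]) (insert u (insert v L))"
      unfolding flag_minor_def R2[symmetric] by simp
    then show ?thesis
      using set_minor_jacobi[of L R u v z ?\<rho> ?\<sigma>] that L d lenR unfolding P_def Q_def f0 by simp
  qed
  have "(flag_minor z (insert y L) * flag_minor z (insert x (insert t L))) * flag_minor z L =
    (flag_minor z (insert x (insert y L)) * flag_minor z (insert t L) +
     flag_minor z (insert y (insert t L)) * flag_minor z (insert x L)) * flag_minor z L"
  proof -
    note xy = f2[OF L(2) L(3) L(5)] and yt = f2[OF L(3) L(4) L(6)]
      and xt = f2[OF L(2) L(4) less_trans[OF L(5,6)]]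
    have "P y * (flag_minor z (insert x (insert t L)) * flag_minor z L) =
        (flag_minor z (insert x (insert y L)) * flag_minor z L) * P t +
        (flag_minor z (insert y (insert t L)) * flag_minor z L) * P x"
      unfolding xy[symmetric] yt[symmetric] xt[symmetric] by (simp add: algebra_simps)
    then show ?thesis unfolding f1[OF L(2)] f1[OF L(3)] f1[OF L(4)] by (simp add: algebra_simps)
  qed
  then show ?thesis using d by simp
qed


lemma minor_triangular:
  assumes len: "length rs = n" "length cs = n"
    and zero: "\<And>i j. i < n \<Longrightarrow> j < i \<Longrightarrow> z (rs ! i) (cs ! j) = 0"
  shows "minor z rs cs = (\<Prod>i<n. z (rs ! i) (cs ! i))"
proof -
  let ?M = "Matrix.mat n n (\<lambda>(i, j). z (rs ! i) (cs ! j))"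
  have "Determinant.det ?M = prod_list (diag_mat ?M)"
    by (rule det_upper_triangular[of _ n]) (auto simp: upper_triangular_def zero)
  also have "diag_mat ?M = map (\<lambda>i. z (rs ! i) (cs ! i)) [0..<n]"
    by (auto simp: diag_mat_def)
  also have "prod_list \<dots> = (\<Prod>i<n. z (rs ! i) (cs ! i))"
    by (subst prod.distinct_set_conv_list[symmetric]) (simp_all add: atLeast0LessThan)
  finally show ?thesis using len by (simp add: minor_def)
qed

definition unitriangular :: "nat \<Rightarrow> (nat \<Rightarrow> nat \<Rightarrow> real) \<Rightarrow> bool" where
  "unitriangular m z \<longleftrightarrow> (\<forall>r \<in> {1..m}. z r r = 1 \<and> (\<forall>c \<in> {1..m}. c < r \<longrightarrow> z r c = 0))"

lemma sorted_list_of_interval: "sorted_list_of_set {a..b :: nat} = [a..<Suc b]"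
  by (metis atLeastLessThanSuc_atLeastAtMost sorted_list_of_set_range)

lemma flag_minor_interval:
  "r \<le> c \<Longrightarrow> flag_minor z {Suc c - r..c} = minor z [1..<Suc r] [Suc c - r..<Suc c]"
  unfolding flag_minor_def set_minor_def sorted_list_of_interval by simp

lemma set_minor_unitriangular:
  assumes z: "unitriangular m z" and c: "c \<in> {1..m}" and \<rho>: "\<rho> \<in> {1..m}"
  shows "set_minor z ([1..<c] @ [\<rho>]) {1..c} = (if \<rho> = c then 1 else 0)"
proof (cases "\<rho> < c")
  case True
  let ?rs = "[1..<c] @ [\<rho>]"
  let ?M = "Matrix.mat c c (\<lambda>(i, j). z (?rs ! i) ([1..<Suc c] ! j))"
  have "Determinant.det ?M = 0"
    by (rule det_identical_rows[of _ c "\<rho> - 1" "c - 1"])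
      (use True \<rho> c in \<open>auto simp: nth_append intro!: eq_vecI\<close>)
  then show ?thesis
    using True c unfolding set_minor_def sorted_list_of_interval minor_def by simp
next
  case False
  let ?rs = "[1..<c] @ [\<rho>]"
  have nth: "?rs ! i = (if i < c - 1 then i + 1 else \<rho>)" if "i < c" for i
    using that by (auto simp: nth_append)
  have nth': "[1..<Suc c] ! j = j + 1" if "j < c" for j
    using that nth_upt[of 1 j "Suc c"] by simp
  have "set_minor z ?rs {1..c} = (\<Prod>i<c. z (?rs ! i) ([1..<Suc c] ! i))"
    unfolding set_minor_def sorted_list_of_interval
  proof (rule minor_triangular)
    fix i j assume ij: "i < c" "j < i"
    then show "z (?rs ! i) ([1..<Suc c] ! j) = 0"
      unfolding nth[OF ij(1)] using nth'[of j] z c \<rho> False by (auto simp: unitriangular_def)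
  qed (use c in auto)
  also have "\<dots> = (\<Prod>i<c. if i < c - 1 then 1 else z \<rho> c)"
  proof (rule prod.cong)
    fix i assume i: "i \<in> {..<c}"
    then have "i < c - 1 \<or> Suc i = c" by auto
    with i show "z (?rs ! i) ([1..<Suc c] ! i) = (if i < c - 1 then 1 else z \<rho> c)"
      using nth[of i] nth'[of i] z c by (auto simp: unitriangular_def not_less)
  qed simp
  also have "\<dots> = z \<rho> c" using c by (cases c) simp_all
  also have "\<dots> = (if \<rho> = c then 1 else 0)"
    using z c \<rho> False by (auto simp: unitriangular_def)
  finally show ?thesis .
qed

lemma flag_minor_principal:
  assumes z: "unitriangular m z" and r: "r \<le> m"
  shows "flag_minor z {1..r} = 1"
proof (cases "r = 0")
  case True
  then show ?thesis by (simp add: flag_minor_def set_minor_def minor_def)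
next
  case False
  then have "[1..<Suc (card {1..r})] = [1..<r] @ [r]" by simp
  then show ?thesis
    unfolding flag_minor_def using set_minor_unitriangular[OF z, of r r] False r by simp
qed

text \<open>
  Below its first row the submatrix is upper unitriangular up to a column of zeros, so that only the
  corner entry survives.
\<close>

lemma minor_entry:
  assumes z: "unitriangular m z" and rc: "1 \<le> r" "r < c" "c \<le> m"
  shows "minor z (r # [Suc c..<Suc m]) [c..<Suc m] = z r c"
proof -
  let ?rs = "r # [Suc c..<Suc m]" and ?n = "Suc m - c"
  have nth: "?rs ! i = (if i = 0 then r else c + i)" "[c..<Suc m] ! i = c + i" if "i < ?n" for i
    using that by (auto simp: nth_Cons' nth_upt simp del: upt_Suc)
  have "minor z ?rs [c..<Suc m] = (\<Prod>i<?n. z (?rs ! i) ([c..<Suc m] ! i))"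
  proof (rule minor_triangular)
    fix i j assume "i < ?n" "j < i"
    then show "z (?rs ! i) ([c..<Suc m] ! j) = 0"
      using nth(1)[of i] nth(2)[of j] z rc by (auto simp: unitriangular_def)
  qed (use rc in auto)
  also have "\<dots> = (\<Prod>i<?n. if i = 0 then z r c else 1)"
  proof (rule prod.cong)
    fix i assume "i \<in> {..<?n}"
    then show "z (?rs ! i) ([c..<Suc m] ! i) = (if i = 0 then z r c else 1)"
      using nth[of i] z rc by (auto simp: unitriangular_def)
  qed simp
  also have "\<dots> = z r c" using rc by (subst prod.delta) auto
  finally show ?thesis .
qed

definition last_columns :: "nat \<Rightarrow> nat \<Rightarrow> nat list" where
  "last_columns m j = map (\<lambda>k. m - k) [0..<j]"

text \<open>
  As a function of its last row, the \<open>j\<close>-th bordered minor is a combination of the last \<open>j + 1\<close> columns of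
  \<open>z\<close>.  So the matrix of bordered minors is the matrix of the last \<open>C\<close> columns times an upper triangular
  matrix, with the unbordered minors on the diagonal.
\<close>

lemma det_minors_last_columns:
  assumes \<phi>: "\<And>j. j < C \<Longrightarrow> minor z [1..<Suc j] (last_columns m j) \<noteq> 0" and I: "length I = C"
  shows "Determinant.det (Matrix.mat C C (\<lambda>(i, j). minor z ([1..<Suc j] @ [I ! i]) (last_columns m (Suc j)))) =
    minor z I (last_columns m C) * (\<Prod>j<C. minor z [1..<Suc j] (last_columns m j))"
proof -
  define \<phi> where "\<phi> j = minor z [1..<Suc j] (last_columns m j)" for j
  have "\<forall>j\<in>{..<C}. \<exists>\<kappa>. \<forall>i<j. (\<Sum>k<j. z ([1..<Suc j] ! i) (last_columns m j ! k) * \<kappa> k) = z ([1..<Suc j] ! i) (m - j)"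
  proof
    fix j assume j: "j \<in> {..<C}"
    have "length [1..<Suc j] = j" "length (last_columns m j) = j" by (simp_all add: last_columns_def)
    from cramer_exists[OF this] \<phi>[of j] j
    show "\<exists>\<kappa>. \<forall>i<j. (\<Sum>k<j. z ([1..<Suc j] ! i) (last_columns m j ! k) * \<kappa> k) = z ([1..<Suc j] ! i) (m - j)"
      by (metis lessThan_iff)
  qed
  then obtain \<kappa> where \<kappa>: "\<And>j i. j < C \<Longrightarrow> i < j \<Longrightarrow>
      (\<Sum>k<j. z ([1..<Suc j] ! i) (last_columns m j ! k) * \<kappa> j k) = z ([1..<Suc j] ! i) (m - j)"
    by (metis lessThan_iff)
  define U where "U k j = (if k = j then \<phi> j else if k < j then - (\<phi> j * \<kappa> j k) else 0)" for k j
  have h: "minor z ([1..<Suc j] @ [\<rho>]) (last_columns m (Suc j)) = (\<Sum>k<C. z \<rho> (last_columns m C ! k) * U k j)"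
    if j: "j < C" for j \<rho>
  proof -
    have nth: "k < i \<Longrightarrow> last_columns m i ! k = m - k" for k i by (simp add: last_columns_def)
    have "minor z ([1..<Suc j] @ [\<rho>]) (last_columns m j @ [m - j]) =
        minor z [1..<Suc j] (last_columns m j) * (z \<rho> (m - j) - (\<Sum>k<j. z \<rho> (last_columns m j ! k) * \<kappa> j k))"
      by (rule minor_schur1) (use \<kappa> j in \<open>auto simp: last_columns_def\<close>)
    also have "\<dots> = \<phi> j * z \<rho> (m - j) + (\<Sum>k<j. z \<rho> (m - k) * U k j)"
      unfolding \<phi>_def[symmetric] by (simp add: U_def nth algebra_simps sum_distrib_left sum_negf del: upt_Suc)
    also have "\<dots> = (\<Sum>k<Suc j. z \<rho> (m - k) * U k j)"
      by (simp add: U_def)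
    also have "\<dots> = (\<Sum>k<C. z \<rho> (m - k) * U k j)"
      by (rule sum.mono_neutral_left) (use j in \<open>auto simp: U_def\<close>)
    also have "\<dots> = (\<Sum>k<C. z \<rho> (last_columns m C ! k) * U k j)"
      by (rule sum.cong) (auto simp: nth)
    finally show ?thesis by (simp add: last_columns_def)
  qed
  let ?Z = "Matrix.mat C C (\<lambda>(i, j). z (I ! i) (last_columns m C ! j))"
  let ?U = "Matrix.mat C C (\<lambda>(i, j). U i j)"
  have "Matrix.mat C C (\<lambda>(i, j). minor z ([1..<Suc j] @ [I ! i]) (last_columns m (Suc j))) = ?Z * ?U"
  proof (rule eq_matI)
    fix i j assume "i < dim_row (?Z * ?U)" "j < dim_col (?Z * ?U)"
    then show "Matrix.mat C C (\<lambda>(i, j). minor z ([1..<Suc j] @ [I ! i]) (last_columns m (Suc j))) $$ (i, j) = (?Z * ?U) $$ (i, j)"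
      using h[of j "I ! i"] by (simp add: scalar_prod_def atLeast0LessThan)
  qed simp_all
  then have "Determinant.det (Matrix.mat C C (\<lambda>(i, j). minor z ([1..<Suc j] @ [I ! i]) (last_columns m (Suc j)))) =
      Determinant.det ?Z * Determinant.det ?U"
    by (simp add: det_mult[of _ C])
  also have "Determinant.det ?U = minor U [0..<C] [0..<C]"
    unfolding minor_def by (rule arg_cong[of _ _ Determinant.det], rule eq_matI) auto
  also have "\<dots> = (\<Prod>j<C. U ([0..<C] ! j) ([0..<C] ! j))"
    by (rule minor_triangular) (auto simp: U_def)
  also have "\<dots> = (\<Prod>j<C. \<phi> j)" by (rule prod.cong) (auto simp: U_def)
  also have "Determinant.det ?Z = minor z I (last_columns m C)" using I by (simp add: minor_def)
  finally show ?thesis by (simp add: \<phi>_def)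
qed

text \<open>
  Rings of functions of which only the values on \<open>G\<close> matter.  The instance of interest consists
  of the Laurent polynomials in the crossing numbers of a reduced word.
\<close>

locale function_ring =
  fixes G :: "'a set" and A :: "('a \<Rightarrow> real) set"
  assumes const_in: "(\<lambda>_. c) \<in> A"
    and add_in: "f \<in> A \<Longrightarrow> g \<in> A \<Longrightarrow> (\<lambda>x. f x + g x) \<in> A"
    and mult_in: "f \<in> A \<Longrightarrow> g \<in> A \<Longrightarrow> (\<lambda>x. f x * g x) \<in> A"
    and cong_in: "f \<in> A \<Longrightarrow> (\<And>x. x \<in> G \<Longrightarrow> f x = g x) \<Longrightarrow> g \<in> A"
begin

lemma sum_in: "(\<And>i. i \<in> I \<Longrightarrow> f i \<in> A) \<Longrightarrow> (\<lambda>x. \<Sum>i\<in>I. f i x) \<in> A"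
  by (induction I rule: infinite_finite_induct) (auto intro: const_in add_in)

lemma prod_in: "(\<And>i. i \<in> I \<Longrightarrow> f i \<in> A) \<Longrightarrow> (\<lambda>x. \<Prod>i\<in>I. f i x) \<in> A"
  by (induction I rule: infinite_finite_induct) (auto intro: const_in mult_in)

lemma det_in:
  assumes "\<And>i j. i < n \<Longrightarrow> j < n \<Longrightarrow> M i j \<in> A"
  shows "(\<lambda>x. Determinant.det (Matrix.mat n n (\<lambda>(i, j). M i j x))) \<in> A"
proof -
  have "Determinant.det (Matrix.mat n n (\<lambda>(i, j). M i j x)) =
      (\<Sum>p \<in> {p. p permutes {0..<n}}. signof p * (\<Prod>i = 0..<n. M i (p i) x))" for x
  proof -
    have "(\<Prod>i = 0..<n. Matrix.mat n n (\<lambda>(i, j). M i j x) $$ (i, p i)) = (\<Prod>i = 0..<n. M i (p i) x)"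
      if "p permutes {0..<n}" for p
      using permutes_in_image[OF that] by (intro prod.cong) auto
    then show ?thesis by (subst det_def'[of _ n]) (auto intro!: sum.cong)
  qed
  moreover have "(\<lambda>x. \<Sum>p \<in> {p. p permutes {0..<n}}. signof p * (\<Prod>i = 0..<n. M i (p i) x)) \<in> A"
  proof (intro sum_in mult_in const_in prod_in)
    fix p i assume "p \<in> {p. p permutes {0..<n}}" "i \<in> {0..<n}"
    then show "M i (p i) \<in> A" using permutes_in_image[of p "{0..<n}" i] by (auto intro: assms)
  qed
  ultimately show ?thesis by simp
qed

lemma minor_in:
  fixes Z :: "'a \<Rightarrow> nat \<Rightarrow> nat \<Rightarrow> real"
  assumes "length cs = length rs" "\<And>r c. r \<in> set rs \<Longrightarrow> c \<in> set cs \<Longrightarrow> (\<lambda>x. Z x r c) \<in> A"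
  shows "(\<lambda>x. minor (Z x) rs cs) \<in> A"
  unfolding minor_def by (rule det_in) (use assms in auto)

end

text \<open>
  An entry of \<open>z\<close> above the diagonal is a minor on consecutive last columns, because \<open>z\<close> is
  unitriangular.  The preceding product formula expresses this minor by bordered minors, and the only
  denominators that it introduces are the flag minors of the last columns.
\<close>

lemma function_ring_flag_minor:
  assumes A: "function_ring G A"
    and G: "\<And>z. z \<in> G \<Longrightarrow> unitriangular m z"
    and nz: "\<And>z j. z \<in> G \<Longrightarrow> j < m \<Longrightarrow> flag_minor z {Suc m - j..m} \<noteq> 0"
    and inv: "\<And>j. j < m \<Longrightarrow> (\<lambda>z. inverse (flag_minor z {Suc m - j..m})) \<in> A"
    and col: "\<And>j \<rho>. j < m \<Longrightarrow> \<rho> \<in> {1..m} \<Longrightarrow> (\<lambda>z. set_minor z ([1..<Suc j] @ [\<rho>]) {m - j..m}) \<in> A"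
    and J: "J \<subseteq> {1..m}"
  shows "(\<lambda>z. flag_minor z J) \<in> A"
proof -
  interpret function_ring G A by (rule A)
  have len: "length (last_columns m j) = j" for j by (simp add: last_columns_def)
  have dist: "distinct (last_columns m j)" and set_cols: "set (last_columns m j) = {Suc m - j..m}" if "j \<le> m" for j
  proof -
    show "distinct (last_columns m j)" using that by (auto simp: last_columns_def distinct_map inj_on_def)
    have "x \<in> (\<lambda>k. m - k) ` {0..<j}" if "x \<in> {Suc m - j..m}" for x
      using that \<open>j \<le> m\<close> by (intro image_eqI[of _ _ "m - x"]) auto
    then show "set (last_columns m j) = {Suc m - j..m}" using that by (auto simp: last_columns_def)
  qed
  have sgn: "\<exists>s :: real. (s = 1 \<or> s = - 1) \<and>
      (\<forall>z rs. length rs = j \<longrightarrow> minor z rs (last_columns m j) = s * set_minor z rs {Suc m - j..m})"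
    if "j \<le> m" for j
    using minor_sort[OF dist[OF that]] unfolding set_cols[OF that] len by metis
  have inv': "(\<lambda>z. inverse (minor z [1..<Suc j] (last_columns m j))) \<in> A"
    and nz': "z \<in> G \<Longrightarrow> minor z [1..<Suc j] (last_columns m j) \<noteq> 0" if j: "j < m" for j z
  proof -
    obtain s :: real where s1: "s = 1 \<or> s = - 1" and
      s2: "\<forall>z rs. length rs = j \<longrightarrow> minor z rs (last_columns m j) = s * set_minor z rs {Suc m - j..m}"
      using sgn[of j] j by auto
    have "card {Suc m - j..m} = j" using j by simp
    then have "minor z [1..<Suc j] (last_columns m j) = s * flag_minor z {Suc m - j..m}" for z
      using s2[rule_format, of "[1..<Suc j]" z] by (simp add: flag_minor_def del: upt_Suc)
    note s = s1 this
    show "(\<lambda>z. inverse (minor z [1..<Suc j] (last_columns m j))) \<in> A"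
      unfolding s(2) inverse_mult_distrib by (intro mult_in const_in inv j)
    show "z \<in> G \<Longrightarrow> minor z [1..<Suc j] (last_columns m j) \<noteq> 0" using s nz[of z j] j by auto
  qed
  have col': "(\<lambda>z. minor z ([1..<Suc j] @ [\<rho>]) (last_columns m (Suc j))) \<in> A" if j: "j < m" "\<rho> \<in> {1..m}" for j \<rho>
  proof -
    obtain s :: real where s2: "\<forall>z rs. length rs = Suc j \<longrightarrow>
        minor z rs (last_columns m (Suc j)) = s * set_minor z rs {Suc m - Suc j..m}"
      using sgn[OF Suc_leI[OF j(1)]] by blast
    have s: "minor z ([1..<Suc j] @ [\<rho>]) (last_columns m (Suc j)) =
        s * set_minor z ([1..<Suc j] @ [\<rho>]) {m - j..m}" for z
      using s2[rule_format, of "[1..<Suc j] @ [\<rho>]" z] by (simp del: upt_Suc)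
    show ?thesis unfolding s by (intro mult_in const_in col that)
  qed
  have entry: "(\<lambda>z. z r c) \<in> A" if rc: "r \<in> {1..m}" "c \<in> {1..m}" for r c
  proof (cases "r < c")
    case False
    show ?thesis
      by (rule cong_in[OF const_in[of "if r = c then 1 else 0"]])
        (use G rc False in \<open>auto simp: unitriangular_def\<close>)
  next
    case True
    let ?C = "Suc m - c" and ?I = "r # [Suc c..<Suc m]"
    have C: "?C \<le> m" "length ?I = ?C" "Suc m - ?C = c" using rc True by auto
    obtain s :: real where s: "s = 1 \<or> s = - 1"
      "\<And>z. minor z ?I (last_columns m ?C) = s * set_minor z ?I {c..m}"
      using sgn[OF C(1)] C(2,3) by metis
    have "(\<lambda>z. s * (Determinant.det (Matrix.mat ?C ?C (\<lambda>(i, j). minor z ([1..<Suc j] @ [?I ! i]) (last_columns m (Suc j)))) *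
        (\<Prod>j<?C. inverse (minor z [1..<Suc j] (last_columns m j))))) \<in> A" (is "?f \<in> A")
    proof (intro mult_in const_in prod_in inv' det_in col')
      show "j < m" if "j < ?C" for j using that C by simp
      show "j < m" if "j \<in> {..<?C}" for j using that C by simp
      show "?I ! i \<in> {1..m}" if "i < ?C" for i
      proof -
        have "?I ! i \<in> set ?I" using that C by (intro nth_mem) simp
        then show ?thesis using rc True by auto
      qed
    qed
    moreover have "?f z = z r c" if z: "z \<in> G" for z
    proof -
      have nzj: "minor z [1..<Suc j] (last_columns m j) \<noteq> 0" if "j < ?C" for j
        using nz'[of j z] z that C by simp
      then have "(\<Prod>j<?C. minor z [1..<Suc j] (last_columns m j)) \<noteq> 0" by simp
      moreover have "(\<Prod>j<?C. inverse (minor z [1..<Suc j] (last_columns m j))) =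
          inverse (\<Prod>j<?C. minor z [1..<Suc j] (last_columns m j))"
        using prod_inversef[of "\<lambda>j. minor z [1..<Suc j] (last_columns m j)"]
        by (simp add: comp_def del: upt_Suc)
      moreover have "Determinant.det (Matrix.mat ?C ?C (\<lambda>(i, j). minor z ([1..<Suc j] @ [?I ! i])
            (last_columns m (Suc j)))) =
          minor z ?I (last_columns m ?C) * (\<Prod>j<?C. minor z [1..<Suc j] (last_columns m j))"
        by (rule det_minors_last_columns[OF nzj C(2)])
      ultimately have "?f z = s * minor z ?I (last_columns m ?C)" by (simp del: upt_Suc)
      also have "\<dots> = set_minor z ?I {c..m}" using s by auto
      also have "\<dots> = z r c"
        unfolding set_minor_def sorted_list_of_interval using minor_entry[of m z r c] G[OF z] rc True by simp
      finally show ?thesis .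
    qed
    ultimately show ?thesis by (rule cong_in) 
  qed
  have "finite J" using J finite_subset by blast
  moreover have "card J \<le> m" using card_mono[OF _ J] by simp
  ultimately show ?thesis
    unfolding flag_minor_def set_minor_def using J by (intro minor_in entry) (auto simp del: upt_Suc)
qed

text \<open>
  The corner entry enters an interval minor linearly, with the preceding interval minor as its
  coefficient.
\<close>

lemma minor_interval_step:
  assumes rc: "k < c" and d: "minor z [1..<Suc k] [c - k..<c] \<noteq> 0"
  obtains t where "minor (z(Suc k := (z (Suc k))(c := t))) [1..<Suc (Suc k)] [c - k..<Suc c] = g"
proof -
  let ?R = "[1..<Suc k]" and ?L = "[c - k..<c]"
  have len: "length ?R = k" "length ?L = k" using rc by auto
  obtain \<kappa> where \<kappa>: "\<And>x i. i < k \<Longrightarrow> (\<Sum>j<k. z (?R ! i) (?L ! j) * \<kappa> x j) = z (?R ! i) x"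
    using cramer_exists[OF len d] by blast
  define S where "S = (\<Sum>j<k. z (Suc k) (?L ! j) * \<kappa> c j)"
  define z' where "z' = z(Suc k := (z (Suc k))(c := g / minor z ?R ?L + S))"
  have R: "?R ! i \<noteq> Suc k" if "i < k" for i using that by (simp add: nth_append)
  have L: "?L ! j \<noteq> c" if "j < k" for j using that rc by simp
  have "minor z' (?R @ [Suc k]) (?L @ [c]) =
      minor z' ?R ?L * (z' (Suc k) c - (\<Sum>j<k. z' (Suc k) (?L ! j) * \<kappa> c j))"
    by (rule minor_schur1) (use len \<kappa> R L in \<open>auto simp: z'_def\<close>)
  also have "minor z' ?R ?L = minor z ?R ?L"
    by (rule minor_cong) (use R in \<open>auto simp: z'_def\<close>)
  also have "(\<Sum>j<k. z' (Suc k) (?L ! j) * \<kappa> c j) = S"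
    unfolding S_def by (rule sum.cong) (use L in \<open>auto simp: z'_def\<close>)
  also have "minor z ?R ?L * (z' (Suc k) c - S) = g" using d by (simp add: z'_def)
  finally have "minor z' [1..<Suc (Suc k)] [c - k..<Suc c] = g" using rc by simp
  then show ?thesis using that unfolding z'_def by blast
qed

text \<open>
  The entries are chosen column by column, and from top to bottom in each column; a new entry does not
  affect the minors that have been adjusted before.
\<close>

lemma unitriangular_interval_minors:
  fixes g :: "nat \<Rightarrow> nat \<Rightarrow> real"
  assumes g: "\<And>r c. g r c \<noteq> 0" "\<And>c. g 0 c = 1" "\<And>c. g c c = 1"
  shows "\<exists>z. unitriangular m z \<and>
    (\<forall>c\<le>m. \<forall>r\<le>c. flag_minor z {Suc c - r..c} = g r c)"
proof -
  define P where "P z r c \<longleftrightarrow> minor z [1..<Suc r] [Suc c - r..<Suc c] = g r c" for z r c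
  have P0: "P z 0 c" for z c by (simp add: P_def minor_def g)
  have "\<exists>z. unitriangular m z \<and> (\<forall>c\<le>C. \<forall>r\<le>c. P z r c)" if "C \<le> m" for C
    using that
  proof (induction C)
    case 0
    define z :: "nat \<Rightarrow> nat \<Rightarrow> real" where "z r c = (if r = c then 1 else 0)" for r c
    have "unitriangular m z" by (simp add: unitriangular_def z_def)
    then show ?case using P0 by auto
  next
    case (Suc C)
    have "\<exists>z. unitriangular m z \<and> (\<forall>c\<le>C. \<forall>r\<le>c. P z r c) \<and> (\<forall>r\<le>k. P z r (Suc C))" if "k \<le> Suc C" for k
      using that
    proof (induction k)
      case 0
      then show ?case using Suc P0 by auto
    next
      case (Suc k)
      then obtain z where z: "unitriangular m z" "\<And>c r. c \<le> C \<Longrightarrow> r \<le> c \<Longrightarrow> P z r c"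
        "\<And>r. r \<le> k \<Longrightarrow> P z r (Suc C)" by auto
      show ?case
      proof (cases "k = C")
        case True
        have "P z (Suc C) (Suc C)"
          using flag_minor_principal[OF z(1), of "Suc C"] flag_minor_interval[of "Suc C" "Suc C" z] \<open>Suc C \<le> m\<close>
          by (simp add: P_def g del: upt_Suc)
        then show ?thesis using z True by (intro exI[of _ z]) (auto simp: le_Suc_eq)
      next
        case False
        then have k: "k < C" using Suc.prems by simp
        have "P z k C" using z(2)[of C k] k by simp
        then have "minor z [1..<Suc k] [Suc C - k..<Suc C] \<noteq> 0" by (simp only: P_def g not_False_eq_True)
        then obtain t where t: "minor (z(Suc k := (z (Suc k))(Suc C := t))) [1..<Suc (Suc k)]
            [Suc C - k..<Suc (Suc C)] = g (Suc k) (Suc C)"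
          using minor_interval_step[of k "Suc C" z] k by (metis less_Suc_eq)
        define z' where "z' = z(Suc k := (z (Suc k))(Suc C := t))"
        have "unitriangular m z'" using z(1) k by (auto simp: unitriangular_def z'_def)
        moreover have "P z' r c" if "c \<le> C" "r \<le> c" for r c
        proof -
          have "minor z' [1..<Suc r] [Suc c - r..<Suc c] = minor z [1..<Suc r] [Suc c - r..<Suc c]"
          proof (rule minor_cong)
            fix i j assume ij: "i < length [1..<Suc r]" "j < length [1..<Suc r]"
            then have "[Suc c - r..<Suc c] ! j \<noteq> Suc C" using that by (simp add: nth_upt del: upt_Suc)
            then show "z' ([1..<Suc r] ! i) ([Suc c - r..<Suc c] ! j) =
                z ([1..<Suc r] ! i) ([Suc c - r..<Suc c] ! j)" by (simp add: z'_def)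
          qed
          then show ?thesis using z(2)[OF that] by (simp only: P_def)
        qed
        moreover have "P z' r (Suc C)" if "r \<le> Suc k" for r
        proof (cases "r = Suc k")
          case True
          then show ?thesis using t by (simp add: P_def z'_def del: upt_Suc)
        next
          case False
          have "minor z' [1..<Suc r] [Suc (Suc C) - r..<Suc (Suc C)] =
              minor z [1..<Suc r] [Suc (Suc C) - r..<Suc (Suc C)]"
          proof (rule minor_cong)
            fix i j assume ij: "i < length [1..<Suc r]" "j < length [1..<Suc r]"
            then have "[1..<Suc r] ! i \<noteq> Suc k" using that False by (simp add: nth_upt del: upt_Suc)
            then show "z' ([1..<Suc r] ! i) ([Suc (Suc C) - r..<Suc (Suc C)] ! j) =
                z ([1..<Suc r] ! i) ([Suc (Suc C) - r..<Suc (Suc C)] ! j)" by (simp add: z'_def)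
          qed
          then show ?thesis using z(3)[of r] that False by (simp only: P_def le_Suc_eq) blast
        qed
        ultimately show ?thesis by blast
      qed
    qed
    from this[of "Suc C"] show ?case by (metis le_SucE le_refl)
  qed
  from this[of m] show ?thesis
    by (metis P_def flag_minor_interval le_refl)
qed

section \<open>Decay rates and Laurent polynomials\<close>

text \<open>
  Tropicalization by decay rates: \<open>h x\<close> behaves like \<open>exp (- c x)\<close> to leading exponential order.  Products
  then have the sum of the rates, and sums of positive functions have the minimum.
\<close>

definition has_trop :: "(real \<Rightarrow> real) \<Rightarrow> real \<Rightarrow> bool" where
  "has_trop h c \<longleftrightarrow> (\<forall>x. 0 < h x) \<and> ((\<lambda>x. - ln (h x) / x) \<longlongrightarrow> c) at_top"

lemma has_trop_unique: "has_trop h c \<Longrightarrow> has_trop h d \<Longrightarrow> c = d"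
  unfolding has_trop_def using tendsto_unique[of "at_top :: real filter"] by force

lemma has_trop_exp: "has_trop (\<lambda>x. exp (- (c * x))) c"
proof -
  have "((\<lambda>x. - ln (exp (- (c * x))) / x) \<longlongrightarrow> c) at_top"
  proof (rule tendsto_eventually)
    show "\<forall>\<^sub>F x in at_top. - ln (exp (- (c * x))) / x = c"
      using eventually_gt_at_top[of 0] by eventually_elim simp
  qed
  then show ?thesis by (simp add: has_trop_def)
qed

lemma has_trop_mult: "has_trop g c \<Longrightarrow> has_trop h d \<Longrightarrow> has_trop (\<lambda>x. g x * h x) (c + d)"
  unfolding has_trop_def
proof (elim conjE, intro conjI allI)
  assume g: "\<forall>x. 0 < g x" "((\<lambda>x. - ln (g x) / x) \<longlongrightarrow> c) at_top"
    and h: "\<forall>x. 0 < h x" "((\<lambda>x. - ln (h x) / x) \<longlongrightarrow> d) at_top"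
  show "0 < g x * h x" for x using g h by simp
  have "(\<lambda>x. - ln (g x * h x) / x) = (\<lambda>x. - ln (g x) / x + - ln (h x) / x)"
    using g h by (auto simp: ln_mult_pos diff_divide_distrib)
  then show "((\<lambda>x. - ln (g x * h x) / x) \<longlongrightarrow> c + d) at_top"
    using tendsto_add[OF g(2) h(2)] by simp
qed

lemma has_trop_inverse: "has_trop g c \<Longrightarrow> has_trop (\<lambda>x. inverse (g x)) (- c)"
  unfolding has_trop_def using tendsto_minus by (fastforce simp: ln_inverse)

lemma has_trop_divide: "has_trop g c \<Longrightarrow> has_trop h d \<Longrightarrow> has_trop (\<lambda>x. g x / h x) (c - d)"
  using has_trop_mult[OF _ has_trop_inverse, of g c h d] by (simp add: divide_inverse)

lemma has_trop_add:
  assumes "has_trop g c" "has_trop h d"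
  shows "has_trop (\<lambda>x. g x + h x) (min c d)"
  unfolding has_trop_def
proof (intro conjI allI)
  have g: "\<And>x. 0 < g x" "((\<lambda>x. - ln (g x) / x) \<longlongrightarrow> c) at_top"
    and h: "\<And>x. 0 < h x" "((\<lambda>x. - ln (h x) / x) \<longlongrightarrow> d) at_top"
    using assms by (auto simp: has_trop_def)
  show "0 < g x + h x" for x using g(1)[of x] h(1)[of x] by simp
  have upper: "((\<lambda>x. min (- ln (g x) / x) (- ln (h x) / x)) \<longlongrightarrow> min c d) at_top"
    by (intro tendsto_min g h)
  have "((\<lambda>x. min (- ln (g x) / x) (- ln (h x) / x) - ln 2 / x) \<longlongrightarrow> min c d - 0) at_top"
    by (intro tendsto_diff upper real_tendsto_divide_at_top[OF tendsto_const] filterlim_ident)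
  then have lower: "((\<lambda>x. min (- ln (g x) / x) (- ln (h x) / x) - ln 2 / x) \<longlongrightarrow> min c d) at_top"
    by simp
  show "((\<lambda>x. - ln (g x + h x) / x) \<longlongrightarrow> min c d) at_top"
  proof (rule tendsto_sandwich[OF _ _ lower upper])
    show "\<forall>\<^sub>F x in at_top. min (- ln (g x) / x) (- ln (h x) / x) - ln 2 / x \<le> - ln (g x + h x) / x"
      using eventually_gt_at_top[of 0]
    proof eventually_elim
      case (elim x)
      have "g x + h x \<le> 2 * max (g x) (h x)" by simp
      then have "ln (g x + h x) \<le> ln (2 * max (g x) (h x))"
        using g(1)[of x] h(1)[of x] by simp
      also have "\<dots> = ln 2 + max (ln (g x)) (ln (h x))"
        using g(1)[of x] h(1)[of x] by (simp add: ln_mult_pos max_def)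
      finally have "min (- ln (g x)) (- ln (h x)) - ln 2 \<le> - ln (g x + h x)" by simp
      then have "(min (- ln (g x)) (- ln (h x)) - ln 2) / x \<le> - ln (g x + h x) / x"
        using elim by (intro divide_right_mono) auto
      moreover have "min (- ln (g x)) (- ln (h x)) / x = min (- ln (g x) / x) (- ln (h x) / x)"
        using elim by (simp add: min_def divide_le_cancel)
      ultimately show ?case by (simp add: diff_divide_distrib)
    qed
    show "\<forall>\<^sub>F x in at_top. - ln (g x + h x) / x \<le> min (- ln (g x) / x) (- ln (h x) / x)"
      using eventually_gt_at_top[of 0]
    proof eventually_elim
      case (elim x)
      have "ln (g x) \<le> ln (g x + h x)" "ln (h x) \<le> ln (g x + h x)"
        using g(1)[of x] h(1)[of x] by auto
      then show ?case using elim by (auto intro!: divide_right_mono)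
    qed
  qed
qed

lemma has_trop_asymptotic:
  assumes h: "has_trop h d" and pos: "\<And>x. 0 < f x" and lim: "((\<lambda>x. f x / h x) \<longlongrightarrow> c) at_top" and c: "c \<noteq> 0"
  shows "has_trop f d"
proof -
  have hp: "0 < h x" for x using h by (simp add: has_trop_def)
  have q: "0 < f x / h x" for x using pos hp by simp
  have "0 \<le> c"
    by (rule tendsto_lowerbound[OF lim always_eventually]) (use q in \<open>auto intro: less_imp_le\<close>)
  then have "((\<lambda>x. ln (f x / h x)) \<longlongrightarrow> ln c) at_top" using c by (intro tendsto_ln lim) auto
  then have "((\<lambda>x. - ln (f x / h x) / x) \<longlongrightarrow> 0) at_top"
    by (intro real_tendsto_divide_at_top[OF tendsto_minus] filterlim_ident)
  then have "has_trop (\<lambda>x. f x / h x) 0" using q unfolding has_trop_def by blast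
  moreover have "f x / h x * h x = f x" for x using hp[of x] by simp
  ultimately show ?thesis using has_trop_mult[of "\<lambda>x. f x / h x" 0 h d] h by simp
qed

lemma has_trop_monomial:
  fixes T :: "real \<Rightarrow> real ^ 'k::finite"
  assumes "\<And>j. ((\<lambda>x. T x $ j / x) \<longlongrightarrow> a $ j) at_top"
  shows "has_trop (\<lambda>x. exp (- inner e (T x))) (inner e a)"
proof -
  have "((\<lambda>x. \<Sum>j\<in>UNIV. e $ j * (T x $ j / x)) \<longlongrightarrow> (\<Sum>j\<in>UNIV. e $ j * a $ j)) at_top"
    by (intro tendsto_sum tendsto_mult tendsto_const assms)
  then show ?thesis
    by (simp add: has_trop_def inner_vec_def sum_divide_distrib)
qed

lemma generic_dense:
  fixes a :: "real ^ 'k::finite"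
  assumes S: "finite S"
  shows "a \<in> closure {b. \<forall>e\<in>S. \<forall>e'\<in>S. e \<noteq> e' \<longrightarrow> inner e b \<noteq> inner e' b}"
proof -
  let ?D = "{(e, e') \<in> S \<times> S. e \<noteq> e'}"
  let ?N = "\<Union>(e, e') \<in> ?D. {b. inner (e - e') b = 0}"
  have fin: "finite ?D" by (rule finite_subset[of _ "S \<times> S"]) (use S in auto)
  have "negligible ?N"
    using fin by (intro negligible_Union finite_imageI) (auto intro: negligible_hyperplane)
  then have "negligible (interior ?N)" by (rule negligible_subset) (rule interior_subset)
  then have "interior ?N = {}" using open_not_negligible[OF open_interior] by blast
  then have "closure (- ?N) = UNIV" unfolding closure_complement by (simp only: Compl_empty_eq)
  moreover have "- ?N = {b. \<forall>e\<in>S. \<forall>e'\<in>S. e \<noteq> e' \<longrightarrow> inner e b \<noteq> inner e' b}"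
    by (auto simp: inner_diff_left)
  ultimately show ?thesis by (metis UNIV_I)
qed

definition laurent_sum :: "((real ^ 'k) \<Rightarrow> real) \<Rightarrow> (real ^ 'k) set \<Rightarrow> real ^ 'k \<Rightarrow> real" where
  "laurent_sum c S t = (\<Sum>e\<in>S. c e * exp (- inner e t))"

text \<open>
  At a point \<open>a\<close> where the exponents take distinct values a single term dominates the sum.  As the
  sum is positive, the coefficient of this term is positive, whatever the signs of the others.
\<close>

lemma has_trop_laurent_generic:
  fixes T :: "real \<Rightarrow> real ^ 'k::finite"
  assumes S: "finite S" "S \<noteq> {}" and c: "\<And>e. e \<in> S \<Longrightarrow> c e \<noteq> 0"
    and T: "\<And>j. ((\<lambda>x. T x $ j / x) \<longlongrightarrow> a $ j) at_top"
    and pos: "\<And>x. 0 < laurent_sum c S (T x)"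
    and gen: "\<And>e e'. e \<in> S \<Longrightarrow> e' \<in> S \<Longrightarrow> e \<noteq> e' \<Longrightarrow> inner e a \<noteq> inner e' a"
  shows "has_trop (\<lambda>x. laurent_sum c S (T x)) (min_linear S a)"
proof -
  obtain d where d: "d \<in> S" "min_linear S a = inner d a" using min_linear_attained[OF S] .
  have "((\<lambda>x. exp (- inner e (T x)) / exp (- inner d (T x))) \<longlongrightarrow> (if e = d then 1 else 0)) at_top"
    if e: "e \<in> S" for e
  proof (cases "e = d")
    case False
    have lt: "inner (d - e) a < 0"
      using min_linear_le[OF S(1) e, of a] gen[OF e d(1) False] d(2) by (simp add: inner_diff_left)
    have "((\<lambda>x. \<Sum>j\<in>UNIV. (d - e) $ j * (T x $ j / x)) \<longlongrightarrow> (\<Sum>j\<in>UNIV. (d - e) $ j * a $ j)) at_top"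
      by (intro tendsto_sum tendsto_mult tendsto_const T)
    then have "((\<lambda>x. inner (d - e) (T x) / x) \<longlongrightarrow> inner (d - e) a) at_top"
      by (simp add: inner_vec_def sum_divide_distrib)
    then have "filterlim (\<lambda>x. (inner (d - e) (T x) / x) * x) at_bot at_top"
      by (rule filterlim_tendsto_neg_mult_at_bot[OF _ lt filterlim_ident])
    then have "filterlim (\<lambda>x. inner (d - e) (T x)) at_bot at_top"
    proof (rule iffD1[OF filterlim_cong, OF HOL.refl HOL.refl, rotated])
      show "\<forall>\<^sub>F x in at_top. inner (d - e) (T x) / x * x = inner (d - e) (T x)"
        using eventually_gt_at_top[of 0] by eventually_elim simp
    qed
    then have "((\<lambda>x. exp (inner (d - e) (T x))) \<longlongrightarrow> 0) at_top"
      by (rule filterlim_compose[OF exp_at_bot])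
    moreover have "exp (- inner e t) / exp (- inner d t) = exp (inner (d - e) t)" for t
      by (simp add: exp_diff[symmetric] inner_diff_left)
    ultimately show ?thesis using False by simp
  qed simp
  then have "((\<lambda>x. \<Sum>e\<in>S. c e * (exp (- inner e (T x)) / exp (- inner d (T x)))) \<longlongrightarrow>
      (\<Sum>e\<in>S. c e * (if e = d then 1 else 0))) at_top"
    by (intro tendsto_sum tendsto_mult tendsto_const)
  also have "(\<Sum>e\<in>S. c e * (if e = d then 1 else 0)) = c d"
    using S d by (simp add: if_distrib sum.delta cong: if_cong)
  finally have lim: "((\<lambda>x. laurent_sum c S (T x) / exp (- inner d (T x))) \<longlongrightarrow> c d) at_top"
    by (simp add: laurent_sum_def sum_divide_distrib)
  show ?thesis
    unfolding d(2) by (rule has_trop_asymptotic[OF has_trop_monomial[OF T] pos lim c[OF d(1)]])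
qed

lemma continuous_min_linear:
  fixes S :: "'a::euclidean_space set"
  assumes "finite S" "S \<noteq> {}"
  shows "continuous_on UNIV (min_linear S)"
  using assms
proof (induction S rule: finite_ne_induct)
  case (singleton e)
  then show ?case by (simp add: min_linear_def continuous_intros)
next
  case (insert e S)
  have "min_linear (insert e S) x = min (inner e x) (min_linear S x)" for x
    unfolding min_linear_def using insert by (simp add: Min_insert)
  then show ?case using insert.IH by (simp add: continuous_on_min continuous_intros)
qed

text \<open>
  The formula holds for generic \<open>a\<close>, these are dense, and both sides are continuous.
\<close>

lemma laurent_trop_eq_min_linear:
  fixes \<mu> :: "real ^ 'k::finite \<Rightarrow> real"
  assumes S: "finite S" "S \<noteq> {}" and c: "\<And>e. e \<in> S \<Longrightarrow> c e \<noteq> 0"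
    and \<mu>: "continuous_on UNIV \<mu>"
    and fam: "\<And>a. \<exists>T. (\<forall>j. ((\<lambda>x. T x $ j / x) \<longlongrightarrow> a $ j) at_top) \<and>
        has_trop (\<lambda>x. laurent_sum c S (T x)) (\<mu> a)"
  shows "\<mu> a = min_linear S a"
proof -
  let ?G = "{b. \<forall>e\<in>S. \<forall>e'\<in>S. e \<noteq> e' \<longrightarrow> inner e b \<noteq> inner e' b}"
  have "\<mu> b = min_linear S b" if b: "b \<in> ?G" for b
  proof -
    obtain T where T: "\<And>j. ((\<lambda>x. T x $ j / x) \<longlongrightarrow> b $ j) at_top"
      and h: "has_trop (\<lambda>x. laurent_sum c S (T x)) (\<mu> b)"
      using fam[of b] by blast
    have "has_trop (\<lambda>x. laurent_sum c S (T x)) (min_linear S b)"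
      by (rule has_trop_laurent_generic[OF S c T]) (use b h in \<open>auto simp: has_trop_def\<close>)
    then show ?thesis using h has_trop_unique by blast
  qed
  then have "\<mu> a - min_linear S a = 0"
    by (intro continuous_constant_on_closure[of ?G "\<lambda>b. \<mu> b - min_linear S b" 0 a])
      (use generic_dense[OF S(1)] continuous_min_linear[OF S] \<mu> in
        \<open>auto intro!: continuous_on_diff intro: continuous_on_subset\<close>)
  then show ?thesis by simp
qed

section \<open>The chamber ansatz\<close>

lemma simple_refl_image: "1 \<le> i \<Longrightarrow> r \<noteq> i \<Longrightarrow> simple_refl i ` {1..r} = {1..r}"
proof -
  assume i: "1 \<le> i" "r \<noteq> i"
  have sub: "simple_refl i ` {1..r} \<subseteq> {1..r}" using i by (auto simp: simple_refl_if)
  moreover have "{1..r} \<subseteq> simple_refl i ` {1..r}"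
  proof
    fix x assume "x \<in> {1..r}"
    then have "simple_refl i x \<in> {1..r}" using sub by blast
    then show "x \<in> simple_refl i ` {1..r}" by (metis image_eqI simple_refl_invol)
  qed
  ultimately show ?thesis by blast
qed

text \<open>
  The chamber at height \<open>r\<close> of the wiring diagram, behind the prefix with permutation \<open>u\<close>, is labelled
  by the lines that run below it.
\<close>

definition chamber :: "(nat \<Rightarrow> nat) \<Rightarrow> nat \<Rightarrow> nat set" where
  "chamber u r = u ` {1..r}"

lemma chamber_other: "1 \<le> i \<Longrightarrow> r \<noteq> i \<Longrightarrow> chamber (u \<circ> simple_refl i) r = chamber u r"
  unfolding chamber_def image_comp[symmetric] by (simp add: simple_refl_image del: One_nat_def)

lemma chamber_Suc: "chamber u (Suc r) = insert (u (Suc r)) (chamber u r)"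
  by (simp add: chamber_def atLeastAtMostSuc_conv)

lemma chamber_0 [simp]: "chamber u 0 = {}"
  by (simp add: chamber_def)

lemma chamber_swap:
  "chamber (u \<circ> simple_refl (Suc i)) (Suc i) = insert (u (Suc (Suc i))) (chamber u i)"
  by (subst chamber_Suc, subst chamber_other) auto

lemma chamber_subset:
  assumes "u permutes {1..m}" "r \<le> m"
  shows "chamber u r \<subseteq> {1..m}"
  using permutes_in_image[OF assms(1)] assms(2) by (fastforce simp: chamber_def)

lemma finite_chamber [simp]: "finite (chamber u r)"
  by (simp add: chamber_def)

lemma card_chamber: "inj u \<Longrightarrow> card (chamber u r) = r"
  by (simp add: chamber_def card_image inj_on_subset)

lemma chamber_notin: "inj u \<Longrightarrow> r < a \<Longrightarrow> u a \<notin> chamber u r"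
  by (simp add: chamber_def inj_image_mem_iff)

definition chamber_minor :: "(nat \<Rightarrow> nat \<Rightarrow> real) \<Rightarrow> (nat \<Rightarrow> nat) \<Rightarrow> nat \<Rightarrow> real" where
  "chamber_minor z u r = flag_minor z (chamber u r)"

text \<open>
  The chamber ansatz: the chambers below and above the crossing at height \<open>i\<close> are divided by those to
  its left and to its right.
\<close>

definition crossing :: "(nat \<Rightarrow> nat \<Rightarrow> real) \<Rightarrow> (nat \<Rightarrow> nat) \<Rightarrow> nat \<Rightarrow> real" where
  "crossing z u i = chamber_minor z u (i - 1) * chamber_minor z u (i + 1) /
     (chamber_minor z u i * chamber_minor z (u \<circ> simple_refl i) i)"

definition word_crossing :: "(nat \<Rightarrow> nat \<Rightarrow> real) \<Rightarrow> nat list \<Rightarrow> nat \<Rightarrow> real" where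
  "word_crossing z w p = crossing z (word_perm (take p w)) (w ! p)"

definition positive_chambers :: "nat \<Rightarrow> nat list \<Rightarrow> (nat \<Rightarrow> nat \<Rightarrow> real) \<Rightarrow> bool" where
  "positive_chambers n w z \<longleftrightarrow>
     (\<forall>k \<le> length w. \<forall>r \<le> n + 1. 0 < chamber_minor z (word_perm (take k w)) r)"

lemma chamber_minor_other:
  "1 \<le> i \<Longrightarrow> r \<noteq> i \<Longrightarrow> chamber_minor z (u \<circ> simple_refl i) r = chamber_minor z u r"
  by (simp add: chamber_minor_def chamber_other)

text \<open>
  Crossings at distant heights have no chamber in common that either of them changes.
\<close>

lemma crossing_commute:
  assumes ij: "1 \<le> i" "1 \<le> j" "i \<noteq> j" "\<not> adjacent i j"
  shows "crossing z (u \<circ> simple_refl i) j = crossing z u j"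
    and "chamber_minor z (u \<circ> simple_refl i \<circ> simple_refl j) j = chamber_minor z (u \<circ> simple_refl j) j"
proof -
  have "u \<circ> simple_refl i \<circ> simple_refl j = u \<circ> simple_refl j \<circ> simple_refl i"
    using simple_refl_commute[OF ij(3,4)] by (simp add: comp_assoc)
  then show e: "chamber_minor z (u \<circ> simple_refl i \<circ> simple_refl j) j = chamber_minor z (u \<circ> simple_refl j) j"
    using ij by (simp add: chamber_minor_other)
  have ne: "j - 1 \<noteq> i" "j + 1 \<noteq> i" "j \<noteq> i" using ij by (auto simp: adjacent_def)
  show "crossing z (u \<circ> simple_refl i) j = crossing z u j"
    unfolding crossing_def e chamber_minor_other[OF ij(1) ne(1)] chamber_minor_other[OF ij(1) ne(2)]
      chamber_minor_other[OF ij(1) ne(3)] ..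
qed

text \<open>
  Let \<open>L\<close> be the set of the first \<open>i\<close> values of \<open>u\<close> and \<open>x < y < w\<close> the next three.  All minors that occur are
  flag minors on the union of \<open>L\<close> with a subset of \<open>{x, y, w}\<close>, and the two sides of the braid move differ
  in one of them: the subset \<open>{y}\<close> on the one side, \<open>{x, w}\<close> on the other.  The Pluecker relation
  computes each of these two from the other, which makes the lemma serve both directions of the move.
\<close>

lemma crossing_braid:
  fixes u :: "nat \<Rightarrow> nat"
  assumes u: "inj u" and lt: "u (Suc i) < u (Suc (Suc i))" "u (Suc (Suc i)) < u (Suc (Suc (Suc i)))"
  defines "s \<equiv> simple_refl (Suc i)" and "t \<equiv> simple_refl (Suc (Suc i))"
  assumes pos: "0 < chamber_minor z u i" "0 < chamber_minor z u (Suc i)"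
    "0 < chamber_minor z u (Suc (Suc i))" "0 < chamber_minor z u (Suc (Suc (Suc i)))"
    "0 < chamber_minor z (u \<circ> s \<circ> t) (Suc (Suc i))" "0 < chamber_minor z (u \<circ> t \<circ> s) (Suc i)"
    and pos': "0 < chamber_minor z (u \<circ> s) (Suc i) \<or> 0 < chamber_minor z (u \<circ> t) (Suc (Suc i))"
  shows "0 < chamber_minor z (u \<circ> s) (Suc i)" "0 < chamber_minor z (u \<circ> t) (Suc (Suc i))"
    "crossing z (u \<circ> t) (Suc i) = crossing z u (Suc i) + crossing z (u \<circ> s \<circ> t) (Suc i)"
    "crossing z (u \<circ> s) (Suc (Suc i)) = crossing z u (Suc (Suc i)) + crossing z (u \<circ> t \<circ> s) (Suc (Suc i))"
    "crossing z u (Suc (Suc i)) * crossing z (u \<circ> t) (Suc i) =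
       crossing z (u \<circ> s) (Suc (Suc i)) * crossing z (u \<circ> s \<circ> t) (Suc i)"
    "crossing z (u \<circ> t) (Suc i) * crossing z (u \<circ> t \<circ> s) (Suc (Suc i)) =
       crossing z u (Suc i) * crossing z (u \<circ> s) (Suc (Suc i))"
proof -
  define L where "L = chamber u i"
  define x y w where "x = u (Suc i)" and "y = u (Suc (Suc i))" and "w = u (Suc (Suc (Suc i)))"
  let ?f = "flag_minor z"
  define FL Fx Fy Fw Fxy Fxw Fyw Fxyw where "FL = ?f L" and "Fx = ?f (insert x L)"
    and "Fy = ?f (insert y L)" and "Fw = ?f (insert w L)" and "Fxy = ?f (insert x (insert y L))"
    and "Fxw = ?f (insert x (insert w L))" and "Fyw = ?f (insert y (insert w L))"
    and "Fxyw = ?f (insert x (insert y (insert w L)))"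
  note F_defs = FL_def Fx_def Fy_def Fw_def Fxy_def Fxw_def Fyw_def Fxyw_def
  have ev: "s (Suc i) = Suc (Suc i)" "s (Suc (Suc i)) = Suc i" "s (Suc (Suc (Suc i))) = Suc (Suc (Suc i))"
    "t (Suc i) = Suc i" "t (Suc (Suc i)) = Suc (Suc (Suc i))" "t (Suc (Suc (Suc i))) = Suc (Suc i)"
    by (simp_all add: s_def t_def simple_refl_if)
  have other: "chamber_minor z (v \<circ> s) r = chamber_minor z v r" if "r \<noteq> Suc i" for v r
    unfolding s_def using that by (intro chamber_minor_other) auto
  have other': "chamber_minor z (v \<circ> t) r = chamber_minor z v r" if "r \<noteq> Suc (Suc i)" for v r
    unfolding t_def using that by (intro chamber_minor_other) auto
  have c0: "chamber u i = L" by (simp add: L_def)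
  have swap: "chamber (v \<circ> s) (Suc i) = insert (v (Suc (Suc i))) (chamber v i)" for v
    unfolding s_def by (rule chamber_swap)
  have swap': "chamber (v \<circ> t) (Suc (Suc i)) = insert (v (Suc (Suc (Suc i)))) (chamber v (Suc i))" for v
    unfolding t_def by (rule chamber_swap)
  have ch_s: "chamber (v \<circ> s) i = chamber v i" "chamber (v \<circ> t) i = chamber v i"
    "chamber (v \<circ> t) (Suc i) = chamber v (Suc i)" for v
    unfolding s_def t_def by (simp_all add: chamber_other)
  have m: "chamber_minor z u i = FL" "chamber_minor z u (Suc i) = Fx"
    "chamber_minor z u (Suc (Suc i)) = Fxy" "chamber_minor z u (Suc (Suc (Suc i))) = Fxyw"
    "chamber_minor z (u \<circ> s) (Suc i) = Fy" "chamber_minor z (u \<circ> t) (Suc (Suc i)) = Fxw"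
    "chamber_minor z (u \<circ> s \<circ> t) (Suc (Suc i)) = Fyw"
    "chamber_minor z (u \<circ> s \<circ> t \<circ> s) (Suc i) = Fw"
    "chamber_minor z (u \<circ> t \<circ> s) (Suc i) = Fw"
    "chamber_minor z (u \<circ> t \<circ> s \<circ> t) (Suc (Suc i)) = Fyw"
    unfolding chamber_minor_def F_defs
    by (simp_all add: swap swap' ch_s chamber_Suc c0 ev x_def y_def w_def insert_commute)
  have nin: "x \<notin> L" "y \<notin> L" "w \<notin> L" by (simp_all add: x_def y_def w_def L_def chamber_notin u)
  have pl: "Fy * Fxw = Fxy * Fw + Fyw * Fx"
    unfolding F_defs
    by (rule flag_minor_pluecker) (use nin lt pos m in \<open>auto simp: x_def y_def w_def L_def chamber_minor_def\<close>)
  have P: "0 < FL" "0 < Fx" "0 < Fxy" "0 < Fxyw" "0 < Fyw" "0 < Fw" using pos by (simp_all add: m)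
  then have "0 < Fy * Fxw" unfolding pl by (intro add_pos_pos mult_pos_pos)
  then have Py: "0 < Fy" "0 < Fxw" using pos' by (auto simp: m zero_less_mult_iff)
  then show "0 < chamber_minor z (u \<circ> s) (Suc i)" "0 < chamber_minor z (u \<circ> t) (Suc (Suc i))"
    by (simp_all add: m)
  have cr: "crossing z u (Suc i) = FL * Fxy / (Fx * Fy)"
    "crossing z (u \<circ> s) (Suc (Suc i)) = Fy * Fxyw / (Fxy * Fyw)"
    "crossing z (u \<circ> s \<circ> t) (Suc i) = FL * Fyw / (Fy * Fw)"
    "crossing z u (Suc (Suc i)) = Fx * Fxyw / (Fxy * Fxw)"
    "crossing z (u \<circ> t) (Suc i) = FL * Fxw / (Fx * Fw)"
    "crossing z (u \<circ> t \<circ> s) (Suc (Suc i)) = Fw * Fxyw / (Fxw * Fyw)"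
    unfolding crossing_def s_def[symmetric] t_def[symmetric]
    by (simp_all add: m other other')
  have ne: "FL \<noteq> 0" "Fx \<noteq> 0" "Fy \<noteq> 0" "Fw \<noteq> 0" "Fxy \<noteq> 0" "Fxw \<noteq> 0" "Fyw \<noteq> 0" "Fxyw \<noteq> 0"
    using P Py by auto
  have "FL * Fxy / (Fx * Fy) + FL * Fyw / (Fy * Fw) = FL * (Fxy * Fw + Fyw * Fx) / (Fx * Fy * Fw)"
    using ne by (simp add: field_simps)
  then show "crossing z (u \<circ> t) (Suc i) = crossing z u (Suc i) + crossing z (u \<circ> s \<circ> t) (Suc i)"
    unfolding cr using ne by (simp add: pl[symmetric])
  have "Fx * Fxyw / (Fxy * Fxw) + Fw * Fxyw / (Fxw * Fyw) = Fxyw * (Fxy * Fw + Fyw * Fx) / (Fxy * Fxw * Fyw)"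
    using ne by (simp add: field_simps)
  then show "crossing z (u \<circ> s) (Suc (Suc i)) = crossing z u (Suc (Suc i)) + crossing z (u \<circ> t \<circ> s) (Suc (Suc i))"
    unfolding cr using ne by (simp add: pl[symmetric])
  show "crossing z u (Suc (Suc i)) * crossing z (u \<circ> t) (Suc i) =
       crossing z (u \<circ> s) (Suc (Suc i)) * crossing z (u \<circ> s \<circ> t) (Suc i)"
    unfolding cr using ne by simp
  show "crossing z (u \<circ> t) (Suc i) * crossing z (u \<circ> t \<circ> s) (Suc (Suc i)) =
       crossing z u (Suc i) * crossing z (u \<circ> s) (Suc (Suc i))"
    unfolding cr using ne by simp
qed

lemma word_perm_take_block:
  assumes "word_perm b = word_perm b'" "length b = length b'" "length xs + length b \<le> p"
  shows "word_perm (take p (xs @ b @ ys)) = word_perm (take p (xs @ b' @ ys))"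
  using assms by (simp add: word_perm_append)

lemma word_crossing_outside:
  assumes "word_perm b = word_perm b'" "length b = length b'"
    and "p < length xs \<or> length xs + length b \<le> p"
  shows "word_crossing z (xs @ b @ ys) p = word_crossing z (xs @ b' @ ys) p"
proof -
  have "word_perm (take p (xs @ b @ ys)) = word_perm (take p (xs @ b' @ ys))"
    using assms word_perm_take_block[OF assms(1,2), of xs p ys] by auto
  moreover have "(xs @ b @ ys) ! p = (xs @ b' @ ys) ! p" using assms by (auto simp: nth_append)
  ultimately show ?thesis by (simp add: word_crossing_def)
qed

lemma word_crossing_block:
  assumes "q < length b"
  shows "word_crossing z (xs @ b @ ys) (length xs + q) =
    crossing z (word_perm xs \<circ> word_perm (take q b)) (b ! q)"
  using assms by (simp add: word_crossing_def word_perm_append nth_append)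

lemma ascending_block:
  assumes "ascending_word (xs @ b @ ys)" "q < length b"
  shows "(word_perm xs \<circ> word_perm (take q b)) (b ! q) < (word_perm xs \<circ> word_perm (take q b)) (b ! q + 1)"
proof -
  have "length xs + q < length (xs @ b @ ys)" using assms(2) by simp
  then have "word_perm (take (length xs + q) (xs @ b @ ys)) ((xs @ b @ ys) ! (length xs + q)) <
      word_perm (take (length xs + q) (xs @ b @ ys)) ((xs @ b @ ys) ! (length xs + q) + 1)"
    using assms(1) unfolding ascending_word_def by blast
  then show ?thesis using assms(2) by (simp add: word_perm_append nth_append)
qed

lemma positive_chambers_block:
  assumes "positive_chambers n (xs @ b @ ys) z" "q \<le> length b" "r \<le> n + 1"
  shows "0 < chamber_minor z (word_perm xs \<circ> word_perm (take q b)) r"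
proof -
  have "length xs + q \<le> length (xs @ b @ ys)" using assms(2) by simp
  then have "0 < chamber_minor z (word_perm (take (length xs + q) (xs @ b @ ys))) r"
    using assms(1,3) unfolding positive_chambers_def by blast
  then show ?thesis using assms(2) by (simp add: word_perm_append)
qed

lemma positive_chambers_exchange:
  assumes pos: "positive_chambers n (xs @ b @ ys) z"
    and b: "word_perm b = word_perm b'" "length b = length b'"
    and mid: "\<And>q r. q < length b \<Longrightarrow> r \<le> n + 1 \<Longrightarrow>
      0 < chamber_minor z (word_perm xs \<circ> word_perm (take q b')) r"
  shows "positive_chambers n (xs @ b' @ ys) z"
  unfolding positive_chambers_def
proof (intro allI impI)
  fix k r assume k: "k \<le> length (xs @ b' @ ys)" and r: "r \<le> n + 1"
  have old: "0 < chamber_minor z (word_perm (take k (xs @ b @ ys))) r"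
    using pos k r b(2) unfolding positive_chambers_def by simp
  consider "k \<le> length xs" | q where "q < length b" "k = length xs + q" | "length xs + length b \<le> k"
    by (metis add_less_cancel_left le_Suc_ex linorder_not_le nat_le_linear)
  then show "0 < chamber_minor z (word_perm (take k (xs @ b' @ ys))) r"
  proof cases
    case 1
    then show ?thesis using old by simp
  next
    case 2
    then show ?thesis using mid[OF 2(1) r] b(2) by (simp add: word_perm_append)
  next
    case 3
    then show ?thesis using old word_perm_take_block[OF b 3] by simp
  qed
qed

lemma commute_chambers:
  assumes ij: "1 \<le> i" "1 \<le> j" "i \<noteq> j" "\<not> adjacent i j"
    and pos: "positive_chambers n (xs @ [i, j] @ ys) z"
  shows "positive_chambers n (xs @ [j, i] @ ys) z"
    and "word_crossing z (xs @ [j, i] @ ys) (length xs) = word_crossing z (xs @ [i, j] @ ys) (length xs + 1)"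
    and "word_crossing z (xs @ [j, i] @ ys) (length xs + 1) = word_crossing z (xs @ [i, j] @ ys) (length xs)"
    and "p < length xs \<or> length xs + 2 \<le> p \<Longrightarrow>
      word_crossing z (xs @ [j, i] @ ys) p = word_crossing z (xs @ [i, j] @ ys) p"
proof -
  have ji: "j \<noteq> i" "\<not> adjacent j i" using ij by (auto simp: adjacent_sym)
  have wp: "word_perm [i, j] = word_perm [j, i]"
    using simple_refl_commute[OF ij(3,4)] by (simp add: word_perm_Cons)
  show "positive_chambers n (xs @ [j, i] @ ys) z"
  proof (rule positive_chambers_exchange[OF pos wp])
    fix q r assume q: "q < length [i, j]" and r: "r \<le> n + 1"
    show "0 < chamber_minor z (word_perm xs \<circ> word_perm (take q [j, i])) r"
    proof (cases "q = 0")
      case True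
      then show ?thesis using positive_chambers_block[OF pos, of 0 r] r by simp
    next
      case False
      then have q1: "q = 1" using q by simp
      show ?thesis
      proof (cases "r = j")
        case True
        then show ?thesis
          using positive_chambers_block[OF pos, of 2 r] r crossing_commute(2)[OF ij, of z "word_perm xs"] q1
          by (simp add: word_perm_Cons comp_assoc)
      next
        case False
        then show ?thesis
          using positive_chambers_block[OF pos, of 0 r] r q1 ij
          by (simp add: word_perm_Cons chamber_minor_other)
      qed
    qed
  qed simp
  show "word_crossing z (xs @ [j, i] @ ys) (length xs) = word_crossing z (xs @ [i, j] @ ys) (length xs + 1)"
    using word_crossing_block[of 0 "[j, i]" z xs ys] word_crossing_block[of 1 "[i, j]" z xs ys]
      crossing_commute(1)[OF ij, of z "word_perm xs"] by (simp add: word_perm_Cons)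
  show "word_crossing z (xs @ [j, i] @ ys) (length xs + 1) = word_crossing z (xs @ [i, j] @ ys) (length xs)"
    using word_crossing_block[of 1 "[j, i]" z xs ys] word_crossing_block[of 0 "[i, j]" z xs ys]
      crossing_commute(1)[OF ij(2,1) ji, of z "word_perm xs"] by (simp add: word_perm_Cons)
  show "word_crossing z (xs @ [j, i] @ ys) p = word_crossing z (xs @ [i, j] @ ys) p"
    if "p < length xs \<or> length xs + 2 \<le> p"
    by (rule word_crossing_outside) (use wp that in auto)
qed

text \<open>
  These subtraction-free equations become the braid map when products are replaced by sums and sums by
  minima.
\<close>

lemma braid_chambers:
  assumes adj: "adjacent i j" and ij: "i \<in> {1..n}" "j \<in> {1..n}"
    and xs: "set xs \<subseteq> {1..n}" and asc: "ascending_word (xs @ [i, j, i] @ ys)"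
    and pos: "positive_chambers n (xs @ [i, j, i] @ ys) z"
  defines "a \<equiv> word_crossing z (xs @ [i, j, i] @ ys)" and "b \<equiv> word_crossing z (xs @ [j, i, j] @ ys)"
    and "l \<equiv> length xs"
  shows "positive_chambers n (xs @ [j, i, j] @ ys) z"
    and "b (l + 1) = a l + a (l + 2)"
    and "b l * b (l + 1) = a (l + 1) * a (l + 2)"
    and "b (l + 1) * b (l + 2) = a l * a (l + 1)"
    and "p < l \<or> l + 3 \<le> p \<Longrightarrow> b p = a p"
proof -
  define u where "u = word_perm xs"
  have u: "inj u" unfolding u_def using word_perm_permutes[OF xs] permutes_inj by blast
  have wp: "word_perm [i, j, i] = word_perm [j, i, j]"
    using simple_refl_braid[OF adj] by (simp add: word_perm_Cons)
  have a: "a l = crossing z u i" "a (l + 1) = crossing z (u \<circ> simple_refl i) j"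
    "a (l + 2) = crossing z (u \<circ> simple_refl i \<circ> simple_refl j) i"
    using word_crossing_block[of 0 "[i, j, i]" z xs ys] word_crossing_block[of 1 "[i, j, i]" z xs ys]
      word_crossing_block[of 2 "[i, j, i]" z xs ys]
    by (simp_all add: a_def l_def u_def word_perm_Cons comp_assoc numeral_2_eq_2)
  have b: "b l = crossing z u j" "b (l + 1) = crossing z (u \<circ> simple_refl j) i"
    "b (l + 2) = crossing z (u \<circ> simple_refl j \<circ> simple_refl i) j"
    using word_crossing_block[of 0 "[j, i, j]" z xs ys] word_crossing_block[of 1 "[j, i, j]" z xs ys]
      word_crossing_block[of 2 "[j, i, j]" z xs ys]
    by (simp_all add: b_def l_def u_def word_perm_Cons comp_assoc numeral_2_eq_2)
  have old: "0 < chamber_minor z u r" "0 < chamber_minor z (u \<circ> simple_refl i) r"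
    "0 < chamber_minor z (u \<circ> simple_refl i \<circ> simple_refl j) r"
    "0 < chamber_minor z (u \<circ> simple_refl i \<circ> simple_refl j \<circ> simple_refl i) r" if "r \<le> n + 1" for r
    using positive_chambers_block[OF pos, of 0 r] positive_chambers_block[OF pos, of 1 r]
      positive_chambers_block[OF pos, of 2 r] positive_chambers_block[OF pos, of 3 r] that
    by (simp_all add: u_def word_perm_Cons comp_assoc numeral_2_eq_2 numeral_3_eq_3)
  have up: "u i < u (i + 1)" "(u \<circ> simple_refl i) j < (u \<circ> simple_refl i) (j + 1)"
    "(u \<circ> simple_refl i \<circ> simple_refl j) i < (u \<circ> simple_refl i \<circ> simple_refl j) (i + 1)"
    using ascending_block[OF asc, of 0] ascending_block[OF asc, of 1] ascending_block[OF asc, of 2]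
    by (simp_all add: u_def word_perm_Cons numeral_2_eq_2)
  have other: "chamber_minor z (v \<circ> simple_refl i) r = chamber_minor z v r" if "r \<noteq> i" for v r
    using that ij by (intro chamber_minor_other) auto
  have other': "chamber_minor z (v \<circ> simple_refl j) r = chamber_minor z v r" if "r \<noteq> j" for v r
    using that ij by (intro chamber_minor_other) auto
  have br: "u \<circ> simple_refl i \<circ> simple_refl j \<circ> simple_refl i = u \<circ> simple_refl j \<circ> simple_refl i \<circ> simple_refl j"
    using simple_refl_braid[OF adj] by (simp add: comp_assoc)
  have main: "0 < chamber_minor z (u \<circ> simple_refl j) j \<and>
    0 < chamber_minor z (u \<circ> simple_refl j \<circ> simple_refl i) i \<and>
    b (l + 1) = a l + a (l + 2) \<and> b l * b (l + 1) = a (l + 1) * a (l + 2) \<and>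
    b (l + 1) * b (l + 2) = a l * a (l + 1)"
  proof (cases "j = i + 1")
    case True
    then obtain h where h: "i = Suc h" "j = Suc (Suc h)" using ij by (cases i) auto
    have "0 < chamber_minor z (u \<circ> simple_refl i \<circ> simple_refl j \<circ> simple_refl i) i"
      using old(4)[of i] ij by simp
    then have w: "0 < chamber_minor z (u \<circ> simple_refl j \<circ> simple_refl i) i"
      unfolding br using other'[of i "u \<circ> simple_refl j \<circ> simple_refl i"] h by simp
    have lt: "u (Suc h) < u (Suc (Suc h))" "u (Suc (Suc h)) < u (Suc (Suc (Suc h)))"
      using up h by (simp_all add: simple_refl_if)
    note cb = crossing_braid[OF u lt, of z, folded h]
    show ?thesis unfolding a b
      using cb w old ij h by auto
  next
    case False
    then have "i = j + 1" using adj by (auto simp: adjacent_def)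
    then obtain h where h: "j = Suc h" "i = Suc (Suc h)" using ij by (cases j) auto
    have w: "0 < chamber_minor z (u \<circ> simple_refl i \<circ> simple_refl j) j" using old(3)[of j] ij by simp
    have "0 < chamber_minor z (u \<circ> simple_refl i \<circ> simple_refl j \<circ> simple_refl i) i"
      using old(4)[of i] ij by simp
    then have yw: "0 < chamber_minor z (u \<circ> simple_refl j \<circ> simple_refl i) i"
      unfolding br using other'[of i "u \<circ> simple_refl j \<circ> simple_refl i"] h by simp
    have lt: "u (Suc h) < u (Suc (Suc h))" "u (Suc (Suc h)) < u (Suc (Suc (Suc h)))"
      using up h by (simp_all add: simple_refl_if)
    note cb = crossing_braid[OF u lt, of z, folded h]
    show ?thesis unfolding a b
      using cb w yw old ij h by (auto simp: mult.commute)
  qed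
  then show "b (l + 1) = a l + a (l + 2)" "b l * b (l + 1) = a (l + 1) * a (l + 2)"
    "b (l + 1) * b (l + 2) = a l * a (l + 1)" by blast+
  show "positive_chambers n (xs @ [j, i, j] @ ys) z"
  proof (rule positive_chambers_exchange[OF pos wp])
    fix q r assume q: "q < length [i, j, i]" and r: "r \<le> n + 1"
    have 1: "0 < chamber_minor z (u \<circ> simple_refl j) r"
      using main other'[of r u] old(1)[OF r] by (cases "r = j") auto
    have 2: "0 < chamber_minor z (u \<circ> simple_refl j \<circ> simple_refl i) r"
      using main other[of r "u \<circ> simple_refl j"] 1 by (cases "r = i") auto
    from q consider "q = 0" | "q = 1" | "q = 2" by fastforce
    then show "0 < chamber_minor z (word_perm xs \<circ> word_perm (take q [j, i, j])) r"
      using old(1)[OF r] 1 2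
      by cases (simp_all add: u_def[symmetric] word_perm_Cons comp_assoc numeral_2_eq_2)
  qed simp
  show "b p = a p" if "p < l \<or> l + 3 \<le> p"
    unfolding a_def b_def by (rule word_crossing_outside[symmetric]) (use wp that in \<open>auto simp: l_def\<close>)
qed

section \<open>A reduced word whose chambers are intervals\<close>

text \<open>
  The word \<open>(1) (2 1) (3 2 1) \<dots>\<close>, whose chambers are all intervals.
\<close>

fun standard_word :: "nat \<Rightarrow> nat list" where
  "standard_word 0 = []"
| "standard_word (Suc k) = standard_word k @ rev [1..<Suc (Suc k)]"

text \<open>
  The permutation of the prefix that ends just before the letter \<open>i\<close> of the \<open>k\<close>-th block; this letter
  stands at position \<open>standard_pos k i\<close>.  In one-line notation it reads
  \<open>k, \<dots>, k - i + 1, k + 1, k - i, \<dots>, 1, k + 2, \<dots>\<close>.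
\<close>

definition standard_perm :: "nat \<Rightarrow> nat \<Rightarrow> nat \<Rightarrow> nat" where
  "standard_perm k i a =
     (if a = 0 then 0 else if a \<le> i then k + 1 - a else if a = i + 1 then k + 1
      else if a \<le> k + 1 then k + 2 - a else a)"

definition standard_pos :: "nat \<Rightarrow> nat \<Rightarrow> nat" where
  "standard_pos k i = length (standard_word (k - 1)) + (k - i)"

lemma standard_perm_step:
  assumes "1 \<le> i" "i \<le> k"
  shows "standard_perm k i \<circ> simple_refl i = standard_perm k (i - 1)"
  using assms by (auto simp: fun_eq_iff standard_perm_def simple_refl_if)

lemma standard_perm_next: "standard_perm k 0 = standard_perm (Suc k) (Suc k)"
  by (auto simp: fun_eq_iff standard_perm_def)

lemma rev_upt_Suc: "rev [Suc 0..<Suc k] ! d = k - d" if "d < k"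
  using that by (simp add: rev_nth nth_upt del: upt_Suc)

lemma word_perm_descending:
  assumes "d \<le> k"
  shows "standard_perm k k \<circ> word_perm (take d (rev [1..<Suc k])) = standard_perm k (k - d)"
  using assms
proof (induction d)
  case (Suc d)
  have "take (Suc d) (rev [1..<Suc k]) = take d (rev [1..<Suc k]) @ [k - d]"
    using Suc.prems by (subst take_Suc_conv_app_nth) (simp_all add: rev_upt_Suc del: upt_Suc)
  then have "standard_perm k k \<circ> word_perm (take (Suc d) (rev [1..<Suc k])) =
      standard_perm k (k - d) \<circ> simple_refl (k - d)"
    by (simp only: word_perm_snoc comp_assoc[symmetric] Suc.IH[OF Suc_leD[OF Suc.prems]])
  also have "\<dots> = standard_perm k (k - Suc d)"
    using Suc.prems by (subst standard_perm_step) auto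
  finally show ?case .
qed simp

lemma word_perm_standard: "word_perm (standard_word k) = standard_perm (Suc k) (Suc k)"
proof (induction k)
  case 0
  then show ?case by (auto simp: fun_eq_iff standard_perm_def)
next
  case (Suc k)
  have "word_perm (standard_word (Suc k)) =
      standard_perm (Suc k) (Suc k) \<circ> word_perm (take (Suc k) (rev [1..<Suc (Suc k)]))"
    by (simp only: standard_word.simps word_perm_append Suc.IH take_all length_rev length_upt
        diff_Suc_1 order_refl)
  also have "\<dots> = standard_perm (Suc k) 0" by (subst word_perm_descending) simp_all
  finally show ?case by (simp add: standard_perm_next)
qed

lemma standard_word_prefix:
  assumes "1 \<le> i" "i \<le> k" "k \<le> n"
  shows "standard_pos k i < length (standard_word n)"
    and "standard_word n ! standard_pos k i = i"
    and "word_perm (take (standard_pos k i) (standard_word n)) = standard_perm k i"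
proof -
  have "standard_pos k i < length (standard_word n) \<and> standard_word n ! standard_pos k i = i \<and>
    word_perm (take (standard_pos k i) (standard_word n)) = standard_perm k i"
    using assms(3)
  proof (induction n rule: dec_induct)
    case base
    obtain h where h: "k = Suc h" using assms by (cases k) auto
    define d where "d = k - i"
    have d: "d < k" "k - d = i" using assms by (simp_all add: d_def)
    have sp: "standard_pos k i = length (standard_word h) + d" by (simp add: standard_pos_def h d_def)
    have sw: "standard_word k = standard_word h @ rev [1..<Suc k]" by (simp add: h)
    have "rev [1..<Suc k] ! d = i" using rev_upt_Suc[OF d(1)] d by simp
    moreover have "word_perm (standard_word h @ take d (rev [1..<Suc k])) = standard_perm k i"
      unfolding word_perm_append word_perm_standard h[symmetric] d(2)[symmetric]
      using d(1) by (intro word_perm_descending) simp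
    ultimately show ?case
      unfolding sp sw nth_append_length_plus using d(1) by (simp del: upt_Suc)
  next
    case (step n)
    then show ?case by (simp add: nth_append del: upt_Suc)
  qed
  then show "standard_pos k i < length (standard_word n)"
    and "standard_word n ! standard_pos k i = i"
    and "word_perm (take (standard_pos k i) (standard_word n)) = standard_perm k i" by blast+
qed

lemma standard_pos_cases:
  assumes "p < length (standard_word n)"
  obtains k i where "1 \<le> i" "i \<le> k" "k \<le> n" "p = standard_pos k i"
proof -
  have "\<exists>k i. 1 \<le> i \<and> i \<le> k \<and> k \<le> n \<and> p = standard_pos k i"
    using assms
  proof (induction n)
    case (Suc n)
    show ?case
    proof (cases "p < length (standard_word n)")
      case True
      then show ?thesis using Suc.IH le_SucI by blast
    next
      case False
      define d where "d = p - length (standard_word n)"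
      have d: "p = length (standard_word n) + d" "d < Suc n"
        using False Suc.prems by (auto simp: d_def simp del: upt_Suc)
      then show ?thesis
        by (intro exI[of _ "Suc n"] exI[of _ "Suc n - d"]) (auto simp: standard_pos_def)
    qed
  qed simp
  then show ?thesis using that by blast
qed

lemma standard_perm_ascent:
  assumes "1 \<le> i" "i \<le> k"
  shows "standard_perm k i i < standard_perm k i (i + 1)"
  using assms by (simp add: standard_perm_def)

lemma standard_word_letters: "set (standard_word n) \<subseteq> {1..n}"
  by (induction n) (auto simp del: upt_Suc)

lemma ascending_standard_word: "ascending_word (standard_word n)"
  unfolding ascending_word_def
proof (intro allI impI)
  fix p assume "p < length (standard_word n)"
  then obtain k i where *: "1 \<le> i" "i \<le> k" "k \<le> n" "p = standard_pos k i"
    by (rule standard_pos_cases)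
  show "word_perm (take p (standard_word n)) (standard_word n ! p)
      < word_perm (take p (standard_word n)) (standard_word n ! p + 1)"
    unfolding *(4) standard_word_prefix(2,3)[OF *(1-3)] by (rule standard_perm_ascent[OF *(1,2)])
qed

lemma word_perm_standard_longest: "word_perm (standard_word n) = longest_elt n"
proof
  fix a
  show "word_perm (standard_word n) a = longest_elt n a"
  proof (cases "a \<in> {1..n + 1}")
    case True
    then show ?thesis by (simp add: word_perm_standard longest_elt_apply standard_perm_def)
  next
    case False
    then have "longest_elt n a = a" using longest_elt_permutes by (rule permutes_not_in[rotated])
    then show ?thesis using False by (auto simp: word_perm_standard standard_perm_def)
  qed
qed

lemma chamber_standard:
  assumes "i \<le> k" "r \<le> n + 1" "k \<le> n"
  shows "chamber (standard_perm k i) r =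
    (if r \<le> i then {Suc k - r..k} else if r \<le> k + 1 then {Suc (Suc k) - r..Suc k} else {1..r})"
proof -
  have low: "chamber (standard_perm k i) r = {Suc k - r..k}" if "r \<le> i" for r
    using that assms(1)
  proof (induction r)
    case (Suc r)
    then have "standard_perm k i (Suc r) = k - r" by (simp add: standard_perm_def)
    then show ?case using Suc by (auto simp: chamber_Suc)
  qed simp
  have mid: "chamber (standard_perm k i) r = {Suc (Suc k) - r..Suc k}" if "i < r" "r \<le> k + 1" for r
    using that
  proof (induction r)
    case (Suc r)
    show ?case
    proof (cases "r = i")
      case True
      then have "standard_perm k i (Suc r) = Suc k" by (simp add: standard_perm_def)
      then show ?thesis using low[of r] True assms(1) by (auto simp: chamber_Suc)
    next
      case False
      then have "standard_perm k i (Suc r) = Suc k - r" using Suc.prems by (simp add: standard_perm_def)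
      then show ?thesis using Suc False by (auto simp: chamber_Suc)
    qed
  qed simp
  have high: "chamber (standard_perm k i) r = {1..r}" if "k + 1 \<le> r" for r
    using that
  proof (induction r)
    case (Suc r)
    show ?case
    proof (cases "r = k")
      case True
      then show ?thesis using mid[of "Suc k"] assms(1) by simp
    next
      case False
      then have "standard_perm k i (Suc r) = Suc r" using Suc.prems assms(1) by (simp add: standard_perm_def)
      then show ?thesis using Suc False by (auto simp: chamber_Suc)
    qed
  qed simp
  show ?thesis using low mid high by auto
qed

text \<open>
  The chamber ansatz of the standard word, solved for the chamber to the right of each crossing:
  \<open>interval_value t r c\<close> is the minor on the interval of length \<open>r\<close> that ends at \<open>c\<close>.
\<close>

function interval_value :: "(nat \<Rightarrow> real) \<Rightarrow> nat \<Rightarrow> nat \<Rightarrow> real" where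
  "interval_value t r c =
     (if r = 0 \<or> c \<le> r then 1
      else interval_value t (r - 1) (c - 1) * interval_value t (r + 1) c /
        (interval_value t r (c - 1) * t (standard_pos (c - 1) r)))"
  by pat_completeness auto
termination by (relation "measures [\<lambda>(t, r, c). c, \<lambda>(t, r, c). c - r]") auto

declare interval_value.simps [simp del]

lemma interval_value_pos: "(\<And>p. 0 < t p) \<Longrightarrow> 0 < interval_value t r c"
proof (induction t r c rule: interval_value.induct)
  case (1 t r c)
  show ?case
  proof (cases "r = 0 \<or> c \<le> r")
    case True
    then show ?thesis by (simp add: interval_value.simps[of t r c])
  next
    case False
    then show ?thesis
      using "1.IH"[OF False] "1.prems" by (simp add: interval_value.simps[of t r c])
  qed
qed

lemma standard_realization:
  assumes t: "\<And>p. 0 < t p"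
  shows "\<exists>z. unitriangular (n + 1) z \<and> positive_chambers n (standard_word n) z \<and>
    (\<forall>p < length (standard_word n). word_crossing z (standard_word n) p = t p)"
proof -
  let ?g = "interval_value t"
  have gpos: "0 < ?g r c" for r c by (rule interval_value_pos[OF t])
  have g1: "?g 0 c = 1" "?g c c = 1" for c by (simp_all add: interval_value.simps)
  have "?g r c \<noteq> 0" for r c using gpos[of r c] by simp
  then obtain z where z: "unitriangular (n + 1) z"
    "\<And>c r. c \<le> n + 1 \<Longrightarrow> r \<le> c \<Longrightarrow> flag_minor z {Suc c - r..c} = ?g r c"
    using unitriangular_interval_minors[of ?g "n + 1"] g1 by blast
  have cm: "chamber_minor z (standard_perm k i) r =
      (if r \<le> i then ?g r k else if r \<le> k + 1 then ?g r (Suc k) else 1)"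
    if "i \<le> k" "k \<le> n" "r \<le> n + 1" for k i r
    unfolding chamber_minor_def chamber_standard[OF that(1,3,2)]
    using z(2)[of k r] z(2)[of "Suc k" r] flag_minor_principal[OF z(1), of r] that by auto
  have cm_pos: "0 < chamber_minor z (standard_perm k i) r"
    if "i \<le> k" "k \<le> n" "r \<le> n + 1" for k i r
    unfolding cm[OF that] using gpos by simp
  have "positive_chambers n (standard_word n) z"
    unfolding positive_chambers_def
  proof (intro allI impI)
    fix p r assume p: "p \<le> length (standard_word n)" and r: "r \<le> n + 1"
    show "0 < chamber_minor z (word_perm (take p (standard_word n))) r"
    proof (cases "p = length (standard_word n)")
      case True
      then show ?thesis using cm_pos[of 0 n r] r by (simp add: word_perm_standard standard_perm_next)
    next
      case False
      then have "p < length (standard_word n)" using p by simp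
      then obtain k i where *: "1 \<le> i" "i \<le> k" "k \<le> n" "p = standard_pos k i"
        by (rule standard_pos_cases)
      show ?thesis unfolding *(4) standard_word_prefix(3)[OF *(1-3)] by (rule cm_pos[OF *(2,3) r])
    qed
  qed
  moreover have "word_crossing z (standard_word n) p = t p" if "p < length (standard_word n)" for p
  proof -
    obtain k i where *: "1 \<le> i" "i \<le> k" "k \<le> n" "p = standard_pos k i"
      using standard_pos_cases[OF \<open>p < length (standard_word n)\<close>] .
    have "word_crossing z (standard_word n) p = crossing z (standard_perm k i) i"
      unfolding word_crossing_def *(4) standard_word_prefix(2,3)[OF *(1-3)] ..
    also have "\<dots> = ?g (i - 1) k * ?g (i + 1) (Suc k) / (?g i k * ?g i (Suc k))"
      unfolding crossing_def standard_perm_step[OF *(1,2)]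
    proof -
      have "i - 1 \<le> i" "i - 1 \<le> k" "i - 1 \<le> n + 1" "\<not> i \<le> i - 1" "\<not> i + 1 \<le> i"
        "i + 1 \<le> n + 1" "i \<le> k + 1" "i \<le> n + 1" "i + 1 \<le> k + 1" using * by auto
      then show "chamber_minor z (standard_perm k i) (i - 1) * chamber_minor z (standard_perm k i) (i + 1) /
          (chamber_minor z (standard_perm k i) i * chamber_minor z (standard_perm k (i - 1)) i) =
          ?g (i - 1) k * ?g (i + 1) (Suc k) / (?g i k * ?g i (Suc k))"
        using cm[of i k "i - 1"] cm[of i k "i + 1"] cm[of i k i] cm[of "i - 1" k i] *(2,3)
        by (simp only: if_True if_False le_refl)
    qed
    also have "?g i (Suc k) = ?g (i - 1) k * ?g (i + 1) (Suc k) / (?g i k * t p)"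
      using interval_value.simps[of t i "Suc k"] * by simp
    finally show ?thesis
      using gpos[of "i - 1" k] gpos[of "i + 1" "Suc k"] gpos[of i k] t[of p] by simp
  qed
  ultimately show ?thesis using z(1) by blast
qed

section \<open>Points realized by families of matrices\<close>

lemma pos_eq_iff:
  assumes "p < CARD('k)" "q < CARD('k)"
  shows "(pos p :: 'k::{finite,linorder}) = pos q \<longleftrightarrow> p = q"
  unfolding pos_def using assms by (simp add: nth_eq_iff_index_eq)

lemma pos_surj: "\<exists>p < CARD('k). pos p = (j :: 'k::{finite,linorder})"
proof -
  have "j \<in> set (sorted_list_of_set UNIV)" by simp
  then show ?thesis unfolding in_set_conv_nth by (auto simp: pos_def)
qed

definition index :: "'k::{finite,linorder} \<Rightarrow> nat" where
  "index j = (SOME p. p < CARD('k) \<and> pos p = j)"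

lemma index: "index (j :: 'k::{finite,linorder}) < CARD('k)" "pos (index j) = j"
  using someI_ex[OF pos_surj[of j, unfolded Bex_def]] unfolding index_def by blast+

lemma index_pos: "p < CARD('k) \<Longrightarrow> index (pos p :: 'k::{finite,linorder}) = p"
  using pos_eq_iff[of "index (pos p :: 'k)" p, where 'k = 'k] index[of "pos p :: 'k"] by blast

lemma commute_map_nth:
  fixes a :: "real ^ 'k::{finite,linorder}"
  assumes "p + 1 < CARD('k)" "q < CARD('k)"
  shows "commute_map p a $ pos q = a $ pos (if q = p then p + 1 else if q = p + 1 then p else q)"
  using assms by (auto simp: commute_map_def pos_eq_iff)

lemma braid_map_nth:
  fixes a :: "real ^ 'k::{finite,linorder}"
  assumes "p + 2 < CARD('k)"
  shows "braid_map p a $ pos p = a $ pos (p + 1) + a $ pos (p + 2) - min (a $ pos p) (a $ pos (p + 2))"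
    and "braid_map p a $ pos (p + 1) = min (a $ pos p) (a $ pos (p + 2))"
    and "braid_map p a $ pos (p + 2) = a $ pos p + a $ pos (p + 1) - min (a $ pos p) (a $ pos (p + 2))"
    and "q < CARD('k) \<Longrightarrow> q \<noteq> p \<Longrightarrow> q \<noteq> p + 1 \<Longrightarrow> q \<noteq> p + 2 \<Longrightarrow> braid_map p a $ pos q = a $ pos q"
  using assms by (simp_all add: braid_map_def Let_def pos_eq_iff)

lemma vec_eq_pos:
  fixes a b :: "real ^ 'k::{finite,linorder}"
  assumes "\<And>p. p < CARD('k) \<Longrightarrow> a $ pos p = b $ pos p"
  shows "a = b"
  unfolding Finite_Cartesian_Product.vec_eq_iff
proof
  fix j :: 'k
  obtain p where "p < CARD('k)" "pos p = j" using pos_surj[of j] by blast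
  then show "a $ j = b $ j" using assms by blast
qed

lemma commute_map_involution:
  fixes a :: "real ^ 'k::{finite,linorder}"
  assumes "p + 1 < CARD('k)"
  shows "commute_map p (commute_map p a) = a"
  by (rule vec_eq_pos) (use assms in \<open>auto simp: commute_map_nth\<close>)

lemma braid_map_involution:
  fixes a :: "real ^ 'k::{finite,linorder}"
  assumes p: "p + 2 < CARD('k)"
  shows "braid_map p (braid_map p a) = a"
proof (rule vec_eq_pos)
  fix q assume q: "q < CARD('k)"
  consider "q = p" | "q = p + 1" | "q = p + 2" | "q \<noteq> p" "q \<noteq> p + 1" "q \<noteq> p + 2" by blast
  then show "braid_map p (braid_map p a) $ pos q = a $ pos q"
  proof cases
    case 4
    then show ?thesis by (simp only: braid_map_nth(4)[OF p q 4])
  next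
    case 1
    then show ?thesis unfolding 1 braid_map_nth(1-3)[OF p] by (simp add: min_def)
  next
    case 2
    then show ?thesis unfolding 2 braid_map_nth(1-3)[OF p] by (simp add: min_def)
  next
    case 3
    then show ?thesis unfolding 3 braid_map_nth(1-3)[OF p] by (simp add: min_def)
  qed
qed

lemma continuous_on_If_const:
  "(P \<Longrightarrow> continuous_on A f) \<Longrightarrow> (\<not> P \<Longrightarrow> continuous_on A g) \<Longrightarrow>
    continuous_on A (\<lambda>x. if P then f x else g x)"
  by (cases P) simp_all

lemma continuous_commute_map: "continuous_on UNIV (commute_map p)"
  unfolding commute_map_def
  by (intro continuous_on_vec_lambda continuous_on_If_const continuous_intros)

lemma continuous_braid_map: "continuous_on UNIV (braid_map p)"
  unfolding braid_map_def Let_def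
  by (intro continuous_on_vec_lambda continuous_on_If_const continuous_on_min continuous_intros)

lemma braid_steps_invariants:
  assumes "braid_step\<^sup>*\<^sup>* v w"
  shows "set w = set v" "length w = length v" "word_perm w = word_perm v"
  using assms by (induction rule: rtranclp_induct) (auto simp: braid_step_invariants)

lemma braid_steps_ascending:
  assumes "braid_step\<^sup>*\<^sup>* v w" "set v \<subseteq> {1..n}" "ascending_word v"
  shows "ascending_word w"
  using assms(1)
proof (induction rule: rtranclp_induct)
  case (step w w')
  then show ?case using braid_step_ascending[of w w' n] braid_steps_invariants(1)[of v w] assms(2) by simp
qed (use assms in simp)

lemma braid_moves_homeomorphism:
  fixes f :: "real ^ 'k::{finite,linorder} \<Rightarrow> real ^ 'k::{finite,linorder}"
  assumes "braid_moves v w f" "length v = CARD('k)"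
  shows "\<exists>g. continuous_on UNIV f \<and> continuous_on UNIV g \<and> (\<forall>x. g (f x) = x) \<and> (\<forall>y. f (g y) = y)"
  using assms
proof (induction rule: braid_moves.induct)
  case (refl v)
  show ?case by (intro exI[of _ id]) (simp add: continuous_on_id)
next
  case (commute v xs i j ys f)
  then obtain g where g: "continuous_on UNIV f" "continuous_on UNIV g" "\<And>x. g (f x) = x" "\<And>y. f (g y) = y"
    by blast
  have "length (xs @ [i, j] @ ys) = CARD('k)"
    using braid_steps_invariants(2)[OF braid_moves_imp_braid_steps[OF commute.hyps(1)]] commute.prems by simp
  then have l: "length xs + 1 < CARD('k)" by simp
  have "continuous_on UNIV (commute_map (length xs) \<circ> f)"
    by (intro continuous_on_compose g continuous_on_subset[OF continuous_commute_map]) auto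
  moreover have "continuous_on UNIV (g \<circ> commute_map (length xs))"
    by (intro continuous_on_compose continuous_commute_map continuous_on_subset[OF g(2)]) auto
  ultimately show ?case
    using g commute_map_involution[OF l] by (intro exI[of _ "g \<circ> commute_map (length xs)"]) simp
next
  case (braid v xs i j ys f)
  then obtain g where g: "continuous_on UNIV f" "continuous_on UNIV g" "\<And>x. g (f x) = x" "\<And>y. f (g y) = y"
    by blast
  have "length (xs @ [i, j, i] @ ys) = CARD('k)"
    using braid_steps_invariants(2)[OF braid_moves_imp_braid_steps[OF braid.hyps(1)]] braid.prems by simp
  then have l: "length xs + 2 < CARD('k)" by simp
  have "continuous_on UNIV (braid_map (length xs) \<circ> f)"
    by (intro continuous_on_compose g continuous_on_subset[OF continuous_braid_map]) auto
  moreover have "continuous_on UNIV (g \<circ> braid_map (length xs))"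
    by (intro continuous_on_compose continuous_braid_map continuous_on_subset[OF g(2)]) auto
  ultimately show ?case
    using g braid_map_involution[OF l] by (intro exI[of _ "g \<circ> braid_map (length xs)"]) simp
qed

text \<open>
  The point \<open>a\<close> is the tropicalization, in the chart of \<open>w\<close>, of a one-parameter family of matrices.
\<close>

definition realizes ::
  "nat \<Rightarrow> nat list \<Rightarrow> (real \<Rightarrow> nat \<Rightarrow> nat \<Rightarrow> real) \<Rightarrow> real ^ 'k::{finite,linorder} \<Rightarrow> bool" where
  "realizes n w Z a \<longleftrightarrow>
     (\<forall>x. unitriangular (n + 1) (Z x) \<and> positive_chambers n w (Z x)) \<and>
     (\<forall>p < length w. has_trop (\<lambda>x. word_crossing (Z x) w p) (a $ pos p))"

text \<open>
  One family realizes a point in all charts at once, and the charts are related by the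
  reparametrization functions.
\<close>

lemma realizes_braid_moves:
  fixes f :: "real ^ 'k::{finite,linorder} \<Rightarrow> real ^ 'k::{finite,linorder}"
  assumes "braid_moves v w f" "set v \<subseteq> {1..n}" "ascending_word v" "length v = CARD('k)" "realizes n v Z a"
  shows "realizes n w Z (f a)"
  using assms
proof (induction rule: braid_moves.induct)
  case (refl v)
  then show ?case by simp
next
  case (commute v xs i j ys f)
  let ?w = "xs @ [i, j] @ ys" and ?w' = "xs @ [j, i] @ ys" and ?l = "length xs"
  have steps: "braid_step\<^sup>*\<^sup>* v ?w" by (rule braid_moves_imp_braid_steps[OF commute.hyps(1)])
  have len: "length ?w = CARD('k)" and letters: "set ?w \<subseteq> {1..n}"
    using braid_steps_invariants[OF steps] commute.prems by simp_all
  have ij: "1 \<le> i" "1 \<le> j" using letters by auto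
  have re: "\<And>x. unitriangular (n + 1) (Z x)" "\<And>x. positive_chambers n ?w (Z x)"
    "\<And>p. p < CARD('k) \<Longrightarrow> has_trop (\<lambda>x. word_crossing (Z x) ?w p) (f a $ pos p)"
    using commute.IH commute.prems len unfolding realizes_def by auto
  note cc = commute_chambers[OF ij commute.hyps(2,3) re(2)]
  show ?case
    unfolding realizes_def
  proof (intro conjI allI impI re(1) cc(1))
    fix p assume "p < length ?w'"
    then have p: "p < CARD('k)" using len by simp
    have l: "?l + 1 < CARD('k)" "?l < CARD('k)" using len by simp_all
    consider "p = ?l" | "p = ?l + 1" | "p < ?l \<or> ?l + 2 \<le> p" by linarith
    then show "has_trop (\<lambda>x. word_crossing (Z x) ?w' p) ((commute_map ?l \<circ> f) a $ pos p)"
    proof cases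
      case 1
      show ?thesis unfolding 1 cc(2) comp_apply commute_map_nth[OF l] using re(3)[OF l(1)] by simp
    next
      case 2
      show ?thesis unfolding 2 cc(3) comp_apply commute_map_nth[OF l(1) l(1)] using re(3)[OF l(2)] by simp
    next
      case 3
      show ?thesis unfolding cc(4)[OF 3] comp_apply commute_map_nth[OF l(1) p] using re(3)[OF p] 3 by auto
    qed
  qed
next
  case (braid v xs i j ys f)
  let ?w = "xs @ [i, j, i] @ ys" and ?w' = "xs @ [j, i, j] @ ys" and ?l = "length xs"
  have steps: "braid_step\<^sup>*\<^sup>* v ?w" by (rule braid_moves_imp_braid_steps[OF braid.hyps(1)])
  have len: "length ?w = CARD('k)" and letters: "set ?w \<subseteq> {1..n}"
    using braid_steps_invariants[OF steps] braid.prems by simp_all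
  have asc: "ascending_word ?w" by (rule braid_steps_ascending[OF steps]) (use braid.prems in auto)
  have ij: "i \<in> {1..n}" "j \<in> {1..n}" "set xs \<subseteq> {1..n}" using letters by auto
  have re: "\<And>x. unitriangular (n + 1) (Z x)" "\<And>x. positive_chambers n ?w (Z x)"
    "\<And>p. p < CARD('k) \<Longrightarrow> has_trop (\<lambda>x. word_crossing (Z x) ?w p) (f a $ pos p)"
    using braid.IH braid.prems len unfolding realizes_def by auto
  note bc = braid_chambers[OF braid.hyps(2) ij asc re(2)]
  have l: "?l + 2 < CARD('k)" "?l + 1 < CARD('k)" "?l < CARD('k)" using len by simp_all
  let ?\<mu> = "min (f a $ pos ?l) (f a $ pos (?l + 2))"
  have mid: "has_trop (\<lambda>x. word_crossing (Z x) ?w' (?l + 1)) ?\<mu>"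
    unfolding bc(2) by (rule has_trop_add[OF re(3)[OF l(3)] re(3)[OF l(1)]])
  then have nz: "word_crossing (Z x) ?w' (?l + 1) \<noteq> 0" for x
    unfolding has_trop_def by (metis less_irrefl)
  show ?case
    unfolding realizes_def
  proof (intro conjI allI impI re(1) bc(1))
    fix p assume "p < length ?w'"
    then have p: "p < CARD('k)" using len by simp
    consider "p = ?l" | "p = ?l + 1" | "p = ?l + 2" | "p < ?l \<or> ?l + 3 \<le> p" by linarith
    then show "has_trop (\<lambda>x. word_crossing (Z x) ?w' p) ((braid_map ?l \<circ> f) a $ pos p)"
    proof cases
      case 1
      have "word_crossing (Z x) ?w' ?l = word_crossing (Z x) ?w (?l + 1) * word_crossing (Z x) ?w (?l + 2) /
          word_crossing (Z x) ?w' (?l + 1)" for x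
        using bc(3)[of x] nz[of x] by (simp only: eq_divide_eq not_False_eq_True if_True)
      then show ?thesis
        unfolding 1 comp_apply braid_map_nth(1)[OF l(1)]
        using has_trop_divide[OF has_trop_mult[OF re(3)[OF l(2)] re(3)[OF l(1)]] mid] by simp
    next
      case 2
      show ?thesis unfolding 2 comp_apply braid_map_nth(2)[OF l(1)] by (rule mid)
    next
      case 3
      have "word_crossing (Z x) ?w' (?l + 2) = word_crossing (Z x) ?w ?l * word_crossing (Z x) ?w (?l + 1) /
          word_crossing (Z x) ?w' (?l + 1)" for x
        using bc(4)[of x] nz[of x] by (simp only: eq_divide_eq not_False_eq_True if_True mult.commute)
      then show ?thesis
        unfolding 3 comp_apply braid_map_nth(3)[OF l(1)]
        using has_trop_divide[OF has_trop_mult[OF re(3)[OF l(3)] re(3)[OF l(2)]] mid] by simp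
    next
      case 4
      then have ne: "p \<noteq> ?l" "p \<noteq> ?l + 1" "p \<noteq> ?l + 2" by auto
      show ?thesis unfolding bc(5)[OF 4] comp_apply braid_map_nth(4)[OF l(1) p ne] by (rule re(3)[OF p])
    qed
  qed
qed

abbreviation w0_words :: "nat \<Rightarrow> nat list set" where
  "w0_words n \<equiv> reduced_words n (longest_elt n)"

lemma w0_words_iff:
  "w \<in> w0_words n \<longleftrightarrow> set w \<subseteq> {1..n} \<and> word_perm w = longest_elt n \<and> ascending_word w"
  by (simp add: reduced_words_eq[OF longest_elt_permutes])

lemma w0_words_length: "w \<in> w0_words n \<Longrightarrow> length w = weyl_length n (longest_elt n)"
  by (simp add: reduced_words_def)

lemma w0_words_connected:
  assumes "v \<in> w0_words n" "w \<in> w0_words n"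
  shows "\<exists>f :: real ^ 'k::{finite,linorder} \<Rightarrow> _. braid_moves v w f"
  using assms by (intro braid_steps_imp_braid_moves ascending_words_connected[of v n w]) (auto simp: w0_words_iff)

lemma braid_moves_w0_words:
  "braid_moves v w f \<Longrightarrow> v \<in> w0_words n \<Longrightarrow> w \<in> w0_words n"
  using braid_steps_invariants[OF braid_moves_imp_braid_steps, of v w f]
    braid_steps_ascending[OF braid_moves_imp_braid_steps, of v w f n] by (simp add: w0_words_iff)

text \<open>
  For the standard word the crossing numbers can be prescribed.  The braid maps being invertible, this
  carries over to any other word.
\<close>

lemma realizes_exists:
  fixes a :: "real ^ 'k::{finite,linorder}"
  assumes v: "v \<in> w0_words n" and len: "length v = CARD('k)"
  shows "\<exists>Z. realizes n v Z a"
proof -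
  let ?s = "standard_word n"
  have s: "?s \<in> w0_words n"
    by (simp add: w0_words_iff standard_word_letters word_perm_standard_longest ascending_standard_word
        del: One_nat_def)
  then have slen: "length ?s = CARD('k)" using w0_words_length v len by metis
  obtain h :: "real ^ 'k::{finite,linorder} \<Rightarrow> real ^ 'k::{finite,linorder}" where h: "braid_moves ?s v h"
    using w0_words_connected[OF s v] by blast
  obtain a' where a': "h a' = a" using braid_moves_homeomorphism[OF h slen] by metis
  have "\<exists>z. unitriangular (n + 1) z \<and> positive_chambers n ?s z \<and>
      (\<forall>p < length ?s. word_crossing z ?s p = exp (- (a' $ pos p * x)))" for x
    by (rule standard_realization) simp
  then obtain Z where Z: "\<And>x. unitriangular (n + 1) (Z x)" "\<And>x. positive_chambers n ?s (Z x)"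
    "\<And>x p. p < length ?s \<Longrightarrow> word_crossing (Z x) ?s p = exp (- (a' $ pos p * x))"
    by metis
  have "realizes n ?s Z a'"
    unfolding realizes_def using Z has_trop_exp by (simp add: has_trop_exp)
  from realizes_braid_moves[OF h _ _ slen this] s have "realizes n v Z (h a')" by (simp add: w0_words_iff)
  then show ?thesis using a' by blast
qed

lemma realizes_unique:
  fixes a b :: "real ^ 'k::{finite,linorder}"
  assumes "realizes n w Z a" "realizes n w Z b" "length w = CARD('k)"
  shows "a = b"
  by (rule vec_eq_pos) (use assms has_trop_unique in \<open>auto simp: realizes_def\<close>)

text \<open>
  Lusztig's theorem: the coordinates of a realized point in the chart of \<open>w\<close> are decay rates, and these
  do not depend on a choice of braid moves.
\<close>

lemma braid_moves_unique:
  fixes f g :: "real ^ 'k::{finite,linorder} \<Rightarrow> real ^ 'k::{finite,linorder}"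
  assumes v: "v \<in> w0_words n" and len: "length v = CARD('k)"
    and f: "braid_moves v w f" and g: "braid_moves v w g"
  shows "f = g"
proof
  fix a :: "real ^ 'k::{finite,linorder}"
  obtain Z where Z: "realizes n v Z a" using realizes_exists[OF v len] by blast
  have "realizes n w Z (f a)" "realizes n w Z (g a)"
    using realizes_braid_moves[OF f _ _ len Z] realizes_braid_moves[OF g _ _ len Z] v
    by (simp_all add: w0_words_iff)
  moreover have "length w = CARD('k)"
    using braid_steps_invariants(2)[OF braid_moves_imp_braid_steps[OF f]] len by simp
  ultimately show "f a = g a" by (rule realizes_unique)
qed

lemma reparam_eq:
  fixes f :: "real ^ 'k::{finite,linorder} \<Rightarrow> real ^ 'k::{finite,linorder}"
  assumes "v \<in> w0_words n" "length v = CARD('k)" "braid_moves v w f"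
  shows "reparam v w = f"
  unfolding reparam_def using braid_moves_unique[OF assms(1,2)] assms(3) by (metis someI)

section \<open>Laurent expansion of flag minors\<close>

text \<open>
  Negative logarithms of the crossing numbers, so that Laurent monomials become exponentials of linear
  functions, as in \<open>laurent_sum\<close>.
\<close>

definition crossing_vector :: "nat list \<Rightarrow> (nat \<Rightarrow> nat \<Rightarrow> real) \<Rightarrow> real ^ 'k::{finite,linorder}" where
  "crossing_vector w z = (\<chi> j. - ln (word_crossing z w (index j)))"

definition positive_matrices :: "nat \<Rightarrow> nat list \<Rightarrow> (nat \<Rightarrow> nat \<Rightarrow> real) set" where
  "positive_matrices n w = {z. unitriangular (n + 1) z \<and> positive_chambers n w z}"

lemma word_perm_take_Suc:
  "k < length w \<Longrightarrow> word_perm (take (Suc k) w) = word_perm (take k w) \<circ> simple_refl (w ! k)"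
  by (simp add: take_Suc_conv_app_nth word_perm_snoc)

lemma positive_chambersD:
  "positive_chambers n w z \<Longrightarrow> k \<le> length w \<Longrightarrow> r \<le> n + 1 \<Longrightarrow>
    0 < chamber_minor z (word_perm (take k w)) r"
  by (simp add: positive_chambers_def)

lemma word_crossing_chambers:
  assumes "k < length w"
  shows "word_crossing z w k =
    chamber_minor z (word_perm (take k w)) (w ! k - 1) * chamber_minor z (word_perm (take k w)) (w ! k + 1) /
    (chamber_minor z (word_perm (take k w)) (w ! k) * chamber_minor z (word_perm (take (Suc k) w)) (w ! k))"
  by (simp only: word_crossing_def crossing_def word_perm_take_Suc[OF assms])

lemma word_crossing_pos:
  assumes "positive_chambers n w z" "set w \<subseteq> {1..n}" "k < length w"
  shows "0 < word_crossing z w k"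
proof -
  have "w ! k \<in> {1..n}" using assms(2,3) nth_mem by blast
  then show ?thesis
    unfolding word_crossing_chambers[OF assms(3)]
    by (intro divide_pos_pos mult_pos_pos positive_chambersD[OF assms(1)]) (use assms(3) in auto)
qed

lemma crossing_vector_nth:
  fixes w :: "nat list"
  assumes "p < CARD('k::{finite,linorder})"
  shows "(crossing_vector w z :: real ^ 'k::{finite,linorder}) $ pos p = - ln (word_crossing z w p)"
  using assms by (simp add: crossing_vector_def index_pos)

text \<open>
  Solving the chamber ansatz for the chamber to the right of a crossing expresses it by the crossing number
  and by chambers further to the left.  The leftmost chambers are principal minors, hence equal to \<open>1\<close>.
\<close>

lemma chamber_minor_monomial:
  assumes w: "set w \<subseteq> {1..n}" and len: "length w = CARD('k::{finite,linorder})"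
    and k: "k \<le> length w" and r: "r \<le> n + 1"
  shows "\<exists>e :: real ^ 'k::{finite,linorder}. \<forall>z \<in> positive_matrices n w.
    chamber_minor z (word_perm (take k w)) r = exp (- inner e (crossing_vector w z))"
  using k r
proof (induction k arbitrary: r)
  case 0
  have "chamber_minor z (word_perm (take 0 w)) r = 1" if "z \<in> positive_matrices n w" for z
    using that 0 flag_minor_principal[of "n + 1" z r]
    by (simp add: chamber_minor_def chamber_def positive_matrices_def)
  then show ?case by (intro exI[of _ 0] ballI) (simp only: inner_zero_left minus_zero exp_zero)
next
  case (Suc k)
  define u i where "u = word_perm (take k w)" and "i = w ! k"
  have kl: "k < length w" using Suc.prems by simp
  have i: "i \<in> {1..n}" using w kl nth_mem unfolding i_def by blast
  have u': "word_perm (take (Suc k) w) = u \<circ> simple_refl i"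
    unfolding u_def i_def by (rule word_perm_take_Suc[OF kl])
  note IH = Suc.IH[OF less_imp_le[OF kl], folded u_def]
  show ?case
  proof (cases "r = i")
    case False
    have "1 \<le> i" using i by simp
    show ?thesis unfolding u' chamber_minor_other[OF \<open>1 \<le> i\<close> False] by (rule IH[OF Suc.prems(2)])
  next
    case True
    have b: "i - 1 \<le> n + 1" "i + 1 \<le> n + 1" "i \<le> n + 1" using i by auto
    obtain e1 e2 e3 :: "real ^ 'k::{finite,linorder}" where
      e1: "\<And>z. z \<in> positive_matrices n w \<Longrightarrow> chamber_minor z u (i - 1) = exp (- inner e1 (crossing_vector w z))" and
      e2: "\<And>z. z \<in> positive_matrices n w \<Longrightarrow> chamber_minor z u (i + 1) = exp (- inner e2 (crossing_vector w z))" and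
      e3: "\<And>z. z \<in> positive_matrices n w \<Longrightarrow> chamber_minor z u i = exp (- inner e3 (crossing_vector w z))"
      using IH[OF b(1)] IH[OF b(2)] IH[OF b(3)] by blast
    have "chamber_minor z (u \<circ> simple_refl i) i =
        exp (- inner (e1 + e2 - e3 - axis (pos k) 1) (crossing_vector w z))"
      if z: "z \<in> positive_matrices n w" for z
    proof -
      have pc: "positive_chambers n w z" using z by (simp add: positive_matrices_def)
      define c where "c = word_crossing z w k"
      have c: "0 < c" unfolding c_def by (rule word_crossing_pos[OF pc w kl])
      have new: "0 < chamber_minor z (u \<circ> simple_refl i) i"
        using positive_chambersD[OF pc, of "Suc k" i] kl i unfolding u' by simp
      have "c = chamber_minor z u (i - 1) * chamber_minor z u (i + 1) /
          (chamber_minor z u i * chamber_minor z (u \<circ> simple_refl i) i)"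
        by (simp only: c_def word_crossing_chambers[OF kl] u' u_def[symmetric] i_def[symmetric])
      then have "chamber_minor z (u \<circ> simple_refl i) i =
          chamber_minor z u (i - 1) * chamber_minor z u (i + 1) / (chamber_minor z u i * c)"
        using c new e3[OF z] by (simp add: field_simps)
      moreover have "c = exp (- inner (axis (pos k) 1) (crossing_vector w z :: real ^ 'k::{finite,linorder}))"
        using c kl len by (simp add: inner_axis' crossing_vector_nth c_def)
      moreover have "exp (- inner e1 t) * exp (- inner e2 t) / (exp (- inner e3 t) * exp (- inner a t)) =
          exp (- inner (e1 + e2 - e3 - a) t)" for a t
        by (simp add: inner_diff_left inner_add_left mult_exp_exp exp_diff[symmetric] algebra_simps)
      ultimately show ?thesis by (simp only: e1[OF z] e2[OF z] e3[OF z])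
    qed
    then show ?thesis unfolding u' True by blast
  qed
qed

definition laurent_functions ::
  "nat \<Rightarrow> nat list \<Rightarrow> 'k::{finite,linorder} itself \<Rightarrow> ((nat \<Rightarrow> nat \<Rightarrow> real) \<Rightarrow> real) set" where
  "laurent_functions n v T = {h. \<exists>(S :: (real ^ 'k::{finite,linorder}) set) c. finite S \<and>
     (\<forall>z \<in> positive_matrices n v. h z = laurent_sum c S (crossing_vector v z))}"

lemma laurent_sum_add:
  assumes "finite S" "finite S'"
  shows "laurent_sum c S t + laurent_sum c' S' t =
    laurent_sum (\<lambda>e. (if e \<in> S then c e else 0) + (if e \<in> S' then c' e else 0)) (S \<union> S') t"
proof -
  have "laurent_sum c S t = (\<Sum>e \<in> S \<union> S'. (if e \<in> S then c e else 0) * exp (- inner e t))"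
    unfolding laurent_sum_def using assms by (intro sum.mono_neutral_cong_left) auto
  moreover have "laurent_sum c' S' t = (\<Sum>e \<in> S \<union> S'. (if e \<in> S' then c' e else 0) * exp (- inner e t))"
    unfolding laurent_sum_def using assms by (intro sum.mono_neutral_cong_left) auto
  ultimately show ?thesis by (simp add: laurent_sum_def sum.distrib distrib_right)
qed

lemma laurent_sum_mult:
  assumes "finite S" "finite S'"
  shows "laurent_sum c S t * laurent_sum c' S' t =
    laurent_sum (\<lambda>d. \<Sum>p \<in> {p \<in> S \<times> S'. fst p + snd p = d}. c (fst p) * c' (snd p))
      ((\<lambda>p. fst p + snd p) ` (S \<times> S')) t"
proof -
  have "laurent_sum c S t * laurent_sum c' S' t =
      (\<Sum>p \<in> S \<times> S'. c (fst p) * c' (snd p) * exp (- inner (fst p + snd p) t))"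
    unfolding laurent_sum_def sum_product sum.cartesian_product
    by (rule sum.cong) (auto simp: inner_add_left exp_diff exp_minus exp_add field_simps)
  also have "\<dots> = (\<Sum>d \<in> (\<lambda>p. fst p + snd p) ` (S \<times> S').
      \<Sum>p \<in> {p \<in> S \<times> S'. fst p + snd p = d}. c (fst p) * c' (snd p) * exp (- inner (fst p + snd p) t))"
    using assms by (intro sum.image_gen) simp
  also have "\<dots> = laurent_sum (\<lambda>d. \<Sum>p \<in> {p \<in> S \<times> S'. fst p + snd p = d}. c (fst p) * c' (snd p))
      ((\<lambda>p. fst p + snd p) ` (S \<times> S')) t"
    unfolding laurent_sum_def sum_distrib_right by (intro sum.cong) auto
  finally show ?thesis .
qed

lemma laurent_function_ring:
  "function_ring (positive_matrices n v) (laurent_functions n v TYPE('k::{finite,linorder}))"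
proof
  let ?A = "laurent_functions n v TYPE('k)"
  fix c :: real
  have "\<forall>z \<in> positive_matrices n v. c = laurent_sum (\<lambda>_. c) {0 :: real ^ 'k::{finite,linorder}} (crossing_vector v z)"
    by (simp add: laurent_sum_def)
  then show "(\<lambda>_. c) \<in> ?A" unfolding laurent_functions_def by blast
next
  let ?A = "laurent_functions n v TYPE('k)"
  fix f g assume "f \<in> ?A" "g \<in> ?A"
  then obtain S S' :: "(real ^ 'k::{finite,linorder}) set" and c c' where S: "finite S" "finite S'"
    and f: "\<And>z. z \<in> positive_matrices n v \<Longrightarrow> f z = laurent_sum c S (crossing_vector v z)"
    and g: "\<And>z. z \<in> positive_matrices n v \<Longrightarrow> g z = laurent_sum c' S' (crossing_vector v z)"
    unfolding laurent_functions_def by blast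
  have "finite (S \<union> S')" using S by simp
  moreover have "\<forall>z \<in> positive_matrices n v. f z + g z =
      laurent_sum (\<lambda>e. (if e \<in> S then c e else 0) + (if e \<in> S' then c' e else 0)) (S \<union> S') (crossing_vector v z)"
    using f g laurent_sum_add[OF S] by simp
  ultimately show "(\<lambda>z. f z + g z) \<in> ?A" unfolding laurent_functions_def by blast
  have "finite ((\<lambda>p. fst p + snd p) ` (S \<times> S'))" using S by simp
  moreover have "\<forall>z \<in> positive_matrices n v. f z * g z =
      laurent_sum (\<lambda>d. \<Sum>p \<in> {p \<in> S \<times> S'. fst p + snd p = d}. c (fst p) * c' (snd p))
        ((\<lambda>p. fst p + snd p) ` (S \<times> S')) (crossing_vector v z)"
    using f g laurent_sum_mult[OF S] by simp
  ultimately show "(\<lambda>z. f z * g z) \<in> ?A" unfolding laurent_functions_def by blast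
next
  let ?A = "laurent_functions n v TYPE('k)"
  fix f g assume "f \<in> ?A" "\<And>z. z \<in> positive_matrices n v \<Longrightarrow> f z = g z"
  then show "g \<in> ?A" unfolding laurent_functions_def by simp
qed

text \<open>
  By the Jacobi identity the bordered chamber minors satisfy a recursion along the word, in which only
  chamber minors, that is monomials, are inverted.  It starts at the principal minors of a unitriangular
  matrix and ends at the bordered minors on the last columns, from which the whole matrix, and with it
  every flag minor, is recovered.
\<close>

lemma flag_minor_laurent:
  assumes v: "v \<in> w0_words n" and len: "length v = CARD('k::{finite,linorder})" and J: "J \<subseteq> {1..n + 1}"
  shows "(\<lambda>z. flag_minor z J) \<in> laurent_functions n v TYPE('k)"
proof -
  let ?A = "laurent_functions n v TYPE('k)" and ?G = "positive_matrices n v"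
  interpret function_ring ?G ?A by (rule laurent_function_ring)
  have letters: "set v \<subseteq> {1..n}" and asc: "ascending_word v" and wp: "word_perm v = longest_elt n"
    using v by (simp_all add: w0_words_iff)
  have mono: "(\<lambda>z. chamber_minor z (word_perm (take k v)) r) \<in> ?A"
    and mono': "(\<lambda>z. inverse (chamber_minor z (word_perm (take k v)) r)) \<in> ?A"
    if kr: "k \<le> length v" "r \<le> n + 1" for k r
  proof -
    obtain e :: "real ^ 'k::{finite,linorder}" where e: "\<forall>z \<in> ?G.
        chamber_minor z (word_perm (take k v)) r = exp (- inner e (crossing_vector v z))"
      using chamber_minor_monomial[OF letters len kr] by blast
    have "\<forall>z \<in> ?G. chamber_minor z (word_perm (take k v)) r = laurent_sum (\<lambda>_. 1) {e} (crossing_vector v z)"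
      using e by (simp add: laurent_sum_def)
    then show "(\<lambda>z. chamber_minor z (word_perm (take k v)) r) \<in> ?A"
      unfolding laurent_functions_def by blast
    have "\<forall>z \<in> ?G. inverse (chamber_minor z (word_perm (take k v)) r) =
        laurent_sum (\<lambda>_. 1) {- e} (crossing_vector v z)"
      using e by (simp add: laurent_sum_def exp_minus)
    then show "(\<lambda>z. inverse (chamber_minor z (word_perm (take k v)) r)) \<in> ?A"
      unfolding laurent_functions_def by blast
  qed
  define H where "H k r \<rho> z = set_minor z ([1..<r] @ [\<rho>]) (chamber (word_perm (take k v)) r)" for k r \<rho> z
  have H: "H k r \<rho> \<in> ?A" if "k \<le> length v" "r \<in> {1..n + 1}" "\<rho> \<in> {1..n + 1}" for k r \<rho>
    using that
  proof (induction k arbitrary: r)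
    case 0
    show ?case
    proof (rule cong_in[OF const_in[of "if \<rho> = r then 1 else 0"]])
      fix z assume "z \<in> ?G"
      then show "(if \<rho> = r then 1 else 0) = H 0 r \<rho> z"
        using set_minor_unitriangular[of "n + 1" z r \<rho>] 0
        by (simp add: H_def chamber_def positive_matrices_def)
    qed
  next
    case (Suc k)
    define u i where "u = word_perm (take k v)" and "i = v ! k"
    have kl: "k < length v" "k \<le> length v" using Suc.prems by simp_all
    have i: "i \<in> {1..n}" using letters kl nth_mem unfolding i_def by blast
    have u': "word_perm (take (Suc k) v) = u \<circ> simple_refl i"
      unfolding u_def i_def by (rule word_perm_take_Suc[OF kl(1)])
    show ?case
    proof (cases "r = i")
      case False
      then have "H (Suc k) r \<rho> = H k r \<rho>"
        unfolding H_def u' u_def[symmetric] using i by (simp add: chamber_other)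
      then show ?thesis using Suc.IH[of r] Suc.prems by simp
    next
      case True
      obtain h where h: "i = Suc h" using i by (cases i) auto
      have "inj u"
        unfolding u_def using letters set_take_subset[of k v]
        by (intro permutes_inj[OF word_perm_permutes[of _ n]]) blast
      note u = this
      \<comment> \<open>The letter \<open>i\<close> replaces \<open>x\<close> by \<open>y\<close> in the chamber at height \<open>i\<close>.\<close>
      define L x y where "L = chamber u h" and "x = u i" and "y = u (Suc i)"
      have xy: "x < y" using asc kl(1) unfolding ascending_word_def x_def y_def u_def i_def by simp
      have L: "finite L" "card L = h" "x \<notin> L" "y \<notin> L"
        unfolding L_def x_def y_def h by (simp_all add: card_chamber[OF u] chamber_notin[OF u])
      have sets: "chamber u i = insert x L" "chamber u (Suc i) = insert x (insert y L)"
        "chamber (u \<circ> simple_refl i) i = insert y L"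
        unfolding h L_def x_def y_def chamber_swap by (simp_all add: chamber_Suc insert_commute)
      have row: "[1..<Suc i] = [1..<i] @ [i]" "[1..<Suc h] = [1..<i]" "length [1..<i] = h"
        using h by simp_all
      have "(\<lambda>z. inverse (chamber_minor z u i) * (H k i \<rho> z * chamber_minor z (u \<circ> simple_refl i) i +
          H k (Suc i) \<rho> z * chamber_minor z u h)) \<in> ?A"
        using Suc.IH[OF kl(2), of i] Suc.IH[OF kl(2), of "Suc i"] Suc.prems(3) i h
          mono[of k h] mono[of "Suc k" i] mono'[of k i] kl
        unfolding u' u_def[symmetric] by (intro mult_in add_in) auto
      then show ?thesis
      proof (rule cong_in)
        fix z assume z: "z \<in> ?G"
        then have pc: "positive_chambers n v z" by (simp add: positive_matrices_def)
        have pos: "0 < chamber_minor z u i" "0 < chamber_minor z u h"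
          using positive_chambersD[OF pc kl(2), of i] positive_chambersD[OF pc kl(2), of h] i h
          unfolding u_def by simp_all
        have cm: "chamber_minor z u i = set_minor z ([1..<i] @ [i]) (insert x L)"
          "chamber_minor z (u \<circ> simple_refl i) i = set_minor z ([1..<i] @ [i]) (insert y L)"
          "chamber_minor z u h = set_minor z [1..<i] L"
          unfolding chamber_minor_def flag_minor_def sets L_def[symmetric]
          using L row h by (simp_all del: upt_Suc)
        have "set_minor z ([1..<i] @ [i]) (insert x L) * set_minor z ([1..<i] @ [\<rho>]) (insert y L) -
          set_minor z ([1..<i] @ [\<rho>]) (insert x L) * set_minor z ([1..<i] @ [i]) (insert y L) =
          set_minor z ([1..<i] @ [i, \<rho>]) (insert x (insert y L)) * set_minor z [1..<i] L"
          using L xy row(3) pos(2) by (intro set_minor_jacobi) (auto simp: cm(3))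
        moreover have "H k i \<rho> z = set_minor z ([1..<i] @ [\<rho>]) (insert x L)"
          unfolding H_def u_def[symmetric] sets ..
        moreover have "H k (Suc i) \<rho> z = set_minor z ([1..<i] @ [i, \<rho>]) (insert x (insert y L))"
          unfolding H_def u_def[symmetric] sets row(1) by simp
        moreover have "H (Suc k) r \<rho> z = set_minor z ([1..<i] @ [\<rho>]) (insert y L)"
          unfolding H_def u' True sets ..
        ultimately have "chamber_minor z u i * H (Suc k) r \<rho> z =
            H k i \<rho> z * chamber_minor z (u \<circ> simple_refl i) i + H k (Suc i) \<rho> z * chamber_minor z u h"
          unfolding cm by simp
        then show "inverse (chamber_minor z u i) * (H k i \<rho> z * chamber_minor z (u \<circ> simple_refl i) i +
          H k (Suc i) \<rho> z * chamber_minor z u h) = H (Suc k) r \<rho> z"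
          using pos(1) by (simp add: field_simps)
      qed
    qed
  qed
  have last: "chamber (word_perm (take (length v) v)) r = {Suc (n + 1) - r..n + 1}" if "r \<le> n + 1" for r
    using longest_elt_image[OF that] by (simp add: chamber_def wp)
  show ?thesis
  proof (rule function_ring_flag_minor[OF laurent_function_ring _ _ _ _ J])
    show "unitriangular (n + 1) z" if "z \<in> ?G" for z using that by (simp add: positive_matrices_def)
    show "flag_minor z {Suc (n + 1) - j..n + 1} \<noteq> 0" if "z \<in> ?G" "j < n + 1" for z j
      using positive_chambersD[of n v z "length v" j] that last[of j]
      by (simp add: positive_matrices_def chamber_minor_def)
    show "(\<lambda>z. inverse (flag_minor z {Suc (n + 1) - j..n + 1})) \<in> ?A" if "j < n + 1" for j
      using mono'[of "length v" j] that last[of j] by (simp add: chamber_minor_def)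
    show "(\<lambda>z. set_minor z ([1..<Suc j] @ [\<rho>]) {n + 1 - j..n + 1}) \<in> ?A"
      if "j < n + 1" "\<rho> \<in> {1..n + 1}" for j \<rho>
    proof -
      have "H (length v) (Suc j) \<rho> = (\<lambda>z. set_minor z ([1..<Suc j] @ [\<rho>]) {n + 1 - j..n + 1})"
        unfolding H_def last[OF Suc_leI[OF that(1)]] by simp
      then show ?thesis using H[of "length v" "Suc j" \<rho>] that by simp
    qed
  qed
qed

section \<open>The linearity domains form a fan\<close>

lemma w0_words_nth:
  assumes "w \<in> w0_words n" "p < length w"
  shows "w ! p \<in> {1..n}"
  using assms nth_mem[OF assms(2)] unfolding w0_words_iff by blast

lemma crossing_vector_limit:
  fixes a :: "real ^ 'k::{finite,linorder}"
  assumes "realizes n w Z a" "length w = CARD('k)"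
  shows "((\<lambda>x. (crossing_vector w (Z x) :: real ^ 'k::{finite,linorder}) $ j / x) \<longlongrightarrow> a $ j) at_top"
proof -
  have "has_trop (\<lambda>x. word_crossing (Z x) w (index j)) (a $ pos (index j))"
    using assms index(1)[of j] unfolding realizes_def by simp
  then show ?thesis by (simp add: has_trop_def crossing_vector_def index(2))
qed

text \<open>
  The decay rate of a chamber minor of \<open>w\<close> is a linear function of \<open>f a\<close>, because the minor is a monomial
  in the crossing numbers of \<open>w\<close>.  It is also a minimum of linear functions of \<open>a\<close>, because the minor is
  a Laurent polynomial in the crossing numbers of \<open>v\<close>.
\<close>

lemma chamber_minor_concave:
  fixes f :: "real ^ 'k::{finite,linorder} \<Rightarrow> real ^ 'k::{finite,linorder}"
  assumes v: "v \<in> w0_words n" and len: "length v = CARD('k)" and f: "braid_moves v w f"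
    and k: "k \<le> length w" and r: "r \<le> n + 1"
  shows "\<exists>S e. finite S \<and> S \<noteq> {} \<and> (\<forall>a. inner e (f a) = min_linear S a) \<and>
    (\<forall>a Z. realizes n v Z a \<longrightarrow> has_trop (\<lambda>x. chamber_minor (Z x) (word_perm (take k w)) r) (min_linear S a))"
proof -
  have w: "w \<in> w0_words n" by (rule braid_moves_w0_words[OF f v])
  have lw: "length w = CARD('k)" using w0_words_length[OF w] w0_words_length[OF v] len by simp
  have letters: "set w \<subseteq> {1..n}" using w by (simp add: w0_words_iff)
  define u where "u = word_perm (take k w)"
  have u: "u permutes {1..n + 1}"
    unfolding u_def using letters set_take_subset[of k w] by (intro word_perm_permutes) blast
  obtain e :: "real ^ 'k::{finite,linorder}" where
    e: "\<And>z. z \<in> positive_matrices n w \<Longrightarrow> chamber_minor z u r = exp (- inner e (crossing_vector w z))"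
    using chamber_minor_monomial[OF letters lw k r] unfolding u_def by blast
  have trop: "has_trop (\<lambda>x. chamber_minor (Z x) u r) (inner e (f a))" if Z: "realizes n v Z a" for Z a
  proof -
    have Zw: "realizes n w Z (f a)"
      using realizes_braid_moves[OF f _ _ len Z] v by (simp add: w0_words_iff)
    then have "Z x \<in> positive_matrices n w" for x by (simp add: realizes_def positive_matrices_def)
    then have "(\<lambda>x. chamber_minor (Z x) u r) = (\<lambda>x. exp (- inner e (crossing_vector w (Z x))))"
      using e by blast
    then show ?thesis using has_trop_monomial[OF crossing_vector_limit[OF Zw lw], of e] by simp
  qed
  obtain S :: "(real ^ 'k::{finite,linorder}) set" and c where S: "finite S" and
    lau: "\<And>z. z \<in> positive_matrices n v \<Longrightarrow> chamber_minor z u r = laurent_sum c S (crossing_vector v z)"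
    using flag_minor_laurent[OF v len chamber_subset[OF u r]]
    unfolding laurent_functions_def chamber_minor_def by blast
  \<comment> \<open>Terms with coefficient zero are removed, since they must not take part in the minimum.\<close>
  define S' where "S' = {e \<in> S. c e \<noteq> 0}"
  have S': "finite S'" using S by (simp add: S'_def)
  have eq: "laurent_sum c S t = laurent_sum c S' t" for t
    unfolding laurent_sum_def using S by (intro sum.mono_neutral_right) (auto simp: S'_def)
  have fam: "has_trop (\<lambda>x. laurent_sum c S' (crossing_vector v (Z x))) (inner e (f a))"
    if Z: "realizes n v Z a" for Z a
  proof -
    have "Z x \<in> positive_matrices n v" for x using Z by (simp add: realizes_def positive_matrices_def)
    then have "(\<lambda>x. chamber_minor (Z x) u r) = (\<lambda>x. laurent_sum c S' (crossing_vector v (Z x)))"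
      using lau eq by simp
    then show ?thesis using trop[OF Z] by simp
  qed
  have ne: "S' \<noteq> {}"
  proof
    assume "S' = {}"
    moreover obtain Z where "realizes n v Z (0 :: real ^ 'k::{finite,linorder})"
      using realizes_exists[OF v len] by blast
    ultimately show False using fam[of Z 0] by (simp add: has_trop_def laurent_sum_def)
  qed
  obtain g where g: "continuous_on UNIV f" using braid_moves_homeomorphism[OF f len] by blast
  have min: "inner e (f a) = min_linear S' a" for a
  proof (rule laurent_trop_eq_min_linear[OF S' ne])
    show "continuous_on UNIV (\<lambda>a. inner e (f a))" by (intro continuous_intros g)
    show "\<exists>T. (\<forall>j. ((\<lambda>x. T x $ j / x) \<longlongrightarrow> a $ j) at_top) \<and>
        has_trop (\<lambda>x. laurent_sum c S' (T x)) (inner e (f a))" for a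
    proof -
      obtain Z where Z: "realizes n v Z a" using realizes_exists[OF v len] by blast
      show ?thesis using fam[OF Z] crossing_vector_limit[OF Z len]
        by (intro exI[of _ "\<lambda>x. crossing_vector v (Z x)"]) blast
    qed
  qed (simp add: S'_def)
  show ?thesis using S' ne min trop unfolding u_def by metis
qed

lemma crossing_coordinate:
  fixes f :: "real ^ 'k::{finite,linorder} \<Rightarrow> real ^ 'k::{finite,linorder}"
  assumes v: "v \<in> w0_words n" and len: "length v = CARD('k)" and f: "braid_moves v w f"
    and M: "\<And>k r Z. k \<le> length w \<Longrightarrow> r \<le> n + 1 \<Longrightarrow> realizes n v Z a \<Longrightarrow>
      has_trop (\<lambda>x. chamber_minor (Z x) (word_perm (take k w)) r) (M k r)"
    and p: "p < CARD('k)"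
  shows "f a $ pos p = M p (w ! p - 1) + M p (w ! p + 1) - (M p (w ! p) + M (Suc p) (w ! p))"
proof -
  have w: "w \<in> w0_words n" by (rule braid_moves_w0_words[OF f v])
  have lw: "length w = CARD('k)" using w0_words_length[OF w] w0_words_length[OF v] len by simp
  have i: "w ! p \<in> {1..n}" using w0_words_nth[OF w] p lw by simp
  obtain Z where Z: "realizes n v Z a" using realizes_exists[OF v len] by blast
  have Zw: "realizes n w Z (f a)"
    using realizes_braid_moves[OF f _ _ len Z] v by (simp add: w0_words_iff)
  then have "has_trop (\<lambda>x. word_crossing (Z x) w p) (f a $ pos p)" using p lw by (simp add: realizes_def)
  moreover have "has_trop (\<lambda>x. word_crossing (Z x) w p)
      (M p (w ! p - 1) + M p (w ! p + 1) - (M p (w ! p) + M (Suc p) (w ! p)))"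
    unfolding word_crossing_chambers[OF p[folded lw]]
    using i p lw by (intro has_trop_divide has_trop_mult M Z) auto
  ultimately show ?thesis by (rule has_trop_unique)
qed

lemma locally_linear_at_plus:
  "locally_linear_at f m \<Longrightarrow> locally_linear_at g m \<Longrightarrow> locally_linear_at (\<lambda>x. f x + g x) m"
proof -
  assume "locally_linear_at f m" "locally_linear_at g m"
  then obtain d e where "\<forall>\<^sub>F x in nhds m. f x = inner d x" "\<forall>\<^sub>F x in nhds m. g x = inner e x"
    by (auto simp: locally_linear_at_def)
  then have "\<forall>\<^sub>F x in nhds m. f x + g x = inner (d + e) x"
    by eventually_elim (simp add: inner_add_left)
  then show ?thesis by (auto simp: locally_linear_at_def)
qed

lemma locally_linear_at_uminus: "locally_linear_at f m \<Longrightarrow> locally_linear_at (\<lambda>x. - f x) m"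
proof -
  assume "locally_linear_at f m"
  then obtain d where "\<forall>\<^sub>F x in nhds m. f x = inner d x" by (auto simp: locally_linear_at_def)
  then have "\<forall>\<^sub>F x in nhds m. - f x = inner (- d) x" by eventually_elim simp
  then show ?thesis unfolding locally_linear_at_def by (rule exI)
qed

lemma locally_linear_at_diff:
  "locally_linear_at f m \<Longrightarrow> locally_linear_at g m \<Longrightarrow> locally_linear_at (\<lambda>x. f x - g x) m"
  using locally_linear_at_plus[OF _ locally_linear_at_uminus, of f m g] by simp

lemma locally_linear_at_sum:
  "finite I \<Longrightarrow> (\<And>i. i \<in> I \<Longrightarrow> locally_linear_at (f i) m) \<Longrightarrow> locally_linear_at (\<lambda>x. \<Sum>i\<in>I. f i x) m"
proof (induction I rule: finite_induct)
  case empty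
  have "\<forall>\<^sub>F x in nhds m. (0 :: real) = inner 0 x" by simp
  then show ?case unfolding locally_linear_at_def sum.empty by (rule exI)
next
  case (insert i I)
  then show ?case by (simp add: locally_linear_at_plus)
qed

lemma locally_linear_at_cong:
  "locally_linear_at f m \<Longrightarrow> (\<And>x. f x = g x) \<Longrightarrow> locally_linear_at g m"
  by (simp add: locally_linear_at_def)

lemma eventually_less_linear:
  fixes A B :: "'a::euclidean_space \<Rightarrow> real"
  assumes "linear A" "linear B" "A m < B m"
  shows "\<forall>\<^sub>F x in nhds m. A x < B x"
proof -
  have "open {x. A x < B x}"
    using assms(1,2) by (intro open_Collect_less linear_continuous_on) (simp_all add: linear_conv_bounded_linear)
  from eventually_nhds_in_open[OF this, of m] show ?thesis using assms(3) by simp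
qed

text \<open>
  The linear map with which the braid map agrees where its minimum is the coordinate \<open>q\<close>.
\<close>

definition braid_branch ::
  "'k \<Rightarrow> nat \<Rightarrow> real ^ 'k::{finite,linorder} \<Rightarrow> real ^ 'k::{finite,linorder}" where
  "braid_branch q p a =
     (\<chi> j. if j = pos p then a $ pos (p + 1) + a $ pos (p + 2) - a $ q
          else if j = pos (p + 1) then a $ q
          else if j = pos (p + 2) then a $ pos p + a $ pos (p + 1) - a $ q
          else a $ j)"

lemma linear_braid_branch: "linear (braid_branch q p)"
  by (rule linearI) (auto simp: braid_branch_def Finite_Cartesian_Product.vec_eq_iff algebra_simps)

lemma linear_commute_map: "linear (commute_map p)"
  by (rule linearI) (auto simp: commute_map_def Finite_Cartesian_Product.vec_eq_iff)

lemma braid_moves_locally_linear: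
  fixes f :: "real ^ 'k::{finite,linorder} \<Rightarrow> real ^ 'k::{finite,linorder}"
  assumes "braid_moves v w f"
    and "\<And>w f. braid_moves v w f \<Longrightarrow> \<forall>H \<in> pbw_walls w. f m \<notin> H"
  shows "\<exists>A. linear A \<and> (\<forall>\<^sub>F x in nhds m. f x = A x)"
  using assms
proof (induction rule: braid_moves.induct)
  case (refl v)
  show ?case by (intro exI[of _ "\<lambda>x. x"]) (simp add: linear_iff)
next
  case (commute v xs i j ys f)
  then obtain A where A: "linear A" "\<forall>\<^sub>F x in nhds m. f x = A x" by blast
  have "\<forall>\<^sub>F x in nhds m. (commute_map (length xs) \<circ> f) x = (commute_map (length xs) \<circ> A) x"
    using A(2) by eventually_elim simp
  then show ?case using linear_compose[OF A(1) linear_commute_map] by blast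
next
  case (braid v xs i j ys f)
  let ?l = "length xs" and ?w = "xs @ [i, j, i] @ ys"
  obtain A where A: "linear A" "\<forall>\<^sub>F x in nhds m. f x = A x" using braid.IH braid.prems by blast
  have Am: "f m = A m" using eventually_nhds_x_imp_x[OF A(2)] .
  have "?l + 2 < length ?w \<and> ?w ! ?l = ?w ! (?l + 2) \<and> adjacent (?w ! ?l) (?w ! (?l + 1))"
    using braid.hyps(2) by (simp add: nth_append)
  then have "{a :: real ^ 'k::{finite,linorder}. a $ pos ?l = a $ pos (?l + 2)} \<in> pbw_walls ?w"
    unfolding pbw_walls_def by blast
  then have ne: "A m $ pos ?l \<noteq> A m $ pos (?l + 2)" using braid.prems[OF braid.hyps(1)] Am by auto
  have coord: "linear (\<lambda>x. A x $ j)" for j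
    using A(1) by (intro linear_compose[of A "\<lambda>y. y $ j", unfolded comp_def]) (auto intro: linearI)
  have "\<exists>q. \<forall>\<^sub>F x in nhds m. min (A x $ pos ?l) (A x $ pos (?l + 2)) = A x $ q"
  proof (cases "A m $ pos ?l < A m $ pos (?l + 2)")
    case True
    from eventually_less_linear[OF coord coord this]
    have "\<forall>\<^sub>F x in nhds m. min (A x $ pos ?l) (A x $ pos (?l + 2)) = A x $ pos ?l"
      by eventually_elim simp
    then show ?thesis by blast
  next
    case False
    then have "A m $ pos (?l + 2) < A m $ pos ?l" using ne by simp
    from eventually_less_linear[OF coord coord this]
    have "\<forall>\<^sub>F x in nhds m. min (A x $ pos ?l) (A x $ pos (?l + 2)) = A x $ pos (?l + 2)"
      by eventually_elim simp
    then show ?thesis by blast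
  qed
  then obtain q where q: "\<forall>\<^sub>F x in nhds m. min (A x $ pos ?l) (A x $ pos (?l + 2)) = A x $ q" by blast
  have "\<forall>\<^sub>F x in nhds m. (braid_map ?l \<circ> f) x = (braid_branch q ?l \<circ> A) x"
    using q A(2)
  proof eventually_elim
    case (elim x)
    then show ?case by (simp only: comp_apply elim(2) braid_map_def braid_branch_def Let_def elim(1))
  qed
  then show ?case using linear_compose[OF A(1) linear_braid_branch] by blast
qed

text \<open>
  On the wall, the minimum touches both of its arguments, so if all three are linear they coincide near
  \<open>m\<close>.  Then \<open>f\<close> would map a neighbourhood of \<open>m\<close> into a hyperplane, but \<open>f\<close> is a homeomorphism.
\<close>

lemma locally_linear_imp_off_wall:
  fixes f :: "real ^ 'k::{finite,linorder} \<Rightarrow> real ^ 'k::{finite,linorder}"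
  assumes f: "braid_moves v w f" and len: "length v = CARD('k)" and p: "p + 2 < CARD('k)"
    and lin: "\<And>q. q < CARD('k) \<Longrightarrow> locally_linear_at (\<lambda>x. f x $ pos q) m"
    and lin': "locally_linear_at (\<lambda>x. min (f x $ pos p) (f x $ pos (p + 2))) m"
  shows "f m $ pos p \<noteq> f m $ pos (p + 2)"
proof
  assume wall: "f m $ pos p = f m $ pos (p + 2)"
  obtain g where g: "continuous_on UNIV g" "\<And>y. f (g y) = y" "\<And>x. g (f x) = x"
    using braid_moves_homeomorphism[OF f len] by blast
  obtain \<alpha> \<beta> \<gamma> where a: "\<forall>\<^sub>F x in nhds m. f x $ pos p = inner \<alpha> x"
    and b: "\<forall>\<^sub>F x in nhds m. f x $ pos (p + 2) = inner \<beta> x"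
    and c: "\<forall>\<^sub>F x in nhds m. min (f x $ pos p) (f x $ pos (p + 2)) = inner \<gamma> x"
    using lin[of p] lin[of "p + 2"] lin' p by (auto simp: locally_linear_at_def)
  note at = eventually_nhds_x_imp_x[OF a] eventually_nhds_x_imp_x[OF b] eventually_nhds_x_imp_x[OF c]
  have "\<gamma> = \<alpha>"
  proof (rule linear_touching_eq)
    show "\<forall>\<^sub>F x in nhds m. inner \<gamma> x \<le> inner \<alpha> x" using a c by eventually_elim linarith
  qed (use at wall in simp)
  moreover have "\<gamma> = \<beta>"
  proof (rule linear_touching_eq)
    show "\<forall>\<^sub>F x in nhds m. inner \<gamma> x \<le> inner \<beta> x" using b c by eventually_elim linarith
  qed (use at wall in simp)
  ultimately have ab: "\<alpha> = \<beta>" by simp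
  from a b have "\<forall>\<^sub>F x in nhds m. f x $ pos p = f x $ pos (p + 2)"
    by eventually_elim (simp add: ab)
  moreover have "filterlim g (nhds m) (nhds (f m))"
  proof -
    have "isCont g (f m)" using g(1) by (simp add: continuous_on_eq_continuous_at)
    then have "(g \<longlongrightarrow> g (f m)) (nhds (f m))" unfolding isCont_def tendsto_at_iff_tendsto_nhds .
    then show ?thesis by (simp only: g(3))
  qed
  ultimately have "\<forall>\<^sub>F y in nhds (f m). f (g y) $ pos p = f (g y) $ pos (p + 2)"
    by (rule eventually_compose_filterlim)
  then have ev: "\<forall>\<^sub>F y in nhds (f m). y $ pos p = y $ pos (p + 2)" by (simp add: g(2))
  \<comment> \<open>A small step in a coordinate direction leaves the hyperplane.\<close>
  have "((\<lambda>s. f m + s *\<^sub>R axis (pos p) 1) \<longlongrightarrow> f m + 0 *\<^sub>R axis (pos p) 1) (at_right 0)"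
    by (intro tendsto_intros)
  then have "filterlim (\<lambda>s. f m + s *\<^sub>R axis (pos p) 1) (nhds (f m)) (at_right 0)" by simp
  from eventually_compose_filterlim[OF ev this]
  have "\<forall>\<^sub>F s in at_right (0::real). s = 0"
    by eventually_elim (use wall p in \<open>simp add: axis_def pos_eq_iff\<close>)
  moreover have "\<forall>\<^sub>F s in at_right (0::real). 0 < s" by (rule eventually_at_right_less)
  ultimately have "\<forall>\<^sub>F s in at_right (0::real). False" by eventually_elim simp
  then show False by simp
qed

theorem corollary4p4:
  fixes n :: nat and v :: "nat list"
  assumes "CARD('k::{finite,linorder}) = weyl_length n (longest_elt n)"
    and "v \<in> reduced_words n (longest_elt n)"
  shows "is_fan ((pbw_linearity_domains n v :: (real ^ 'k::{finite,linorder}) set set) \<union>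
           {F. \<exists>C \<in> pbw_linearity_domains n v. cone_face F C})"
proof -
  note v = assms(2)
  have len: "length v = CARD('k)" using w0_words_length[OF v] assms(1) by simp
  have lenw: "length w = CARD('k)" if "w \<in> w0_words n" for w using w0_words_length[OF that] assms(1) by simp
  define R :: "nat list \<Rightarrow> real ^ 'k::{finite,linorder} \<Rightarrow> real ^ 'k::{finite,linorder}" where "R = reparam v"
  have R: "braid_moves v w (R w)" if "w \<in> w0_words n" for w
    unfolding R_def reparam_def by (rule someI_ex[OF w0_words_connected[OF v that]])
  have R_eq: "R w = f" if "braid_moves v w f" for w f
    unfolding R_def by (rule reparam_eq[OF v len that])
  define I where "I = w0_words n \<times> {..CARD('k)} \<times> {..n + 1}"
  have "w0_words n \<subseteq> {w. set w \<subseteq> {1..n} \<and> length w = CARD('k)}"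
  proof
    fix w assume w: "w \<in> w0_words n"
    then show "w \<in> {w. set w \<subseteq> {1..n} \<and> length w = CARD('k)}"
      using lenw[OF w] unfolding w0_words_iff by blast
  qed
  then have finI: "finite I"
    unfolding I_def using finite_subset[OF _ finite_lists_length_eq[of "{1..n}" "CARD('k)"]] by blast
  have "\<forall>i \<in> I. \<exists>S e. finite S \<and> S \<noteq> {} \<and> (\<forall>a. inner e (R (fst i) a) = min_linear S a) \<and>
      (\<forall>a Z. realizes n v Z a \<longrightarrow>
        has_trop (\<lambda>x. chamber_minor (Z x) (word_perm (take (fst (snd i)) (fst i))) (snd (snd i))) (min_linear S a))"
  proof
    fix i assume i: "i \<in> I"
    then have "fst i \<in> w0_words n" "fst (snd i) \<le> length (fst i)" "snd (snd i) \<le> n + 1"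
      using lenw by (auto simp: I_def)
    from chamber_minor_concave[OF v len R[OF this(1)] this(2,3)]
    show "\<exists>S e. finite S \<and> S \<noteq> {} \<and> (\<forall>a. inner e (R (fst i) a) = min_linear S a) \<and>
      (\<forall>a Z. realizes n v Z a \<longrightarrow>
        has_trop (\<lambda>x. chamber_minor (Z x) (word_perm (take (fst (snd i)) (fst i))) (snd (snd i))) (min_linear S a))" .
  qed
  then obtain S e where Se: "\<forall>i \<in> I. finite (S i) \<and> S i \<noteq> {} \<and>
      (\<forall>a. inner (e i) (R (fst i) a) = min_linear (S i) a) \<and>
      (\<forall>a Z. realizes n v Z a \<longrightarrow>
        has_trop (\<lambda>x. chamber_minor (Z x) (word_perm (take (fst (snd i)) (fst i))) (snd (snd i))) (min_linear (S i) a))"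
    by metis
  have S1: "finite (S i) \<and> S i \<noteq> {}"
    and S2: "inner (e i) (R (fst i) a) = min_linear (S i) a"
    and S3: "realizes n v Z a \<Longrightarrow> has_trop (\<lambda>x. chamber_minor (Z x)
      (word_perm (take (fst (snd i)) (fst i))) (snd (snd i))) (min_linear (S i) a)"
    if "i \<in> I" for i a Z
    using bspec[OF Se that] by blast+
  define M where "M w k r a = min_linear (S (w, k, r)) a" for w k r a
  have M: "has_trop (\<lambda>x. chamber_minor (Z x) (word_perm (take k w)) r) (M w k r a)"
    if "w \<in> w0_words n" "k \<le> length w" "r \<le> n + 1" "realizes n v Z a" for w k r Z a
  proof -
    have "(w, k, r) \<in> I" using that lenw by (simp add: I_def)
    from S3[OF this that(4)] show ?thesis by (simp add: M_def)
  qed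
  have coord: "R w a $ pos p = M w p (w ! p - 1) a + M w p (w ! p + 1) a - (M w p (w ! p) a + M w (Suc p) (w ! p) a)"
    if "w \<in> w0_words n" "p < CARD('k)" for w p a
    by (rule crossing_coordinate[OF v len R[OF that(1)] _ that(2)]) (rule M[OF that(1)])
  \<comment> \<open>All charts enter one concave function, whose linearity at a point decides regularity.\<close>
  let ?F = "\<lambda>x. \<Sum>i\<in>I. min_linear (S i) x"
  have reg: "pbw_regular n v = {m \<in> positive_orthant. locally_linear_at ?F m}"
  proof (intro equalityI subsetI)
    fix m :: "real ^ 'k::{finite,linorder}" assume m: "m \<in> pbw_regular n v"
    have avoid: "\<forall>H \<in> pbw_walls w. f m \<notin> H" if "braid_moves v w f"
      for w and f :: "real ^ 'k::{finite,linorder} \<Rightarrow> real ^ 'k::{finite,linorder}"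
      using m braid_moves_w0_words[OF that v] R_eq[OF that] by (auto simp: pbw_regular_def R_def)
    have "locally_linear_at (min_linear (S i)) m" if i: "i \<in> I" for i
    proof -
      have fi: "fst i \<in> w0_words n" using i by (auto simp: I_def)
      have "\<exists>A. linear A \<and> (\<forall>\<^sub>F x in nhds m. R (fst i) x = A x)"
        by (rule braid_moves_locally_linear[OF R[OF fi]]) (rule avoid)
      then obtain A where A: "linear A" "\<forall>\<^sub>F x in nhds m. R (fst i) x = A x" by blast
      have "\<forall>\<^sub>F x in nhds m. min_linear (S i) x = inner (adjoint A (e i)) x"
        using A(2)
      proof eventually_elim
        case (elim x)
        have "min_linear (S i) x = inner (e i) (A x)" unfolding S2[OF i, symmetric] elim ..
        then show ?case using adjoint_works[OF A(1), of x "e i"] by (simp add: inner_commute)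
      qed
      then show ?thesis by (auto simp: locally_linear_at_def)
    qed
    then have "locally_linear_at ?F m" by (intro locally_linear_at_sum finI)
    then show "m \<in> {m \<in> positive_orthant. locally_linear_at ?F m}"
      using m by (simp add: pbw_regular_def positive_orthant_def)
  next
    fix m :: "real ^ 'k::{finite,linorder}" assume m: "m \<in> {m \<in> positive_orthant. locally_linear_at ?F m}"
    have lin: "locally_linear_at (min_linear (S i)) m" if "i \<in> I" for i
      by (rule locally_linear_sum_min_linear_imp[OF finI S1 _ that]) (use m in simp_all)
    have linR: "locally_linear_at (\<lambda>x. R w x $ pos p) m" if w: "w \<in> w0_words n" and p: "p < CARD('k)" for w p
    proof -
      have "w ! p \<in> {1..n}" using w0_words_nth[OF w] p lenw[OF w] by simp
      then have "locally_linear_at (M w k r) m" if "k \<le> CARD('k)" "r \<le> n + 1" for k r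
        using lin[of "(w, k, r)"] w that by (simp add: I_def M_def[abs_def])
      moreover have "w ! p \<le> n" "1 \<le> w ! p" using \<open>w ! p \<in> {1..n}\<close> by auto
      ultimately have "locally_linear_at (\<lambda>x. M w p (w ! p - 1) x + M w p (w ! p + 1) x -
          (M w p (w ! p) x + M w (Suc p) (w ! p) x)) m"
        using p by (intro locally_linear_at_diff locally_linear_at_plus) auto
      then show ?thesis by (rule locally_linear_at_cong) (simp add: coord[OF w p])
    qed
    have "R w m \<notin> H" if w: "w \<in> w0_words n" and H: "H \<in> pbw_walls w" for w H
    proof -
      obtain p where p: "p + 2 < length w" "w ! p = w ! (p + 2)" "adjacent (w ! p) (w ! (p + 1))"
        and Heq: "H = {a. a $ pos p = a $ pos (p + 2)}"
        using H unfolding pbw_walls_def by blast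
      define xs ys i j where "xs = take p w" and "ys = drop (p + 3) w" and "i = w ! p" and "j = w ! (p + 1)"
      have lxs: "length xs = p" using p by (simp add: xs_def)
      have wdec: "w = xs @ [i, j, i] @ ys"
      proof -
        have "w = take p w @ drop p w" by simp
        also have "drop p w = w ! p # w ! (p + 1) # w ! (p + 2) # drop (p + 3) w"
          using p(1) by (simp add: Cons_nth_drop_Suc numeral_3_eq_3 numeral_2_eq_2)
        finally show ?thesis using p(2) by (simp add: xs_def ys_def i_def j_def)
      qed
      \<comment> \<open>In the neighbouring chart the minimum of the two coordinates is itself a coordinate.\<close>
      have step: "braid_moves v (xs @ [j, i, j] @ ys) (braid_map (length xs) \<circ> R w)"
      proof (rule braid_moves.braid)
        show "braid_moves v (xs @ [i, j, i] @ ys) (R w)" using R[OF w] by (subst wdec[symmetric])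
        show "adjacent i j" using p(3) by (simp only: i_def j_def)
      qed
      let ?w' = "xs @ [j, i, j] @ ys"
      have w': "?w' \<in> w0_words n" by (rule braid_moves_w0_words[OF step v])
      have pc: "p + 2 < CARD('k)" using p(1) lenw[OF w] by simp
      have "R ?w' = braid_map p \<circ> R w" using R_eq[OF step] lxs by simp
      then have "R ?w' x $ pos (p + 1) = min (R w x $ pos p) (R w x $ pos (p + 2))" for x
        using braid_map_nth(2)[OF pc] by simp
      then have "locally_linear_at (\<lambda>x. min (R w x $ pos p) (R w x $ pos (p + 2))) m"
        using linR[OF w', of "p + 1"] pc by simp
      from locally_linear_imp_off_wall[OF R[OF w] len pc linR[OF w] this]
      show ?thesis by (simp add: Heq)
    qed
    then show "m \<in> pbw_regular n v"
      using m by (simp add: pbw_regular_def positive_orthant_def R_def)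
  qed
  show ?thesis
    unfolding pbw_linearity_domains_def
    by (rule is_fan_linearity_regions[where S = S, OF finI S1 reg])
qed

end
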